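(* Let $A$ be the generator of a $C_0$-semigroup $(T(t))_{t\ge0}$ in a complex Banach space $\mathbb{X}$, let $f\in BUC_C(\mathbb{R}^+,\mathbb{X})$, and let $\sigma_i(A)=\{\xi\in\mathbb{R}: i\xi\in\sigma(A)\}$. Assume that $$sp(f)\cap\overline{\sigma_i(A)\setminus sp(f)}=\emptyset$$ and that at least one of the sets $sp(f)$, $\overline{\sigma_i(A)\setminus sp(f)}$ is bounded (hence compact). If there is an asymptotic mild solution $u\in BUC_C(\mathbb{R}^+,\mathbb{X})$ of the equation $u'(t)=Au(t)+f(t)$, $t\ge0$, then there exists an asymptotic mild solution $w$ of this equation with $$sp(w)\subset sp(f).$$
   Context: Let $\mathbb{R}^+=[0,\infty)$. $BUC(\mathbb{R}^+,\mathbb{X})$ is the Banach space (sup norm) of bounded uniformly continuous functions $\mathbb{R}^+\to\mathbb{X}$. $BUC_C(\mathbb{R}^+,\mathbb{X})$ is its closed subspace of functions with precompact range. $C_0(\mathbb{R}^+,\mathbb{X})$ is its closed subspace of functions $g$ with $\lim_{t\to\infty}g(t)=0$. $\sigma(A)$ is the spectrum of $A$. Spectrum of a function on the half line: let $\mathbb{Y}=BUC(\mathbb{R}^+,\mathbb{X})/C_0(\mathbb{R}^+,\mathbb{X})$ with the quotient norm, and let $\tilde g$ be the class of $g$. Let $\mathcal{D}=d/dt$ in $BUC(\mathbb{R}^+,\mathbb{X})$ with domain $D(\mathcal{D})=\{g\in BUC(\mathbb{R}^+,\mathbb{X}): g' \text{ exists and } g'\in BUC(\mathbb{R}^+,\mathbb{X})\}$.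 The operator $\tilde{\mathcal{D}}$ in $\mathbb{Y}$ has domain consisting of all classes $\tilde g$ that contain some $u\in D(\mathcal{D})$, and $\tilde{\mathcal{D}}\tilde g:=\widetilde{\mathcal{D}u}$ for such a $u$. It is well defined and generates a strongly continuous group of isometries of $\mathbb{Y}$ (the extension of the semigroup induced by the translations $(S(t)g)(\cdot)=g(t+\cdot)$). For $g\in BUC(\mathbb{R}^+,\mathbb{X})$ put $\hat g(\lambda)=(\lambda-\tilde{\mathcal{D}})^{-1}\tilde g$ for $\lambda\in\mathbb{C}\setminus i\mathbb{R}$. The spectrum $sp(g)$ is the set of all $\xi_0\in\mathbb{R}$ such that $\hat g$ has no analytic extension to any neighborhood of $i\xi_0$. Asymptotic mild solution: $u\in BUC(\mathbb{R}^+,\mathbb{X})$ is an asymptotic mild solution of $u'(t)=Au(t)+f(t)$, $t\ge0$, if there is $\varepsilon\in C_0(\mathbb{R}^+,\mathbb{X})$ such that $u(t)=T(t)u(0)+\int_0^tT(t-s)\left(f(s)+\varepsilon(s)\right)ds$ for all $t\ge 0$. *)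

theory Defs
  imports "HOL-Analysis.Analysis"
begin

section \<open>Complex normed spaces\<close>

class scaleC =
  fixes scaleC :: "complex \<Rightarrow> 'a \<Rightarrow> 'a"  (infixr \<open>*\<^sub>C\<close> 75)

class complex_normed_vector = real_normed_vector + scaleC +
  assumes scaleC_add_right: "c *\<^sub>C (x + y) = c *\<^sub>C x + c *\<^sub>C y"
    and scaleC_add_left: "(c + d) *\<^sub>C x = c *\<^sub>C x + d *\<^sub>C x"
    and scaleC_scaleC: "c *\<^sub>C (d *\<^sub>C x) = (c * d) *\<^sub>C x"
    and scaleR_eq_scaleC: "r *\<^sub>R x = complex_of_real r *\<^sub>C x"
    and norm_scaleC: "norm (c *\<^sub>C x) = cmod c * norm x"

class complex_banach = complex_normed_vector + banach

lemma bounded_linear_scaleC: "bounded_linear (\<lambda>x::'a::complex_normed_vector. c *\<^sub>C x)"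
proof (rule bounded_linear_intro[where K="cmod c"])
  show "c *\<^sub>C (r *\<^sub>R x) = r *\<^sub>R (c *\<^sub>C x)" for r and x :: 'a
    by (simp add: scaleR_eq_scaleC scaleC_scaleC mult.commute)
qed (simp_all add: scaleC_add_right norm_scaleC mult.commute)

definition bounded_clinear :: "('a::complex_normed_vector \<Rightarrow> 'b::complex_normed_vector) \<Rightarrow> bool"
  where "bounded_clinear F \<longleftrightarrow> bounded_linear F \<and> (\<forall>c x. F (c *\<^sub>C x) = c *\<^sub>C F x)"

text \<open>Vector-valued analyticity on an open set, as complex differentiability at every point.\<close>

definition vanalytic_on :: "(complex \<Rightarrow> 'a::complex_normed_vector) \<Rightarrow> complex set \<Rightarrow> bool"
  where "vanalytic_on F U \<longleftrightarrow> (\<forall>z\<in>U. \<exists>F'. (F has_derivative (\<lambda>h. h *\<^sub>C F')) (at z))"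


section \<open>Unbounded operators and semigroups\<close>

text \<open>A possibly unbounded operator is a pair of a domain \<open>D\<close> and a map \<open>A\<close> whose values
  outside \<open>D\<close> are irrelevant.\<close>

definition resolvent :: "'a::complex_normed_vector set \<Rightarrow> ('a \<Rightarrow> 'a) \<Rightarrow> complex \<Rightarrow> 'a \<Rightarrow> 'a"
  where "resolvent D A \<mu> = inv_into D (\<lambda>x. \<mu> *\<^sub>C x - A x)"

definition resolvent_set :: "'a::complex_normed_vector set \<Rightarrow> ('a \<Rightarrow> 'a) \<Rightarrow> complex set"
  where "resolvent_set D A =
    {\<mu>. bij_betw (\<lambda>x. \<mu> *\<^sub>C x - A x) D UNIV \<and> bounded_clinear (resolvent D A \<mu>)}"

definition spectrum :: "'a::complex_normed_vector set \<Rightarrow> ('a \<Rightarrow> 'a) \<Rightarrow> complex set"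
  where "spectrum D A = - resolvent_set D A"

definition imag_spectrum :: "'a::complex_normed_vector set \<Rightarrow> ('a \<Rightarrow> 'a) \<Rightarrow> real set"
  where "imag_spectrum D A = {\<xi>. \<i> * complex_of_real \<xi> \<in> spectrum D A}"

definition C0_semigroup :: "(real \<Rightarrow> 'a::complex_normed_vector \<Rightarrow> 'a) \<Rightarrow> bool"
  where "C0_semigroup T \<longleftrightarrow>
    (\<forall>t\<ge>0. bounded_clinear (T t)) \<and>
    T 0 = id \<and>
    (\<forall>s\<ge>0. \<forall>t\<ge>0. T (s + t) = T s \<circ> T t) \<and>
    (\<forall>x. continuous_on {0..} (\<lambda>t. T t x))"

definition is_generator ::
  "(real \<Rightarrow> 'a::complex_normed_vector \<Rightarrow> 'a) \<Rightarrow> 'a set \<Rightarrow> ('a \<Rightarrow> 'a) \<Rightarrow> bool"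
  where "is_generator T D A \<longleftrightarrow>
    D = {x. \<exists>y. ((\<lambda>h. (T h x - x) /\<^sub>R h) \<longlongrightarrow> y) (at_right 0)} \<and>
    (\<forall>x\<in>D. ((\<lambda>h. (T h x - x) /\<^sub>R h) \<longlongrightarrow> A x) (at_right 0))"


section \<open>Function spaces on the half line\<close>

text \<open>A function on the half line is a total function on \<open>real\<close> of which only the values
  on \<open>{0..}\<close> matter.\<close>

definition BUC :: "(real \<Rightarrow> 'a::real_normed_vector) set"
  where "BUC = {g. bounded (g ` {0..}) \<and> uniformly_continuous_on {0..} g}"

definition BUC_C :: "(real \<Rightarrow> 'a::real_normed_vector) set"
  where "BUC_C = {g \<in> BUC. compact (closure (g ` {0..}))}"

definition C0 :: "(real \<Rightarrow> 'a::real_normed_vector) set"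
  where "C0 = {g \<in> BUC. (g \<longlongrightarrow> 0) at_top}"

definition supnorm :: "(real \<Rightarrow> 'a::real_normed_vector) \<Rightarrow> real"
  where "supnorm g = (SUP t\<in>{0..}. norm (g t))"

definition hderiv :: "(real \<Rightarrow> 'a::real_normed_vector) \<Rightarrow> real \<Rightarrow> 'a"
  where "hderiv g t = vector_derivative g (at t within {0..})"

definition D_dom :: "(real \<Rightarrow> 'a::real_normed_vector) set"
  where "D_dom = {g \<in> BUC. (\<forall>t\<ge>0. g differentiable (at t within {0..})) \<and> hderiv g \<in> BUC}"

lemma BUC_0: "(\<lambda>t. 0) \<in> BUC"
  by (auto simp: BUC_def uniformly_continuous_on_const bounded_iff)

lemma BUC_add: "f \<in> BUC \<Longrightarrow> g \<in> BUC \<Longrightarrow> (\<lambda>t. f t + g t) \<in> BUC"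
  by (auto simp: BUC_def intro: uniformly_continuous_on_add bounded_plus_comp)

lemma BUC_bounded_linear: "bounded_linear L \<Longrightarrow> f \<in> BUC \<Longrightarrow> (\<lambda>t. L (f t)) \<in> BUC"
  using bounded_linear_image[of "f ` {0..}" L]
  by (auto simp: BUC_def image_image intro: bounded_linear.uniformly_continuous_on)

lemma BUC_minus: "f \<in> BUC \<Longrightarrow> (\<lambda>t. - f t) \<in> BUC"
  by (rule BUC_bounded_linear[OF bounded_linear_minus[OF bounded_linear_ident]])

lemma BUC_diff: "f \<in> BUC \<Longrightarrow> g \<in> BUC \<Longrightarrow> (\<lambda>t. f t - g t) \<in> BUC"
  using BUC_add[OF _ BUC_minus, of f g] by simp

lemma C0_0: "(\<lambda>t. 0) \<in> C0"
  by (auto simp: C0_def BUC_0)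

lemma C0_add: "f \<in> C0 \<Longrightarrow> g \<in> C0 \<Longrightarrow> (\<lambda>t. f t + g t) \<in> C0"
  by (auto simp: C0_def BUC_add intro: tendsto_add_zero)

lemma C0_bounded_linear: "bounded_linear L \<Longrightarrow> f \<in> C0 \<Longrightarrow> (\<lambda>t. L (f t)) \<in> C0"
  by (auto simp: C0_def BUC_bounded_linear intro: bounded_linear.tendsto_zero)

lemma C0_minus: "f \<in> C0 \<Longrightarrow> (\<lambda>t. - f t) \<in> C0"
  by (rule C0_bounded_linear[OF bounded_linear_minus[OF bounded_linear_ident]])

lemma norm_le_supnorm: "g \<in> BUC \<Longrightarrow> 0 \<le> t \<Longrightarrow> norm (g t) \<le> supnorm g"
  unfolding supnorm_def BUC_def
  by (rule cSUP_upper) (auto simp: bdd_above_norm[symmetric] image_image[symmetric]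
      simp del: bdd_above_norm intro!: bdd_above_norm[THEN iffD2])

lemma supnorm_le: "(\<And>t. 0 \<le> t \<Longrightarrow> norm (g t) \<le> B) \<Longrightarrow> supnorm g \<le> B"
  unfolding supnorm_def by (rule cSUP_least) auto

lemma supnorm_nonneg: "g \<in> BUC \<Longrightarrow> 0 \<le> supnorm g"
  using norm_le_supnorm[of g 0] norm_ge_zero[of "g 0"] by linarith


section \<open>The quotient of BUC by C0\<close>

definition buc_rel :: "(real \<Rightarrow> 'a::real_normed_vector) \<Rightarrow> (real \<Rightarrow> 'a) \<Rightarrow> bool"
  where "buc_rel f g \<longleftrightarrow> f \<in> BUC \<and> g \<in> BUC \<and> (\<lambda>t. f t - g t) \<in> C0"

lemma part_equivp_buc_rel: "part_equivp buc_rel"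
proof (rule part_equivpI)
  show "\<exists>x. buc_rel x x"
    by (rule exI[of _ "\<lambda>t. 0"]) (auto simp: buc_rel_def BUC_0 C0_0)
  show "symp buc_rel"
    by (rule sympI) (auto simp: buc_rel_def dest: C0_minus)
  show "transp buc_rel"
    by (rule transpI) (auto simp: buc_rel_def dest: C0_add)
qed

quotient_type (overloaded) 'a buc_quot = "real \<Rightarrow> 'a::complex_normed_vector" / partial: buc_rel
  morphisms rep_buc_quot buc_class
  by (rule part_equivp_buc_rel)

lemma buc_class_eq_iff: "f \<in> BUC \<Longrightarrow> g \<in> BUC \<Longrightarrow>
    buc_class f = buc_class g \<longleftrightarrow> (\<lambda>t. f t - g t) \<in> C0"
  using Quotient3_rel[OF Quotient3_buc_quot, of f g]
  by (auto simp: buc_rel_def C0_0)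

lemma buc_class_cases: obtains g where "g \<in> BUC" "y = buc_class g"
  using Quotient3_abs_rep[OF Quotient3_buc_quot, of y]
    Quotient3_rep_reflp[OF Quotient3_buc_quot, of y]
  by (auto simp: buc_rel_def)

instantiation buc_quot :: (complex_normed_vector) complex_normed_vector
begin

lift_definition zero_buc_quot :: "'a buc_quot" is "\<lambda>t. 0"
  by (simp add: buc_rel_def BUC_0 C0_0)

lift_definition plus_buc_quot :: "'a buc_quot \<Rightarrow> 'a buc_quot \<Rightarrow> 'a buc_quot"
  is "\<lambda>f g t. f t + g t"
  by (auto simp: buc_rel_def BUC_add add_diff_add intro: C0_add)

lift_definition scaleC_buc_quot :: "complex \<Rightarrow> 'a buc_quot \<Rightarrow> 'a buc_quot"
  is "\<lambda>c g t. c *\<^sub>C g t"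
  by (auto simp: buc_rel_def BUC_bounded_linear[OF bounded_linear_scaleC]
      linear_diff[OF bounded_linear.linear[OF bounded_linear_scaleC], symmetric]
      intro: C0_bounded_linear[OF bounded_linear_scaleC])

lift_definition uminus_buc_quot :: "'a buc_quot \<Rightarrow> 'a buc_quot" is "\<lambda>g t. - g t"
  by (auto simp: buc_rel_def BUC_minus dest: C0_minus)

definition minus_buc_quot :: "'a buc_quot \<Rightarrow> 'a buc_quot \<Rightarrow> 'a buc_quot"
  where "minus_buc_quot x y = x + - y"

definition scaleR_buc_quot :: "real \<Rightarrow> 'a buc_quot \<Rightarrow> 'a buc_quot"
  where "scaleR_buc_quot r x = complex_of_real r *\<^sub>C x"

definition norm_buc_quot :: "'a buc_quot \<Rightarrow> real"
  where "norm_buc_quot y = Inf {supnorm g | g. g \<in> BUC \<and> buc_class g = y}"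

definition dist_buc_quot :: "'a buc_quot \<Rightarrow> 'a buc_quot \<Rightarrow> real"
  where "dist_buc_quot x y = norm (x - y)"

definition sgn_buc_quot :: "'a buc_quot \<Rightarrow> 'a buc_quot"
  where "sgn_buc_quot x = inverse (norm x) *\<^sub>R x"

definition uniformity_buc_quot :: "('a buc_quot \<times> 'a buc_quot) filter"
  where "uniformity_buc_quot = (INF e\<in>{0 <..}. principal {(x, y). dist x y < e})"

definition open_buc_quot :: "'a buc_quot set \<Rightarrow> bool"
  where "open_buc_quot U \<longleftrightarrow> (\<forall>x\<in>U. \<forall>\<^sub>F (x', y) in uniformity. x' = x \<longrightarrow> y \<in> U)"

lemma buc_class_zero: "(0::'a buc_quot) = buc_class (\<lambda>t. 0)"
  by (fact zero_buc_quot.abs_eq)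

lemma buc_class_add:
  "f \<in> BUC \<Longrightarrow> g \<in> BUC \<Longrightarrow> buc_class f + buc_class g = buc_class (\<lambda>t. f t + g t :: 'a)"
  by (rule plus_buc_quot.abs_eq) (auto simp: eq_onp_def buc_rel_def C0_0)

lemma buc_class_scaleC:
  "f \<in> BUC \<Longrightarrow> c *\<^sub>C buc_class f = buc_class (\<lambda>t. c *\<^sub>C f t :: 'a)"
  by (rule scaleC_buc_quot.abs_eq) (auto simp: eq_onp_def buc_rel_def C0_0)

lemma buc_class_minus:
  "f \<in> BUC \<Longrightarrow> - buc_class f = buc_class (\<lambda>t. - f t :: 'a)"
  by (rule uminus_buc_quot.abs_eq) (auto simp: eq_onp_def buc_rel_def C0_0)

lemma norm_buc_class_le: "g \<in> BUC \<Longrightarrow> norm (buc_class g :: 'a buc_quot) \<le> supnorm g"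
  unfolding norm_buc_quot_def
  by (rule cInf_lower) (auto intro!: bdd_belowI[of _ 0] supnorm_nonneg)

lemma norm_buc_quot_approx:
  assumes "e > 0"
  obtains g where "g \<in> BUC" "y = buc_class g" "supnorm g < norm (y :: 'a buc_quot) + e"
proof -
  have "{supnorm g | g. g \<in> BUC \<and> buc_class g = y} \<noteq> {}"
    using buc_class_cases[of y] by blast
  from cInf_lessD[OF this, of "norm y + e"] assms that show ?thesis
    by (auto simp: norm_buc_quot_def)
qed

lemma norm_buc_quot_nonneg: "0 \<le> norm (y :: 'a buc_quot)"
proof -
  have "{supnorm g | g. g \<in> BUC \<and> buc_class g = y} \<noteq> {}"
    using buc_class_cases[of y] by blast
  then show ?thesis
    unfolding norm_buc_quot_def by (rule cInf_greatest) (auto intro: supnorm_nonneg)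
qed

lemma norm_buc_quot_scaleC_le: "norm (c *\<^sub>C (y :: 'a buc_quot)) \<le> cmod c * norm y"
proof (rule field_le_epsilon)
  fix e :: real assume e: "e > 0"
  obtain g where g: "g \<in> BUC" "y = buc_class g" "supnorm g < norm y + e / (cmod c + 1)"
    using norm_buc_quot_approx[of "e / (cmod c + 1)" y] e
    by (metis add_nonneg_pos divide_pos_pos norm_ge_zero zero_less_one)
  have cg: "(\<lambda>t. c *\<^sub>C g t) \<in> BUC"
    by (rule BUC_bounded_linear[OF bounded_linear_scaleC g(1)])
  have "norm (c *\<^sub>C y) \<le> supnorm (\<lambda>t. c *\<^sub>C g t)"
    using norm_buc_class_le[OF cg] by (simp add: g buc_class_scaleC)
  also have "\<dots> \<le> cmod c * supnorm g"
    by (rule supnorm_le) (auto simp: norm_scaleC intro!: mult_left_mono norm_le_supnorm g)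
  also have "\<dots> \<le> cmod c * (norm y + e / (cmod c + 1))"
    using g(3) by (intro mult_left_mono) auto
  also have "\<dots> \<le> cmod c * norm y + e"
  proof -
    have "cmod c * (e / (cmod c + 1)) \<le> (cmod c + 1) * (e / (cmod c + 1))"
      using e by (intro mult_right_mono) auto
    also have "\<dots> = e"
      using norm_ge_zero[of c] by (simp add: add_nonneg_eq_0_iff)
    finally show ?thesis by (simp add: distrib_left)
  qed
  finally show "norm (c *\<^sub>C y) \<le> cmod c * norm y + e" .
qed

instance
proof
  fix a b c :: "'a buc_quot" and r s :: real and k l :: complex and U :: "'a buc_quot set"
  obtain f g h where fgh: "f \<in> BUC" "a = buc_class f" "g \<in> BUC" "b = buc_class g"
      "h \<in> BUC" "c = buc_class h"
    by (metis buc_class_cases)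
  have sc: "(\<lambda>t. k *\<^sub>C q t) \<in> BUC" if "q \<in> BUC" for k and q :: "real \<Rightarrow> 'a"
    by (rule BUC_bounded_linear[OF bounded_linear_scaleC that])
  note rules = fgh sc BUC_add BUC_minus BUC_0 buc_class_add buc_class_minus buc_class_zero
    buc_class_scaleC scaleR_buc_quot_def
  show "a + b + c = a + (b + c)" "a + b = b + a" "0 + a = a"
    by (simp_all add: rules ac_simps)
  show "- a + a = 0"
    by (simp add: rules)
  show "a - b = a + - b"
    by (fact minus_buc_quot_def)
  have kadd: "k *\<^sub>C (a + b) = k *\<^sub>C a + k *\<^sub>C b" for k
    by (simp add: rules scaleC_add_right)
  have kladd: "(k + l) *\<^sub>C a = k *\<^sub>C a + l *\<^sub>C a" for k l
    by (simp add: rules scaleC_add_left)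
  have kl: "k *\<^sub>C l *\<^sub>C a = (k * l) *\<^sub>C a" for k l
    by (simp add: rules scaleC_scaleC)
  have one: "1 *\<^sub>C a = a"
  proof -
    have "1 *\<^sub>C x = x" for x :: 'a
      using scaleR_eq_scaleC[of 1 x] by simp
    then show ?thesis by (simp add: rules)
  qed
  show "k *\<^sub>C (a + b) = k *\<^sub>C a + k *\<^sub>C b" "(k + l) *\<^sub>C a = k *\<^sub>C a + l *\<^sub>C a"
      "k *\<^sub>C l *\<^sub>C a = (k * l) *\<^sub>C a"
    by (fact kadd kladd kl)+
  show "r *\<^sub>R (a + b) = r *\<^sub>R a + r *\<^sub>R b" "(r + s) *\<^sub>R a = r *\<^sub>R a + s *\<^sub>R a"
      "r *\<^sub>R s *\<^sub>R a = (r * s) *\<^sub>R a" "1 *\<^sub>R a = a"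
    by (simp_all add: scaleR_buc_quot_def kadd kladd kl one)
  show "r *\<^sub>R a = complex_of_real r *\<^sub>C a"
    by (fact scaleR_buc_quot_def)
  show "dist a b = norm (a - b)"
    by (fact dist_buc_quot_def)
  show "sgn a = inverse (norm a) *\<^sub>R a"
    by (fact sgn_buc_quot_def)
  show "uniformity = (INF e\<in>{0 <..}. principal {(x, y :: 'a buc_quot). dist x y < e})"
    by (fact uniformity_buc_quot_def)
  show "open U = (\<forall>x\<in>U. \<forall>\<^sub>F (x', y) in uniformity. x' = x \<longrightarrow> y \<in> U)"
    by (fact open_buc_quot_def)
  show normC: "norm (k *\<^sub>C a) = cmod k * norm a" for k
  proof (rule antisym[OF norm_buc_quot_scaleC_le])
    show "cmod k * norm a \<le> norm (k *\<^sub>C a)"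
    proof (cases "k = 0")
      case False
      have "norm (inverse k *\<^sub>C k *\<^sub>C a) \<le> cmod (inverse k) * norm (k *\<^sub>C a)"
        by (rule norm_buc_quot_scaleC_le)
      then show ?thesis
        using False by (simp add: kl one norm_divide field_simps)
    qed (simp add: norm_buc_quot_nonneg)
  qed
  show "norm (r *\<^sub>R a) = \<bar>r\<bar> * norm a"
    by (simp add: scaleR_buc_quot_def normC)
  show "norm (a + b) \<le> norm a + norm b"
  proof (rule field_le_epsilon)
    fix e :: real assume "e > 0"
    then have e: "e / 2 > 0" by simp
    obtain p where p: "p \<in> BUC" "a = buc_class p" "supnorm p < norm a + e / 2"
      using norm_buc_quot_approx[OF e] .
    obtain q where q: "q \<in> BUC" "b = buc_class q" "supnorm q < norm b + e / 2"
      using norm_buc_quot_approx[OF e] .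
    have "norm (a + b) \<le> supnorm (\<lambda>t. p t + q t)"
      using norm_buc_class_le[OF BUC_add[OF p(1) q(1)]] by (simp add: p q buc_class_add)
    also have "\<dots> \<le> supnorm p + supnorm q"
      by (rule supnorm_le) (auto intro!: norm_triangle_mono norm_le_supnorm p q)
    finally show "norm (a + b) \<le> norm a + norm b + e"
      using p(3) q(3) by linarith
  qed
  show "norm a = 0 \<longleftrightarrow> a = 0"
  proof
    assume "a = 0"
    then have "norm a \<le> supnorm (\<lambda>t. 0 :: 'a)"
      using norm_buc_class_le[OF BUC_0] by (simp add: buc_class_zero)
    also have "\<dots> \<le> 0"
      by (rule supnorm_le) simp
    finally show "norm a = 0"
      using norm_buc_quot_nonneg[of a] by linarith
  next
    assume a0: "norm a = 0"
    have "\<forall>\<^sub>F t in at_top. norm (f t) < e" if "e > 0" for e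
    proof -
      have e: "e / 2 > 0" using that by simp
      obtain p where p: "p \<in> BUC" "a = buc_class p" "supnorm p < norm a + e / 2"
        using norm_buc_quot_approx[OF e] .
      have "((\<lambda>t. f t - p t) \<longlongrightarrow> 0) at_top"
        using p(1,2) fgh(1,2) buc_class_eq_iff[of f p] by (simp add: C0_def)
      then have "\<forall>\<^sub>F t in at_top. norm (f t - p t) < e / 2"
        using e by (simp only: tendsto_iff dist_0_norm diff_zero dist_norm)
      then show ?thesis
        using eventually_ge_at_top[of 0]
      proof eventually_elim
        case (elim t)
        have "norm (f t) \<le> norm (f t - p t) + norm (p t)"
          using norm_triangle_sub[of "f t" "p t"] by simp
        then show ?case
          using elim norm_le_supnorm[OF p(1) elim(2)] p(3) a0 by linarith
      qed
    qed
    then have "(f \<longlongrightarrow> 0) at_top"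
      by (simp add: tendsto_iff)
    then show "a = 0"
      using fgh by (simp add: buc_class_zero buc_class_eq_iff BUC_0 C0_def)
  qed
qed

end


section \<open>The spectrum of a function on the half line\<close>

definition D_quot_dom :: "'a::complex_normed_vector buc_quot set"
  where "D_quot_dom = buc_class ` D_dom"

text \<open>Two members of \<open>D_dom\<close> in the same class have derivatives in the same class, so the value
  does not depend on the choice of \<open>u\<close>.\<close>

definition D_quot :: "'a::complex_normed_vector buc_quot \<Rightarrow> 'a buc_quot"
  where "D_quot y = buc_class (hderiv (SOME u. u \<in> D_dom \<and> buc_class u = y))"

definition transform :: "(real \<Rightarrow> 'a::complex_normed_vector) \<Rightarrow> complex \<Rightarrow> 'a buc_quot"
  where "transform g \<mu> = resolvent D_quot_dom D_quot \<mu> (buc_class g)"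

definition sp :: "(real \<Rightarrow> 'a::complex_normed_vector) \<Rightarrow> real set"
  where "sp g = {\<xi>. \<not> (\<exists>U F. open U \<and> \<i> * complex_of_real \<xi> \<in> U \<and> vanalytic_on F U \<and>
    (\<forall>\<mu>\<in>U. Re \<mu> \<noteq> 0 \<longrightarrow> F \<mu> = transform g \<mu>))}"


section \<open>Asymptotic mild solutions\<close>

definition asymptotic_mild_solution ::
  "(real \<Rightarrow> 'a::complex_banach \<Rightarrow> 'a) \<Rightarrow> (real \<Rightarrow> 'a) \<Rightarrow> (real \<Rightarrow> 'a) \<Rightarrow> bool"
  where "asymptotic_mild_solution T f u \<longleftrightarrow> u \<in> BUC \<and>
    (\<exists>\<epsilon>\<in>C0. \<forall>t\<ge>0. u t = T t (u 0) + integral {0..t} (\<lambda>s. T (t - s) (f s + \<epsilon> s)))"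

end

theory Submission
  imports Defs "HOL-Complex_Analysis.Complex_Analysis"
begin

text \<open>The argument takes place in the quotient \<open>Y = BUC / C\<^sub>0\<close>, where the resolvent \<open>R\<close> of
  differentiation exists off the imaginary axis with \<open>norm (R z) \<le> 1 / \<bar>Re z\<bar>\<close>.  A class \<open>y\<close> whose spectrum
  splits into a compact \<open>K\<close> and a disjoint closed \<open>L\<close> is projected onto the \<open>K\<close>-part by integrating
  \<open>R z y / (2 \<pi> i)\<close> over rectangles symmetric to the axis that enclose \<open>K\<close> and cross the axis outside
  \<open>K \<union> L\<close>, where \<open>R z y\<close> extends analytically; a class with empty spectrum is \<open>0\<close> by a Liouville argument.
  If \<open>u\<close> is an asymptotic mild solution and \<open>m \<in> \<rho>(A)\<close>, then
  \<open>R z u = (m - A)\<^sup>-\<^sup>1 (R z f + u + (m - z) R z u)\<close> in \<open>Y\<close>.  This identity confines the spectrum of \<open>u\<close> to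
  \<open>sp f \<union> \<sigma>\<^sub>i(A)\<close>, and it commutes with the projection.  The projected classes lie in the domain of every power
  of differentiation, which makes it possible to pass back from the identity to a genuine mild solution.\<close>

section \<open>Vector-valued complex differentiation\<close>

text \<open>Finitely many rectangles enclose only a compact part of the spectrum, and only classes
  carried by such a part are shown to be smooth; this decides which class becomes a solution. If
  \<open>sp f\<close> is compact, u is projected onto \<open>sp f\<close>, and f is its own
  projection. Otherwise the remaining part L is compact: projecting onto it kills f and gives a
  solution x of the homogeneous equation, and u - x is the answer, with no smoothness needed for u -
  x itself. Classes are projected one at a time: where the contour crosses the axis no resolvent
  operator is at hand, only the continued function z -> R z y. Identities there are limits of
  identities off the axis. A mild solution need not take values in the domain of A, so the equation
  cannot be read pointwise for u. R(-1) repairs this: it sends u to the class of -e^(-t) times the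
  integral of e^s u(s) over [0,t], whose values lie in that domain. The term e^(-t) u(0) left over
  dies in the quotient. The single point -1 suffices, since the resolvent identity carries the
  relation to all z off the axis.\<close>

instantiation complex :: complex_banach
begin
text \<open>With the scalars as an instance, Cauchy kernels and vector-valued resolvents share the
  same integral \<open>rint\<close>.\<close>

definition scaleC_complex :: "complex \<Rightarrow> complex \<Rightarrow> complex"
  where [simp]: "scaleC_complex = (*)"
instance
  by standard (auto simp: algebra_simps norm_mult scaleR_conv_of_real)
end

lemma scaleC_one [simp]: "1 *\<^sub>C x = (x :: 'a::complex_normed_vector)"
  using scaleR_eq_scaleC[of 1 x] by simp

lemma bounded_bilinear_scaleC: "bounded_bilinear (\<lambda>c (x::'a::complex_normed_vector). c *\<^sub>C x)"
proof
  show "(r *\<^sub>R c) *\<^sub>C x = r *\<^sub>R (c *\<^sub>C x)" for r c and x :: 'a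
    by (simp add: scaleR_eq_scaleC scaleC_scaleC scaleR_conv_of_real)
  show "c *\<^sub>C (r *\<^sub>R x) = r *\<^sub>R (c *\<^sub>C x)" for r c and x :: 'a
    by (simp add: scaleR_eq_scaleC scaleC_scaleC mult.commute)
  show "\<exists>K. \<forall>c (x::'a). norm (c *\<^sub>C x) \<le> norm c * norm x * K"
    by (rule exI[of _ 1]) (simp add: norm_scaleC)
qed (simp_all add: scaleC_add_right scaleC_add_left)

interpretation scaleC: bounded_bilinear "\<lambda>c (x::'a::complex_normed_vector). c *\<^sub>C x"
  by (rule bounded_bilinear_scaleC)

lemmas scaleC_tendsto [tendsto_intros] = scaleC.tendsto
lemmas scaleC_continuous [continuous_intros] = scaleC.continuous scaleC.continuous_on
lemmas scaleC_zero [simp] = scaleC.zero_left scaleC.zero_right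

lemma scaleC_minus [simp]:
  "(- c) *\<^sub>C x = - (c *\<^sub>C x)" "c *\<^sub>C (- x) = - (c *\<^sub>C (x :: 'a::complex_normed_vector))"
  by (fact scaleC.minus_left scaleC.minus_right)+

lemma scaleC_eq_0_iff [simp]: "c *\<^sub>C x = 0 \<longleftrightarrow> c = 0 \<or> x = (0 :: 'a::complex_normed_vector)"
  using norm_scaleC[of c x] by (metis mult_eq_0_iff norm_eq_zero)

lemma scaleC_cancel_left:
  "c \<noteq> 0 \<Longrightarrow> c *\<^sub>C x = c *\<^sub>C y \<longleftrightarrow> x = (y :: 'a::complex_normed_vector)"
  by (metis diff_eq_diff_eq right_minus_eq scaleC.diff_right scaleC_eq_0_iff)

lemma scaleC_scaleR_commute: "c *\<^sub>C r *\<^sub>R x = r *\<^sub>R c *\<^sub>C (x :: 'a::complex_normed_vector)"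
  by (fact scaleC.scaleR_right)

lemma bounded_clinearD:
  assumes "bounded_clinear F"
  shows "bounded_linear F" "F (c *\<^sub>C x) = c *\<^sub>C F x" "F (x + y) = F x + F y" "F (x - y) = F x - F y"
    "F 0 = 0" "F (- x) = - F x"
  using assms linear_add[of F] linear_diff[of F] linear_0[of F] linear_neg[of F]
  by (auto simp: bounded_clinear_def dest: bounded_linear.linear)

text \<open>Bridges the Frechet form used in \<open>vanalytic_on\<close> and difference quotients;
  \<open>vanalytic_fixpoint\<close> feeds the quotient of its data into a solution operator.\<close>

lemma has_cderivative_quotient_iff:
  fixes F :: "complex \<Rightarrow> 'a::complex_normed_vector"
  shows "(F has_derivative (\<lambda>h. h *\<^sub>C F')) (at w) \<longleftrightarrow> ((\<lambda>z. (1 / (z - w)) *\<^sub>C (F z - F w)) \<longlongrightarrow> F') (at w)"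
proof -
  have eq: "norm (F z - F w - (z - w) *\<^sub>C F') / norm (z - w) = norm ((1 / (z - w)) *\<^sub>C (F z - F w) - F')"
    if "z \<noteq> w" for z
  proof -
    have "(1 / (z - w)) *\<^sub>C (F z - F w) - F' = (1 / (z - w)) *\<^sub>C (F z - F w - (z - w) *\<^sub>C F')"
      using that by (simp add: scaleC.diff_right scaleC_scaleC)
    then show ?thesis by (simp add: norm_scaleC norm_divide)
  qed
  have "(F has_derivative (\<lambda>h. h *\<^sub>C F')) (at w) \<longleftrightarrow>
      ((\<lambda>z. norm (F z - F w - (z - w) *\<^sub>C F') / norm (z - w)) \<longlongrightarrow> 0) (at w)"
    by (simp add: has_derivative_iff_norm scaleC.bounded_linear_left)
  also have "\<dots> \<longleftrightarrow> ((\<lambda>z. norm ((1 / (z - w)) *\<^sub>C (F z - F w) - F')) \<longlongrightarrow> 0) (at w)"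
    by (rule tendsto_cong) (use eq eventually_neq_at_within[of w w UNIV] in \<open>auto elim: eventually_mono\<close>)
  also have "\<dots> \<longleftrightarrow> ((\<lambda>z. (1 / (z - w)) *\<^sub>C (F z - F w)) \<longlongrightarrow> F') (at w)"
    by (simp add: tendsto_norm_zero_iff LIM_zero_iff)
  finally show ?thesis .
qed

text \<open>Caratheodory's form of the derivative: an algebraic identity for increments plus a limit
  of the slope function. Resolvents, kernel integrals and fixed points all obtain their analyticity
  in this way.\<close>

lemma caratheodory_has_derivative:
  fixes F :: "complex \<Rightarrow> 'a::complex_normed_vector"
  assumes "open U" "w \<in> U" "\<And>z. z \<in> U \<Longrightarrow> F z - F w = (z - w) *\<^sub>C G z" "(G \<longlongrightarrow> F') (at w)"
  shows "(F has_derivative (\<lambda>h. h *\<^sub>C F')) (at w)"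
  unfolding has_cderivative_quotient_iff
proof (rule Lim_transform_eventually[OF assms(4)])
  show "\<forall>\<^sub>F z in at w. G z = (1 / (z - w)) *\<^sub>C (F z - F w)"
    using eventually_at_in_open'[OF assms(1,2)] eventually_neq_at_within[of w w UNIV]
    by eventually_elim (simp add: assms(3) scaleC_scaleC)
qed

lemma has_cderivative_scaleC:
  fixes F :: "complex \<Rightarrow> 'a::complex_normed_vector"
  assumes "(h has_field_derivative h') (at z)" "(F has_derivative (\<lambda>k. k *\<^sub>C F')) (at z)"
  shows "((\<lambda>z. h z *\<^sub>C F z) has_derivative (\<lambda>k. k *\<^sub>C (h z *\<^sub>C F' + h' *\<^sub>C F z))) (at z)"
  using scaleC.FDERIV[OF assms(1)[unfolded has_field_derivative_def] assms(2)]
  by (simp add: scaleC_add_right scaleC_scaleC mult.commute)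

lemma has_cderivative_bounded_clinear:
  assumes "bounded_clinear L" "(F has_derivative (\<lambda>k. k *\<^sub>C F')) (at z)"
  shows "((\<lambda>z. L (F z)) has_derivative (\<lambda>k. k *\<^sub>C L F')) (at z)"
  using bounded_linear.has_derivative[OF bounded_clinearD(1)[OF assms(1)] assms(2)]
  by (simp add: bounded_clinearD[OF assms(1)])

lemma vanalytic_onD_continuous: "vanalytic_on F U \<Longrightarrow> z \<in> U \<Longrightarrow> isCont F z"
  unfolding vanalytic_on_def by (blast dest: has_derivative_continuous)

lemma vanalytic_on_const: "vanalytic_on (\<lambda>z. x) U"
  unfolding vanalytic_on_def by (auto intro!: exI[of _ 0])

lemma vanalytic_on_add: "vanalytic_on F U \<Longrightarrow> vanalytic_on G U \<Longrightarrow> vanalytic_on (\<lambda>z. F z + G z) U"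
  unfolding vanalytic_on_def
proof
  fix z assume "\<forall>z\<in>U. \<exists>F'. (F has_derivative (\<lambda>h. h *\<^sub>C F')) (at z)"
    "\<forall>z\<in>U. \<exists>G'. (G has_derivative (\<lambda>h. h *\<^sub>C G')) (at z)" "z \<in> U"
  then obtain F' G' where "(F has_derivative (\<lambda>h. h *\<^sub>C F')) (at z)"
    "(G has_derivative (\<lambda>h. h *\<^sub>C G')) (at z)"
    by blast
  from has_derivative_add[OF this]
  show "\<exists>F'. ((\<lambda>z. F z + G z) has_derivative (\<lambda>h. h *\<^sub>C F')) (at z)"
    by (auto simp: scaleC_add_right[symmetric])
qed

lemma vanalytic_on_bounded_clinear:
  "bounded_clinear L \<Longrightarrow> vanalytic_on F U \<Longrightarrow> vanalytic_on (\<lambda>z. L (F z)) U"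
  unfolding vanalytic_on_def by (blast intro: has_cderivative_bounded_clinear)

lemma vanalytic_on_subset: "vanalytic_on F U \<Longrightarrow> V \<subseteq> U \<Longrightarrow> vanalytic_on F V"
  unfolding vanalytic_on_def by blast

lemma vanalytic_on_cong:
  assumes "open U" "vanalytic_on F U" "\<And>z. z \<in> U \<Longrightarrow> F z = G z"
  shows "vanalytic_on G U"
  unfolding vanalytic_on_def
proof
  fix z assume "z \<in> U"
  then obtain F' where "(F has_derivative (\<lambda>h. h *\<^sub>C F')) (at z)"
    using assms(2) by (auto simp: vanalytic_on_def)
  then have "(G has_derivative (\<lambda>h. h *\<^sub>C F')) (at z)"
    by (rule has_derivative_transform_within_open[OF _ assms(1) \<open>z \<in> U\<close> assms(3)])
  then show "\<exists>F'. (G has_derivative (\<lambda>h. h *\<^sub>C F')) (at z)" ..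
qed

lemma integral_scaleC:
  fixes F :: "real \<Rightarrow> 'a::complex_normed_vector"
  assumes "F integrable_on S"
  shows "integral S (\<lambda>t. c *\<^sub>C F t) = c *\<^sub>C integral S F"
  using integral_linear[OF assms bounded_linear_scaleC, of c] by (simp add: o_def)

lemma integral_scaleC_right:
  fixes x :: "'a::complex_normed_vector"
  assumes "h integrable_on S"
  shows "integral S (\<lambda>t::real. h t *\<^sub>C x) = integral S h *\<^sub>C x"
  using integral_linear[OF assms scaleC.bounded_linear_left, of x] by (simp add: o_def)

section \<open>Integrals over rectangles symmetric to the imaginary axis\<close>

text \<open>The counterclockwise contour integral over the boundary of [-c,c] x [a,b], with opposite
  sides paired. Real integrals make it meaningful for vector values.\<close>

definition rint :: "real \<Rightarrow> real \<Rightarrow> real \<Rightarrow> (complex \<Rightarrow> 'a::complex_banach) \<Rightarrow> 'a"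
  where "rint a b c F =
    \<i> *\<^sub>C integral {a..b} (\<lambda>y. F (Complex c y) - F (Complex (- c) y)) +
    integral {- c..c} (\<lambda>x. F (Complex x a) - F (Complex x b))"

definition rect_boundary :: "real \<Rightarrow> real \<Rightarrow> real \<Rightarrow> complex set"
  where "rect_boundary a b c =
    {z. \<bar>Re z\<bar> = c \<and> Im z \<in> {a..b} \<or> \<bar>Re z\<bar> \<le> c \<and> (Im z = a \<or> Im z = b)}"

lemma continuous_on_rect_sides:
  assumes "continuous_on (rect_boundary a b c) F" "c \<ge> 0" "a \<le> b"
  shows "continuous_on {a..b} (\<lambda>y. F (Complex c y))" "continuous_on {a..b} (\<lambda>y. F (Complex (- c) y))"
    "continuous_on {- c..c} (\<lambda>x. F (Complex x a))" "continuous_on {- c..c} (\<lambda>x. F (Complex x b))"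
  using assms(2,3) unfolding Complex_eq
  by (auto intro!: continuous_on_compose2[OF assms(1)] continuous_intros simp: rect_boundary_def)

lemma rect_sides_integrable:
  fixes F :: "complex \<Rightarrow> 'a::complex_banach"
  assumes "continuous_on (rect_boundary a b c) F" "c \<ge> 0" "a \<le> b"
  shows "(\<lambda>y. F (Complex c y) - F (Complex (- c) y)) integrable_on {a..b}"
    "(\<lambda>x. F (Complex x a) - F (Complex x b)) integrable_on {- c..c}"
  using continuous_on_rect_sides[OF assms]
  by (safe intro!: integrable_continuous_interval continuous_on_diff)

lemma rint_cong:
  assumes "\<And>z. z \<in> rect_boundary a b c \<Longrightarrow> F z = G z" "c \<ge> 0" "a \<le> b"
  shows "rint a b c F = rint a b c G"
proof -
  have "integral {a..b} (\<lambda>y. F (Complex c y) - F (Complex (- c) y)) =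
      integral {a..b} (\<lambda>y. G (Complex c y) - G (Complex (- c) y))"
    using assms(2,3)
    by (intro integral_cong arg_cong2[of _ _ _ _ "(-)"] assms(1)) (auto simp: rect_boundary_def)
  moreover have "integral {- c..c} (\<lambda>x. F (Complex x a) - F (Complex x b)) =
      integral {- c..c} (\<lambda>x. G (Complex x a) - G (Complex x b))"
    using assms(2,3)
    by (intro integral_cong arg_cong2[of _ _ _ _ "(-)"] assms(1)) (auto simp: rect_boundary_def)
  ultimately show ?thesis by (simp add: rint_def)
qed

lemma rint_bounded_clinear:
  assumes "continuous_on (rect_boundary a b c) F" "c \<ge> 0" "a \<le> b" "bounded_clinear L"
  shows "rint a b c (\<lambda>z. L (F z)) = L (rint a b c F)"
  using integral_linear[OF rect_sides_integrable(1)[OF assms(1-3)] bounded_clinearD(1)[OF assms(4)]]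
    integral_linear[OF rect_sides_integrable(2)[OF assms(1-3)] bounded_clinearD(1)[OF assms(4)]]
  by (simp add: rint_def bounded_clinearD[OF assms(4)] o_def)

lemma rint_add:
  assumes "continuous_on (rect_boundary a b c) F" "continuous_on (rect_boundary a b c) G"
    "c \<ge> 0" "a \<le> b"
  shows "rint a b c (\<lambda>z. F z + G z) = rint a b c F + rint a b c G"
proof -
  have *: "(F z + G z) - (F w + G w) = (F z - F w) + (G z - G w)" for z w
    by simp
  show ?thesis
    unfolding rint_def *
    using rect_sides_integrable[OF assms(1,3,4)] rect_sides_integrable[OF assms(2,3,4)]
    by (simp add: integral_add scaleC_add_right)
qed

lemma rint_scaleC_const:
  assumes "continuous_on (rect_boundary a b c) h" "c \<ge> 0" "a \<le> b"
  shows "rint a b c (\<lambda>z. h z *\<^sub>C x) = rint a b c h *\<^sub>C x"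
  unfolding rint_def
  using rect_sides_integrable[OF assms]
  by (simp add: integral_scaleC_right scaleC.diff_left[symmetric] scaleC_add_left scaleC_scaleC)

lemma rint_const: "rint a b c (\<lambda>z. x) = 0"
  by (simp add: rint_def)

text \<open>The common horizontal side is traversed in opposite directions and cancels. This lets an
  end point of a contour move through a spectral gap.\<close>

lemma rint_combine:
  fixes F :: "complex \<Rightarrow> 'a::complex_banach"
  assumes "continuous_on (rect_boundary a b c) F" "continuous_on (rect_boundary b d c) F"
    "c \<ge> 0" "a \<le> b" "b \<le> d"
  shows "rint a b c F + rint b d c F = rint a d c F"
proof -
  note ab = continuous_on_rect_sides[OF assms(1,3,4)] and bd = continuous_on_rect_sides[OF assms(2,3,5)]
  let ?g = "\<lambda>y. F (Complex c y) - F (Complex (- c) y)"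
  have g: "continuous_on {a..b} ?g" "continuous_on {b..d} ?g"
    by (intro continuous_intros ab bd)+
  have "continuous_on ({a..b} \<union> {b..d}) ?g"
    by (rule continuous_on_closed_Un) (use g in auto)
  moreover have "{a..b} \<union> {b..d} = {a..d}"
    using assms by auto
  ultimately have "?g integrable_on {a..d}"
    by (simp add: integrable_continuous_interval)
  then have "integral {a..b} ?g + integral {b..d} ?g = integral {a..d} ?g"
    by (rule Henstock_Kurzweil_Integration.integral_combine[OF assms(4,5)])
  moreover have "integral {- c..c} (\<lambda>x. F (Complex x a) - F (Complex x b)) +
      integral {- c..c} (\<lambda>x. F (Complex x b) - F (Complex x d)) =
      integral {- c..c} (\<lambda>x. F (Complex x a) - F (Complex x d))"
    using ab bd
    by (subst integral_add[symmetric]) (simp_all add: integrable_continuous_interval continuous_on_diff)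
  ultimately show ?thesis
    by (simp add: rint_def scaleC_add_right[symmetric] algebra_simps)
qed

lemma norm_rint_le:
  assumes "continuous_on (rect_boundary a b c) F" "c \<ge> 0" "a \<le> b"
    and "\<And>z. z \<in> rect_boundary a b c \<Longrightarrow> norm (F z) \<le> B"
  shows "norm (rint a b c F) \<le> 2 * B * (b - a) + 2 * B * (2 * c)"
proof -
  note sides = continuous_on_rect_sides[OF assms(1-3)]
  have "norm (integral {a..b} (\<lambda>y. F (Complex c y) - F (Complex (- c) y))) \<le> 2 * B * (b - a)"
  proof (rule integral_bound)
    show "norm (F (Complex c y) - F (Complex (- c) y)) \<le> 2 * B" if "y \<in> {a..b}" for y
    proof -
      have "norm (F (Complex c y)) \<le> B" "norm (F (Complex (- c) y)) \<le> B"
        using that assms(2,3) by (auto intro!: assms(4) simp: rect_boundary_def)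
      then show ?thesis
        using norm_triangle_ineq4[of "F (Complex c y)" "F (Complex (- c) y)"] by linarith
    qed
  qed (use assms(2,3) sides in \<open>simp_all add: continuous_on_diff\<close>)
  moreover have "norm (integral {- c..c} (\<lambda>x. F (Complex x a) - F (Complex x b))) \<le> 2 * B * (c - - c)"
  proof (rule integral_bound)
    show "norm (F (Complex x a) - F (Complex x b)) \<le> 2 * B" if "x \<in> {- c..c}" for x
    proof -
      have "norm (F (Complex x a)) \<le> B" "norm (F (Complex x b)) \<le> B"
        using that assms(2,3) by (auto intro!: assms(4) simp: rect_boundary_def)
      then show ?thesis
        using norm_triangle_ineq4[of "F (Complex x a)" "F (Complex x b)"] by linarith
    qed
  qed (use assms(2,3) sides in \<open>simp_all add: continuous_on_diff\<close>)
  ultimately show ?thesis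
    unfolding rint_def
    by (intro norm_triangle_le) (simp add: norm_scaleC)
qed

text \<open>Winding numbers are needed for scalar kernels only; the vector-valued factors come out
  of the integral through the resolvent identity.\<close>

lemma has_contour_integral_rectpath_imp_rint:
  assumes "(h has_contour_integral I) (rectpath (Complex (- c) a) (Complex c b))"
    and "continuous_on (rect_boundary a b c) h" "c > 0" "a < b"
  shows "rint a b c h = I"
proof -
  note sides = continuous_on_rect_sides[OF assms(2)]
  have Hor: "contour_integral (linepath (Complex (- c) v) (Complex c v)) h =
      integral {- c..c} (\<lambda>x. h (Complex x v))" for v
  proof -
    have "contour_integral (linepath (Complex (- c) v) (Complex c v)) h =
        contour_integral (linepath (of_real (- c)) (of_real c)) (\<lambda>z. h (z + \<i> * of_real v))"
      by (simp add: contour_integral_integral linepath_def Complex_eq algebra_simps scaleR_conv_of_real)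
    also have "\<dots> = integral {- c..c} (\<lambda>x. h (Complex x v))"
      using assms(3) by (subst contour_integral_linepath_Reals_eq) (auto simp: Complex_eq)
    finally show ?thesis .
  qed
  have Ver: "contour_integral (linepath (Complex u a) (Complex u b)) h =
      \<i> * integral {a..b} (\<lambda>y. h (Complex u y))" for u
    by (rule contour_integral_linepath_same_Re) (use assms in auto)
  let ?l1 = "linepath (Complex (- c) a) (Complex c a)" and ?l2 = "linepath (Complex c a) (Complex c b)"
    and ?l3 = "linepath (Complex c b) (Complex (- c) b)" and ?l4 = "linepath (Complex (- c) b) (Complex (- c) a)"
  have ci: "h contour_integrable_on ?l1" "h contour_integrable_on ?l2" "h contour_integrable_on ?l3"
      "h contour_integrable_on ?l4"
    using assms(3,4)
    by (auto intro!: contour_integrable_continuous_linepath continuous_on_subset[OF assms(2)]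
        simp: rect_boundary_def closed_segment_same_Re closed_segment_same_Im closed_segment_eq_real_ivl)
  have "I = contour_integral (?l1 +++ ?l2 +++ ?l3 +++ ?l4) h"
    using contour_integral_unique[OF assms(1)] by (simp add: rectpath_def Let_def)
  also have "\<dots> = contour_integral ?l1 h + (contour_integral ?l2 h +
      (contour_integral ?l3 h + contour_integral ?l4 h))"
    using ci by (simp add: contour_integrable_join)
  also have "\<dots> = contour_integral ?l1 h + (contour_integral ?l2 h -
      (contour_integral (linepath (Complex (- c) b) (Complex c b)) h +
       contour_integral (linepath (Complex (- c) a) (Complex (- c) b)) h))"
    using contour_integral_reverse_linepath[of "Complex (- c) b" "Complex c b" h]
      contour_integral_reverse_linepath[of "Complex (- c) a" "Complex (- c) b" h]
      contour_integrable_continuous_linepath ci contour_integral_reversepath[of "linepath (Complex (- c) b) (Complex c b)" h]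
      contour_integral_reversepath[of "linepath (Complex (- c) a) (Complex (- c) b)" h]
    by (simp add: algebra_simps)
  also have "\<dots> = rint a b c h"
    unfolding Hor Ver rint_def using sides assms(3,4)
    by (simp add: integral_diff integrable_continuous_interval algebra_simps)
  finally show ?thesis ..
qed

lemma rect_boundary_eq_path_image:
  assumes "c > 0" "a < b"
  shows "path_image (rectpath (Complex (- c) a) (Complex c b)) = rect_boundary a b c"
  using assms
  by (subst path_image_rectpath) (auto simp: rect_boundary_def abs_if)

text \<open>The entire factor \<open>h\<close> is 1 for the projections and the weight
  \<open>1 + z^2 / N^2\<close> in the Liouville argument.\<close>

lemma rint_Cauchy_formula:
  assumes "h holomorphic_on UNIV" "c > 0" "a < b" "\<bar>Re \<mu>\<bar> < c" "a < Im \<mu>" "Im \<mu> < b"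
  shows "rint a b c (\<lambda>z. h z / (z - \<mu>)) = 2 * pi * \<i> * h \<mu>"
proof (rule has_contour_integral_rectpath_imp_rint)
  have box: "\<mu> \<in> box (Complex (- c) a) (Complex c b)"
    using assms by (auto simp: in_box_complex_iff)
  have "((\<lambda>z. h z / (z - \<mu>)) has_contour_integral
      (2 * pi * \<i> * winding_number (rectpath (Complex (- c) a) (Complex c b)) \<mu> * h \<mu>))
      (rectpath (Complex (- c) a) (Complex c b))"
    by (rule Cauchy_integral_formula_convex_simple[of UNIV])
      (use assms in \<open>auto simp: rect_boundary_eq_path_image rect_boundary_def\<close>)
  then show "((\<lambda>z. h z / (z - \<mu>)) has_contour_integral (2 * pi * \<i> * h \<mu>))
      (rectpath (Complex (- c) a) (Complex c b))"
    using box by (simp add: winding_number_rectpath)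
  show "continuous_on (rect_boundary a b c) (\<lambda>z. h z / (z - \<mu>))"
    using assms by (intro continuous_intros holomorphic_on_imp_continuous_on)
      (auto simp: rect_boundary_def intro: holomorphic_on_subset)
qed (use assms in auto)

lemma rint_Cauchy_outside:
  assumes "c > 0" "a < b" "Im \<mu> < a \<or> b < Im \<mu>"
  shows "rint a b c (\<lambda>z. 1 / (z - \<mu>)) = 0"
proof (rule has_contour_integral_rectpath_imp_rint)
  let ?S = "cbox (Complex (- c) a) (Complex c b)"
  have nin: "\<mu> \<notin> ?S"
    using assms by (auto simp: in_cbox_complex_iff)
  have "(\<lambda>z. 1 / (z - \<mu>)) holomorphic_on ?S"
    using nin by (auto intro!: holomorphic_intros)
  then show "((\<lambda>z. 1 / (z - \<mu>)) has_contour_integral 0) (rectpath (Complex (- c) a) (Complex c b))"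
    by (rule Cauchy_theorem_convex_simple[OF _ convex_box(1)])
      (use assms in \<open>auto simp: rect_boundary_eq_path_image rect_boundary_def in_cbox_complex_iff\<close>)
  show "continuous_on (rect_boundary a b c) (\<lambda>z. 1 / (z - \<mu>))"
    using assms by (intro continuous_intros) (auto simp: rect_boundary_def)
qed (use assms in auto)

text \<open>Cauchy's theorem across the axis: the vertical integrals have the derivative prescribed by the
  horizontal ones off the axis, and continuity suffices on it.\<close>

lemma rint_Cauchy_theorem:
  fixes G G' :: "complex \<Rightarrow> 'a::complex_banach"
  assumes cont: "continuous_on {z. \<bar>Re z\<bar> \<le> c \<and> a \<le> Im z \<and> Im z \<le> b} G"
    and deriv: "\<And>z. Re z \<noteq> 0 \<Longrightarrow> (G has_derivative (\<lambda>h. h *\<^sub>C G' z)) (at z)"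
    and cont': "continuous_on {z. Re z \<noteq> 0} G'"
    and "c > 0" "a \<le> b"
  shows "rint a b c G = 0"
proof -
  have contG: "continuous_on T (\<lambda>t. G (Complex (p t) (q t)))"
    if "continuous_on T p" "continuous_on T q" "\<And>t. t \<in> T \<Longrightarrow> \<bar>p t\<bar> \<le> c \<and> a \<le> q t \<and> q t \<le> b"
    for T :: "'t::topological_space set" and p q
    unfolding Complex_eq
    by (rule continuous_on_compose2[OF cont]) (use that in \<open>auto intro!: continuous_intros\<close>)
  define \<Phi> where "\<Phi> x = integral {a..b} (\<lambda>y. G (Complex x y))" for x
  define \<Psi> where "\<Psi> x = integral {- c..x} (\<lambda>r. G (Complex r b) - G (Complex r a))" for x
  have contH: "continuous_on {- c..c} (\<lambda>r. G (Complex r b) - G (Complex r a))"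
    by (intro continuous_intros contG) (use assms in auto)
  have d\<Phi>: "(\<Phi> has_vector_derivative integral {a..b} (\<lambda>y. G' (Complex x y))) (at x)"
    if x: "x \<noteq> 0" "- c < x" "x < c" for x
  proof -
    \<comment> \<open>The half interval on the side of x stays off the axis, where G is
      differentiable and the Leibniz rule applies.\<close>
    define U where "U = (if x > 0 then {0<..<c} else {- c<..<0})"
    have U: "open U" "convex U" "x \<in> U" "U \<subseteq> {- c..c}" "0 \<notin> U"
      using x by (auto simp: U_def)
    have "((\<lambda>x. integral (cbox a b) (\<lambda>y. G (Complex x y))) has_vector_derivative
        integral (cbox a b) (\<lambda>y. G' (Complex x y))) (at x within U)"
    proof (rule leibniz_rule_vector_derivative[OF _ _ _ U(3,2)])
      show "((\<lambda>u. G (Complex u t)) has_vector_derivative G' (Complex u t)) (at u within U)"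
        if "u \<in> U" "t \<in> cbox a b" for u t
      proof -
        have "((\<lambda>u. Complex u t) has_derivative of_real) (at u)"
          unfolding Complex_eq by (auto intro!: derivative_eq_intros)
        from has_derivative_compose[OF this deriv[of "Complex u t"]] that U
        have "((\<lambda>u. G (Complex u t)) has_derivative (\<lambda>h. of_real h *\<^sub>C G' (Complex u t))) (at u)"
          by auto
        then show ?thesis
          by (simp add: has_vector_derivative_def scaleR_eq_scaleC has_derivative_at_withinI)
      qed
      show "(\<lambda>y. G (Complex u y)) integrable_on cbox a b" if "u \<in> U" for u
      proof -
        have "u \<in> {- c..c}" using that U(4) by blast
        then have "\<bar>u\<bar> \<le> c" by auto
        then show ?thesis
          by (auto intro!: integrable_continuous_interval contG continuous_intros)
      qed
      show "continuous_on (U \<times> cbox a b) (\<lambda>(u, t). G' (Complex u t))"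
        unfolding Complex_eq split_beta
        by (rule continuous_on_compose2[OF cont']) (use U in \<open>auto intro!: continuous_intros\<close>)
    qed
    then show ?thesis
      unfolding \<Phi>_def[abs_def] at_within_open[OF U(3,1)] cbox_interval .
  qed
  \<comment> \<open>Along a vertical line i G' is the derivative of G in y, so the integral
    telescopes to the two horizontal sides.\<close>
  have int_G': "\<i> *\<^sub>C integral {a..b} (\<lambda>y. G' (Complex x y)) = G (Complex x b) - G (Complex x a)"
    if "x \<noteq> 0" for x
  proof -
    have "((\<lambda>y. \<i> *\<^sub>C G' (Complex x y)) has_integral G (Complex x b) - G (Complex x a)) {a..b}"
    proof (rule fundamental_theorem_of_calculus)
      fix y
      have "((\<lambda>y. Complex x y) has_derivative (\<lambda>h. \<i> * of_real h)) (at y within {a..b})"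
        unfolding Complex_eq by (auto intro!: derivative_eq_intros)
      from has_derivative_compose[OF this deriv[of "Complex x y"]] that
      show "((\<lambda>y. G (Complex x y)) has_vector_derivative \<i> *\<^sub>C G' (Complex x y)) (at y within {a..b})"
        by (simp add: has_vector_derivative_def scaleR_eq_scaleC scaleC_scaleC mult.commute)
    qed (use assms in auto)
    moreover have "(\<lambda>y. G' (Complex x y)) integrable_on {a..b}"
      unfolding Complex_eq
      by (intro integrable_continuous_interval continuous_on_compose2[OF cont'])
        (use that in \<open>auto intro!: continuous_intros\<close>)
    ultimately show ?thesis
      by (simp add: integral_scaleC[symmetric] integral_unique)
  qed
  define K where "K x = \<i> *\<^sub>C \<Phi> x - \<Psi> x" for x
  \<comment> \<open>The derivative of K vanishes except at finitely many points. At 0, where the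
    strip meets the axis, continuity of K alone bridges the gap.\<close>
  have "K c = K (- c)"
  proof (rule has_derivative_zero_unique_strong_interval[of "{0, c, - c}" "- c" c K])
    have "continuous_on {- c..c} (\<lambda>x. integral (cbox a b) (\<lambda>y. G (Complex x y)))"
      by (rule integral_continuous_on_param)
        (auto simp: split_beta intro!: contG continuous_intros)
    then show "continuous_on {- c..c} K"
      unfolding K_def \<Phi>_def \<Psi>_def
      by (auto intro!: continuous_intros indefinite_integral_continuous_1 integrable_continuous_interval contH)
    show "(K has_derivative (\<lambda>h. 0)) (at x within {- c..c})" if x: "x \<in> {- c..c} - {0, c, - c}" for x
    proof -
      have "(\<Psi> has_vector_derivative G (Complex x b) - G (Complex x a)) (at x within {- c..c})"
        unfolding \<Psi>_def[abs_def] by (rule integral_has_vector_derivative[OF contH]) (use x in auto)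
      moreover have "(\<Phi> has_vector_derivative integral {a..b} (\<lambda>y. G' (Complex x y))) (at x within {- c..c})"
        by (rule has_vector_derivative_at_within[OF d\<Phi>]) (use x in auto)
      ultimately have "(K has_vector_derivative \<i> *\<^sub>C integral {a..b} (\<lambda>y. G' (Complex x y)) -
          (G (Complex x b) - G (Complex x a))) (at x within {- c..c})"
        unfolding K_def
        by (intro has_vector_derivative_diff bounded_linear.has_vector_derivative[OF bounded_linear_scaleC])
      then show ?thesis
        using x int_G'[of x] by (simp add: has_vector_derivative_def)
    qed
  qed (use assms in auto)
  moreover have "\<Psi> (- c) = 0"
    by (simp add: \<Psi>_def)
  ultimately have "\<i> *\<^sub>C (\<Phi> c - \<Phi> (- c)) = \<Psi> c"
    by (simp add: K_def scaleC.diff_right algebra_simps)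
  moreover have "\<Phi> c - \<Phi> (- c) = integral {a..b} (\<lambda>y. G (Complex c y) - G (Complex (- c) y))"
    unfolding \<Phi>_def using \<open>c > 0\<close> \<open>a \<le> b\<close>
    by (intro integral_diff[symmetric] integrable_continuous_interval contG continuous_intros) auto
  moreover have "integral {- c..c} (\<lambda>x. G (Complex x a) - G (Complex x b)) = - \<Psi> c"
    unfolding \<Psi>_def by (simp flip: integral_neg)
  ultimately show ?thesis
    by (simp add: rint_def)
qed

lemma bounded_clinear_scaleC: "bounded_clinear (\<lambda>x. c *\<^sub>C x)"
  by (simp add: bounded_clinear_def bounded_linear_scaleC scaleC_scaleC mult.commute)

lemma rint_scaleC:
  assumes "continuous_on (rect_boundary a b c) F" "c \<ge> 0" "a \<le> b"
  shows "rint a b c (\<lambda>z. k *\<^sub>C F z) = k *\<^sub>C rint a b c F"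
  using rint_bounded_clinear[OF assms bounded_clinear_scaleC] .

lemma rint_diff:
  assumes "continuous_on (rect_boundary a b c) F" "continuous_on (rect_boundary a b c) G"
    "c \<ge> 0" "a \<le> b"
  shows "rint a b c (\<lambda>z. F z - G z) = rint a b c F - rint a b c G"
  using rint_add[OF assms(1) continuous_on_minus[OF assms(2)] assms(3,4)]
    rint_scaleC[OF assms(2-4), of "- 1"]
  by simp

section \<open>Cauchy kernel integrals as analytic functions of the pole\<close>

lemma closed_rect_boundary: "closed (rect_boundary a b c)"
proof -
  have "rect_boundary a b c = {z. \<bar>Re z\<bar> = c} \<inter> {z. a \<le> Im z} \<inter> {z. Im z \<le> b} \<union>
      {z. \<bar>Re z\<bar> \<le> c} \<inter> ({z. Im z = a} \<union> {z. Im z = b})"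
    by (auto simp: rect_boundary_def)
  then show ?thesis
    by (auto intro!: closed_Un closed_Int closed_Collect_eq closed_Collect_le continuous_intros)
qed

lemma rint_continuous_param:
  fixes F :: "complex \<Rightarrow> 'a::complex_banach"
  assumes F: "continuous_on (rect_boundary a b c) F"
    and k: "continuous_on (U \<times> rect_boundary a b c) (\<lambda>(m, z). k m z)"
    and "c \<ge> 0" "a \<le> b"
  shows "continuous_on U (\<lambda>m. rint a b c (\<lambda>z. k m z *\<^sub>C F z))"
proof -
  note F' = continuous_on_compose2[OF F] and k' = continuous_on_compose2[OF k, unfolded split_beta]
  have side: "continuous_on (U \<times> T) (\<lambda>(m, t). k m (Complex (p t) (q t)) *\<^sub>C F (Complex (p t) (q t)))"
    if pq: "continuous_on T p" "continuous_on T q" "\<And>t. t \<in> T \<Longrightarrow> Complex (p t) (q t) \<in> rect_boundary a b c"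
    for T :: "real set" and p q
  proof -
    have cpq: "continuous_on T (\<lambda>t. Complex (p t) (q t))"
      unfolding Complex_eq by (intro continuous_intros pq)
    have "continuous_on (U \<times> T) (\<lambda>x. k (fst x) (Complex (p (snd x)) (q (snd x))))"
    proof -
      have "continuous_on (U \<times> T) (\<lambda>x. (fst x, Complex (p (snd x)) (q (snd x))))"
        by (auto intro!: continuous_intros continuous_on_compose2[OF cpq])
      moreover have "(\<lambda>x. (fst x, Complex (p (snd x)) (q (snd x)))) ` (U \<times> T) \<subseteq> U \<times> rect_boundary a b c"
        using pq(3) by (simp add: image_subset_iff mem_Times_iff)
      ultimately show ?thesis
        using k'[of "U \<times> T" "\<lambda>x. (fst x, Complex (p (snd x)) (q (snd x)))"] by simp
    qed
    moreover have "continuous_on (U \<times> T) (\<lambda>x. F (Complex (p (snd x)) (q (snd x))))"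
      by (rule F') (use pq(3) in \<open>auto intro!: continuous_intros continuous_on_compose2[OF cpq]\<close>)
    ultimately show ?thesis
      unfolding split_beta by (intro continuous_intros)
  qed
  have s1: "continuous_on (U \<times> {a..b}) (\<lambda>(m, t). k m (Complex c t) *\<^sub>C F (Complex c t))"
    by (rule side) (use assms(3,4) in \<open>auto simp: rect_boundary_def\<close>)
  have s2: "continuous_on (U \<times> {a..b}) (\<lambda>(m, t). k m (Complex (- c) t) *\<^sub>C F (Complex (- c) t))"
    by (rule side) (use assms(3,4) in \<open>auto simp: rect_boundary_def\<close>)
  have s3: "continuous_on (U \<times> {- c..c}) (\<lambda>(m, t). k m (Complex t a) *\<^sub>C F (Complex t a))"
    by (rule side) (use assms(3,4) in \<open>auto simp: rect_boundary_def\<close>)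
  have s4: "continuous_on (U \<times> {- c..c}) (\<lambda>(m, t). k m (Complex t b) *\<^sub>C F (Complex t b))"
    by (rule side) (use assms(3,4) in \<open>auto simp: rect_boundary_def\<close>)
  have vert: "continuous_on U (\<lambda>m. integral (cbox a b) (\<lambda>y.
      k m (Complex c y) *\<^sub>C F (Complex c y) - k m (Complex (- c) y) *\<^sub>C F (Complex (- c) y)))"
    by (rule integral_continuous_on_param) (use s1 s2 in \<open>simp add: split_beta continuous_on_diff\<close>)
  have hor: "continuous_on U (\<lambda>m. integral (cbox (- c) c) (\<lambda>x.
      k m (Complex x a) *\<^sub>C F (Complex x a) - k m (Complex x b) *\<^sub>C F (Complex x b)))"
    by (rule integral_continuous_on_param) (use s3 s4 in \<open>simp add: split_beta continuous_on_diff\<close>)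
  show ?thesis
    using vert hor unfolding rint_def by (auto intro!: continuous_intros)
qed

text \<open>Two kernels with poles m and w differ by m - w times the kernel -1 / ((m - z)(w - z)).
  Its integral is continuous in m, which is Caratheodory's criterion.\<close>

lemma rint_Cauchy_kernel_vanalytic:
  fixes F :: "complex \<Rightarrow> 'a::complex_banach"
  assumes F: "continuous_on (rect_boundary a b c) F" and "c \<ge> 0" "a \<le> b"
  shows "vanalytic_on (\<lambda>\<mu>. rint a b c (\<lambda>z. (1 / (\<mu> - z)) *\<^sub>C F z)) (- rect_boundary a b c)"
  unfolding vanalytic_on_def
proof
  fix w assume w: "w \<in> - rect_boundary a b c"
  let ?K = "\<lambda>\<mu>. rint a b c (\<lambda>z. (1 / (\<mu> - z)) *\<^sub>C F z)"
  let ?U = "- rect_boundary a b c"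
  let ?G = "\<lambda>m. rint a b c (\<lambda>z. (- 1 / ((m - z) * (w - z))) *\<^sub>C F z)"
  have U: "open ?U"
    using closed_rect_boundary by blast
  have k: "continuous_on (rect_boundary a b c) (\<lambda>z. (1 / (m - z)) *\<^sub>C F z)" if "m \<in> ?U" for m
    using that by (auto intro!: continuous_intros F)
  have "(?K has_derivative (\<lambda>h. h *\<^sub>C ?G w)) (at w)"
  proof (rule caratheodory_has_derivative[OF U w])
    fix m assume m: "m \<in> ?U"
    have "?K m - ?K w =
        rint a b c (\<lambda>z. (1 / (m - z)) *\<^sub>C F z - (1 / (w - z)) *\<^sub>C F z)"
      using k m w assms by (intro rint_diff[symmetric]) auto
    also have "\<dots> = rint a b c (\<lambda>z. (m - w) *\<^sub>C (- 1 / ((m - z) * (w - z))) *\<^sub>C F z)"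
    proof (rule rint_cong)
      fix z assume "z \<in> rect_boundary a b c"
      then have "m - z \<noteq> 0" "w - z \<noteq> 0" using m w by auto
      then have "1 / (m - z) - 1 / (w - z) = (1 * (w - z) - 1 * (m - z)) / ((m - z) * (w - z))"
        by (rule diff_frac_eq)
      also have "\<dots> = (w - m) / ((m - z) * (w - z))"
        by simp
      also have "\<dots> = (m - w) * (- 1 / ((m - z) * (w - z)))"
      proof -
        have "(m - w) * (- 1 / X) = (w - m) / X" for X
          by (cases "X = 0") (simp_all add: field_simps)
        then show ?thesis by simp
      qed
      finally have "1 / (m - z) - 1 / (w - z) = (m - w) * (- 1 / ((m - z) * (w - z)))" .
      then show "(1 / (m - z)) *\<^sub>C F z - (1 / (w - z)) *\<^sub>C F z =
          (m - w) *\<^sub>C (- 1 / ((m - z) * (w - z))) *\<^sub>C F z"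
        by (simp add: scaleC.diff_left[symmetric] scaleC_scaleC)
    qed (use assms in auto)
    also have "\<dots> = (m - w) *\<^sub>C ?G m"
      by (rule rint_scaleC) (use m w assms in \<open>auto intro!: continuous_intros\<close>)
    finally show "?K m - ?K w =
        (m - w) *\<^sub>C ?G m" .
  next
    have "continuous_on ?U ?G"
      by (rule rint_continuous_param[OF F])
        (use w assms in \<open>auto simp: split_beta intro!: continuous_intros\<close>)
    then show "(?G \<longlongrightarrow> ?G w) (at w)"
      using U w by (simp add: continuous_on_eq_continuous_at isCont_def)
  qed
  then show "\<exists>F'. (?K has_derivative (\<lambda>h. h *\<^sub>C F')) (at w)"
    ..
qed

text \<open>For \<open>Q = (m - A)\<^sup>-\<^sup>1\<close> the fixed point below is \<open>(z - A)\<^sup>-\<^sup>1 (F z)\<close>; no operator \<open>A\<close> is needed.\<close>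

lemma vanalytic_fixpoint:
  fixes Q :: "'a::complex_banach \<Rightarrow> 'a"
  assumes Q: "bounded_clinear Q"
  shows "\<exists>r>0. \<forall>U F. open U \<and> U \<subseteq> ball m r \<and> vanalytic_on F U \<longrightarrow>
    (\<exists>E. vanalytic_on E U \<and> (\<forall>z\<in>U. \<forall>x. x = Q (F z + (m - z) *\<^sub>C x) \<longleftrightarrow> x = E z))"
proof -
  note Q_simps = bounded_clinearD(2-)[OF Q]
  obtain K where K: "K > 0" "\<And>x. norm (Q x) \<le> norm x * K"
    using bounded_linear.pos_bounded[OF bounded_clinearD(1)[OF Q]] by blast
  \<comment> \<open>With K a bound for Q, this radius makes x -> Q ((m - z) x) a contraction with
    factor 1/2, uniformly in z.\<close>
  define r where "r = 1 / (2 * K)"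
  have r: "r > 0" using K by (simp add: r_def)
  have small: "cmod (m - z) * K \<le> 1 / 2" if "z \<in> ball m r" for z
  proof -
    have "cmod (m - z) * K \<le> r * K"
      using that K by (intro mult_right_mono) (auto simp: dist_norm)
    then show ?thesis using K by (simp add: r_def)
  qed
  have contraction: "norm (Q ((m - z) *\<^sub>C x)) \<le> 1 / 2 * norm x" if "z \<in> ball m r" for z x
  proof -
    have "norm (Q ((m - z) *\<^sub>C x)) \<le> (cmod (m - z) * K) * norm x"
      using K(2)[of "(m - z) *\<^sub>C x"] by (simp add: norm_scaleC mult_ac)
    also have "\<dots> \<le> 1 / 2 * norm x"
      by (intro mult_right_mono small that) simp
    finally show ?thesis .
  qed
  have ex1: "\<exists>!x. Q (p + (m - z) *\<^sub>C x) = x" if z: "z \<in> ball m r" for z p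
  proof (rule banach_fix_type[of "1 / 2"])
    show "\<forall>x y. dist (Q (p + (m - z) *\<^sub>C x)) (Q (p + (m - z) *\<^sub>C y)) \<le> 1 / 2 * dist x y"
    proof (intro allI)
      fix x y
      have "Q (p + (m - z) *\<^sub>C x) - Q (p + (m - z) *\<^sub>C y) = Q ((m - z) *\<^sub>C (x - y))"
        by (simp add: Q_simps scaleC.diff_right)
      then show "dist (Q (p + (m - z) *\<^sub>C x)) (Q (p + (m - z) *\<^sub>C y)) \<le> 1 / 2 * dist x y"
        using contraction[OF z, of "x - y"] by (simp add: dist_norm)
    qed
  qed auto
  define S where "S z p = (THE x. Q (p + (m - z) *\<^sub>C x) = x)" for z p
  have S_iff: "x = Q (p + (m - z) *\<^sub>C x) \<longleftrightarrow> x = S z p" if "z \<in> ball m r" for x z p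
    unfolding S_def using theI'[OF ex1[OF that, of p]] ex1[OF that, of p] by metis
  have S: "S z p = Q (p + (m - z) *\<^sub>C S z p)" if "z \<in> ball m r" for z p
    using S_iff[OF that] by blast
  have S_bound: "norm (S z p) \<le> 2 * K * norm p" if "z \<in> ball m r" for z p
  proof -
    have "norm (S z p) = norm (Q p + Q ((m - z) *\<^sub>C S z p))"
      using S[OF that, of p] by (simp add: Q_simps)
    also have "\<dots> \<le> norm p * K + 1 / 2 * norm (S z p)"
      by (intro norm_triangle_mono K contraction that)
    finally show ?thesis by (simp add: mult_ac)
  qed
  \<comment> \<open>A difference of two solutions solves the fixed point problem at z again, with
    the change of parameter moved into the data. This replaces linearity of S in p.\<close>
  have S_diff: "S z p - S w q = S z (p - q - (z - w) *\<^sub>C S w q)" if z: "z \<in> ball m r" "w \<in> ball m r" for z w p q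
  proof -
    have "S z p - S w q = Q (p + (m - z) *\<^sub>C S z p) - Q (q + (m - w) *\<^sub>C S w q)"
      using S z by simp
    also have "\<dots> = Q ((p - q - (z - w) *\<^sub>C S w q) + (m - z) *\<^sub>C (S z p - S w q))"
      by (simp add: Q_simps scaleC.diff_right scaleC.diff_left)
    finally show ?thesis
      by (rule S_iff[OF z(1), THEN iffD1])
  qed
  have S_scaleC: "S z (k *\<^sub>C p) = k *\<^sub>C S z p" if "z \<in> ball m r" for z k p
  proof -
    have "k *\<^sub>C S z p = k *\<^sub>C Q (p + (m - z) *\<^sub>C S z p)"
      using S that by simp
    also have "\<dots> = Q (k *\<^sub>C p + (m - z) *\<^sub>C (k *\<^sub>C S z p))"
      by (simp add: Q_simps scaleC_add_right scaleC_scaleC mult.commute)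
    finally show ?thesis
      using S_iff[OF that] by metis
  qed
  have main: "vanalytic_on (\<lambda>z. S z (F z)) U" if U: "open U" "U \<subseteq> ball m r" "vanalytic_on F U" for U F
    unfolding vanalytic_on_def
  proof
    fix w assume w: "w \<in> U"
    then obtain F' where F': "(F has_derivative (\<lambda>h. h *\<^sub>C F')) (at w)"
      using U(3) by (auto simp: vanalytic_on_def)
    let ?q = "\<lambda>z. (1 / (z - w)) *\<^sub>C (F z - F w)"
    let ?x = "S w (F w)"
    have wr: "w \<in> ball m r" using w U by auto
    \<comment> \<open>Differentiating E = Q (F + (m - z) E) formally gives E' = Q (F' - E + (m - z)
      E'), so E' is the fixed point for the data F' - E.\<close>
    have "((\<lambda>z. S z (F z)) has_derivative (\<lambda>h. h *\<^sub>C S w (F' - ?x))) (at w)"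
    proof (rule caratheodory_has_derivative[OF U(1) w])
      show "S z (F z) - S w (F w) = (z - w) *\<^sub>C S z (?q z - ?x)" if "z \<in> U" for z
      proof (cases "z = w")
        case False
        have zr: "z \<in> ball m r" using that U by auto
        have "F z - F w - (z - w) *\<^sub>C ?x = (z - w) *\<^sub>C (?q z - ?x)"
          using False by (simp add: scaleC.diff_right scaleC_scaleC)
        then show ?thesis
          using S_diff[OF zr wr, of "F z" "F w"] by (simp only: S_scaleC[OF zr])
      qed simp
      have q: "((\<lambda>z. ?q z - ?x) \<longlongrightarrow> F' - ?x) (at w)"
        by (intro tendsto_intros F'[unfolded has_cderivative_quotient_iff])
      let ?y = "S w (F' - ?x)"
      have "((\<lambda>z. S z (?q z - ?x) - ?y) \<longlongrightarrow> 0) (at w)"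
      proof (rule Lim_null_comparison)
        have "\<forall>\<^sub>F z in at w. z \<in> U"
          by (rule eventually_at_in_open'[OF U(1) w])
        then show "\<forall>\<^sub>F z in at w. norm (S z (?q z - ?x) - ?y) \<le>
            2 * K * norm (?q z - ?x - (F' - ?x) - (z - w) *\<^sub>C ?y)"
        proof eventually_elim
          case (elim z)
          then have zr: "z \<in> ball m r" using U by auto
          show ?case
            unfolding S_diff[OF zr wr] by (rule S_bound[OF zr])
        qed
        have "((\<lambda>z. 2 * K * norm (?q z - ?x - (F' - ?x) - (z - w) *\<^sub>C ?y)) \<longlongrightarrow>
            2 * K * norm (F' - ?x - (F' - ?x) - (w - w) *\<^sub>C ?y)) (at w)"
          by (intro tendsto_intros q)
        then show "((\<lambda>z. 2 * K * norm (?q z - ?x - (F' - ?x) - (z - w) *\<^sub>C ?y)) \<longlongrightarrow> 0) (at w)"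
          by simp
      qed
      then show "((\<lambda>z. S z (?q z - ?x)) \<longlongrightarrow> ?y) (at w)"
        by (simp add: LIM_zero_iff)
    qed
    then show "\<exists>F'. ((\<lambda>z. S z (F z)) has_derivative (\<lambda>h. h *\<^sub>C F')) (at w)" ..
  qed
  show ?thesis
  proof (intro exI[of _ r] conjI r allI impI)
    fix U :: "complex set" and F :: "complex \<Rightarrow> 'a"
    assume U: "open U \<and> U \<subseteq> ball m r \<and> vanalytic_on F U"
    show "\<exists>E. vanalytic_on E U \<and> (\<forall>z\<in>U. \<forall>x. x = Q (F z + (m - z) *\<^sub>C x) \<longleftrightarrow> x = E z)"
      using U by (intro exI[of _ "\<lambda>z. S z (F z)"] conjI main ballI allI S_iff) auto
  qed
qed

text \<open>The components of the complement of L are pairwise disjoint open intervals, and finitely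
  many cover K. Inside each one the compact piece of K has a least and a greatest point, and a
  slightly larger closed interval still fits. The components themselves serve as index set.\<close>

lemma compact_closed_separating_intervals:
  fixes K L :: "real set"
  assumes K: "compact K" and L: "closed L" and KL: "K \<inter> L = {}"
  shows "\<exists>(I :: real set set) a b. finite I \<and> K \<subseteq> (\<Union>i\<in>I. {a i<..<b i}) \<and>
    disjoint_family_on (\<lambda>i. {a i..b i}) I \<and>
    (\<forall>i\<in>I. a i < b i \<and> {a i..b i} \<inter> L = {} \<and> a i \<notin> K \<and> b i \<notin> K)"
proof -
  let ?C = "components (- L)"
  have oC: "open c" if "c \<in> ?C" for c
    using open_components[OF _ that] L by auto
  have "K \<subseteq> \<Union>?C"
    using KL by auto
  then obtain D where D: "D \<subseteq> ?C" "finite D" "K \<subseteq> \<Union>D"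
    using compactE[OF K _ oC] by metis
  \<comment> \<open>Components that miss K are dropped, so that each remaining piece of K has a
    minimum and a maximum.\<close>
  define I where "I = {c \<in> D. c \<inter> K \<noteq> {}}"
  have disj: "c \<inter> c' = {}" if "c \<in> I" "c' \<in> I" "c \<noteq> c'" for c c'
    using that D components_nonoverlap[of c "- L" c'] by (auto simp: I_def)
  have cover: "K \<subseteq> \<Union>I"
  proof
    fix x assume "x \<in> K"
    then obtain c where "c \<in> D" "x \<in> c" using D by blast
    with \<open>x \<in> K\<close> show "x \<in> \<Union>I" by (auto simp: I_def)
  qed
  have "\<exists>a b. a < b \<and> {a..b} \<subseteq> c \<and> a \<notin> K \<and> b \<notin> K \<and> K \<inter> c \<subseteq> {a<..<b}" if c: "c \<in> I" for c
  proof -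
    have cC: "c \<in> ?C" using c D by (auto simp: I_def)
    \<comment> \<open>The piece of K in c is K without the other chosen open components, hence
      closed in K and compact.\<close>
    have "K \<inter> c = K \<inter> (- \<Union>(I - {c}))"
      using cover disj c by blast
    moreover have "closed (- \<Union>(I - {c}))"
      using oC D by (intro closed_Compl open_Union) (auto simp: I_def)
    ultimately have comp: "compact (K \<inter> c)"
      using K by (simp add: compact_Int_closed)
    have ne: "K \<inter> c \<noteq> {}" using c by (auto simp: I_def)
    obtain p where p: "p \<in> K \<inter> c" "\<And>x. x \<in> K \<inter> c \<Longrightarrow> p \<le> x"
      using compact_attains_inf[OF comp ne] by blast
    obtain q where q: "q \<in> K \<inter> c" "\<And>x. x \<in> K \<inter> c \<Longrightarrow> x \<le> q"
      using compact_attains_sup[OF comp ne] by blast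
    obtain e where e: "e > 0" "cball p e \<subseteq> c"
      using oC[OF cC] p(1) open_contains_cball by blast
    obtain d where d: "d > 0" "cball q d \<subseteq> c"
      using oC[OF cC] q(1) open_contains_cball by blast
    have ac: "p - e \<in> c" and bc: "q + d \<in> c"
      using e d by (auto simp: dist_real_def subset_iff)
    have iv: "is_interval c"
      using in_components_connected[OF cC] by (simp add: is_interval_connected_1)
    have sub: "{p - e..q + d} \<subseteq> c"
      using mem_is_interval_1_I[OF iv ac bc] by auto
    have pq: "p \<le> q" using p q by auto
    have "p - e \<notin> K" "q + d \<notin> K"
      using p(2)[of "p - e"] q(2)[of "q + d"] ac bc e d by auto
    moreover have "K \<inter> c \<subseteq> {p - e<..<q + d}"
      using p(2) q(2) e(1) d(1) by force
    ultimately show ?thesis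
      using sub pq e d by (intro exI[of _ "p - e"] exI[of _ "q + d"]) auto
  qed
  then obtain a b where ab: "\<And>c. c \<in> I \<Longrightarrow> a c < b c \<and> {a c..b c} \<subseteq> c \<and> a c \<notin> K \<and> b c \<notin> K \<and>
      K \<inter> c \<subseteq> {a c<..<b c}"
    by metis
  show ?thesis
  proof (rule exI[of _ I], rule exI[of _ a], rule exI[of _ b], intro conjI ballI)
    show "finite I" using D by (simp add: I_def)
    show "K \<subseteq> (\<Union>i\<in>I. {a i<..<b i})"
    proof
      fix x assume "x \<in> K"
      moreover from this obtain c where "c \<in> I" "x \<in> c" using cover by blast
      ultimately show "x \<in> (\<Union>i\<in>I. {a i<..<b i})" using ab[of c] by blast
    qed
    show "{a c..b c} \<inter> L = {}" if "c \<in> I" for c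
    proof -
      have "c \<subseteq> - L"
        using that D in_components_subset by (fastforce simp: I_def)
      then show ?thesis using ab[OF that] by blast
    qed
    show "disjoint_family_on (\<lambda>i. {a i..b i}) I"
      unfolding disjoint_family_on_def
    proof (intro ballI impI)
      fix i j assume ij: "i \<in> I" "j \<in> I" "i \<noteq> j"
      show "{a i..b i} \<inter> {a j..b j} = {}"
        using ab[OF ij(1)] ab[OF ij(2)] disj[OF ij] by blast
    qed
  qed (use ab in auto)
qed

section \<open>Local spectral theory for a resolvent defined off the imaginary axis\<close>

text \<open>The bound is the one for generators of isometry groups. The operator itself does not
  appear: the resolvent identity and injectivity take its place.\<close>

locale axis_resolvent =
  fixes R :: "complex \<Rightarrow> 'y::complex_banach \<Rightarrow> 'y"
  assumes R_bounded_clinear: "Re l \<noteq> 0 \<Longrightarrow> bounded_clinear (R l)"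
    and R_norm: "Re l \<noteq> 0 \<Longrightarrow> norm (R l y) \<le> norm y / \<bar>Re l\<bar>"
    and R_resolvent: "Re l \<noteq> 0 \<Longrightarrow> Re m \<noteq> 0 \<Longrightarrow> R l y - R m y = (m - l) *\<^sub>C R l (R m y)"
    and R_inj: "Re l \<noteq> 0 \<Longrightarrow> R l y = 0 \<Longrightarrow> y = 0"
begin

lemmas R_simps = bounded_clinearD(2-)[OF R_bounded_clinear]

lemma R_commute:
  assumes "Re l \<noteq> 0" "Re m \<noteq> 0"
  shows "R l (R m y) = R m (R l y)"
proof (cases "l = m")
  case False
  have "(m - l) *\<^sub>C R l (R m y) = - (R m y - R l y)"
    using R_resolvent[OF assms] by simp
  also have "\<dots> = (m - l) *\<^sub>C R m (R l y)"
    unfolding R_resolvent[OF assms(2,1)] by (simp add: scaleC.diff_left)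
  finally show ?thesis using False by (simp add: scaleC_cancel_left)
qed simp

text \<open>The resolvent identity collects the increment into R z applied to one small vector.
  Letting the argument vary with z also covers iterated resolvents such as
  \<open>R z (R z y)\<close>.\<close>

lemma isCont_R:
  assumes "Re w \<noteq> 0" "isCont u w"
  shows "isCont (\<lambda>z. R z (u z)) w"
proof -
  have "((\<lambda>z. R z (u z) - R w (u w)) \<longlongrightarrow> 0) (at w)"
  proof (rule Lim_null_comparison)
    have "\<forall>\<^sub>F z in at w. Re z \<noteq> 0"
      using assms(1) by (intro tendsto_imp_eventually_ne[OF tendsto_Re[OF tendsto_ident_at]])
    then show "\<forall>\<^sub>F z in at w. norm (R z (u z) - R w (u w)) \<le>
        (norm (u z - u w) + norm (w - z) * norm (R w (u w))) / \<bar>Re z\<bar>"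
    proof eventually_elim
      case (elim z)
      have "R z (u z) - R w (u w) = R z (u z - u w) + (w - z) *\<^sub>C R z (R w (u w))"
        unfolding R_resolvent[OF elim assms(1), symmetric] by (simp add: R_simps elim)
      also have "\<dots> = R z (u z - u w + (w - z) *\<^sub>C R w (u w))"
        by (simp add: R_simps elim)
      also have "norm \<dots> \<le> norm (u z - u w + (w - z) *\<^sub>C R w (u w)) / \<bar>Re z\<bar>"
        by (rule R_norm[OF elim])
      also have "\<dots> \<le> (norm (u z - u w) + norm (w - z) * norm (R w (u w))) / \<bar>Re z\<bar>"
        by (intro divide_right_mono order_trans[OF norm_triangle_ineq]) (auto simp: norm_scaleC)
      finally show ?case .
    qed
    have "((\<lambda>z. (norm (u z - u w) + norm (w - z) * norm (R w (u w))) / \<bar>Re z\<bar>) \<longlongrightarrow>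
        (norm (u w - u w) + norm (w - w) * norm (R w (u w))) / \<bar>Re w\<bar>) (at w)"
      using assms by (intro tendsto_intros) (auto simp: isCont_def)
    then show "((\<lambda>z. (norm (u z - u w) + norm (w - z) * norm (R w (u w))) / \<bar>Re z\<bar>) \<longlongrightarrow> 0) (at w)"
      by simp
  qed
  then show ?thesis
    by (simp add: isCont_def LIM_zero_iff)
qed

lemma open_off_axis: "open {z. Re z \<noteq> 0}"
  by (intro open_Collect_neq continuous_intros)

lemma R_has_derivative:
  assumes "Re w \<noteq> 0"
  shows "((\<lambda>z. R z y) has_derivative (\<lambda>h. h *\<^sub>C (- R w (R w y)))) (at w)"
proof (rule caratheodory_has_derivative[OF open_off_axis])
  show "R z y - R w y = (z - w) *\<^sub>C (- R z (R w y))" if "z \<in> {z. Re z \<noteq> 0}" for z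
    using R_resolvent[of z w y] that assms by (simp add: scaleC.diff_left)
  show "((\<lambda>z. - R z (R w y)) \<longlongrightarrow> - R w (R w y)) (at w)"
    using isCont_R[OF assms, of "\<lambda>z. R w y"] by (intro tendsto_minus) (simp add: isCont_def)
qed (use assms in auto)

text \<open>The condition of \<open>sp\<close> with an abstract resolvent, so that the two agree by
  unfolding once R is \<open>RD\<close>.\<close>

definition spec :: "'y \<Rightarrow> real set"
  where "spec y = {\<xi>. \<not> (\<exists>U F. open U \<and> \<i> * complex_of_real \<xi> \<in> U \<and> vanalytic_on F U \<and>
    (\<forall>\<mu>\<in>U. Re \<mu> \<noteq> 0 \<longrightarrow> F \<mu> = R \<mu> y))}"

lemma not_specI:
  assumes "open U" "\<i> * complex_of_real \<xi> \<in> U" "vanalytic_on F U"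
    "\<And>\<mu>. \<mu> \<in> U \<Longrightarrow> Re \<mu> \<noteq> 0 \<Longrightarrow> F \<mu> = R \<mu> y"
  shows "\<xi> \<notin> spec y"
  using assms unfolding spec_def by blast

lemma not_specE:
  assumes "\<xi> \<notin> spec y"
  obtains U F where "open U" "\<i> * complex_of_real \<xi> \<in> U" "vanalytic_on F U"
    "\<forall>\<mu>\<in>U. Re \<mu> \<noteq> 0 \<longrightarrow> F \<mu> = R \<mu> y"
  using assms unfolding spec_def by auto

section \<open>Continuation of z -> R z y to regular points of the axis\<close>

lemma off_axis_nontrivial: "Re z = 0 \<Longrightarrow> at z within {w. Re w \<noteq> 0} \<noteq> bot"
  unfolding trivial_limit_within islimpt_approachable
proof (clarsimp)
  fix e :: real assume "Re z = 0" "e > 0"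
  then show "\<exists>w. Re w \<noteq> 0 \<and> w \<noteq> z \<and> dist w z < e"
    by (intro exI[of _ "z + of_real (e / 2)"]) (auto simp: dist_norm)
qed

text \<open>Points off the axis are dense. This is how identities between resolvents reach the
  axis.\<close>

lemma off_axis_closure:
  assumes "isCont H z" "\<And>w. Re w \<noteq> 0 \<Longrightarrow> H w = (0 :: 'b::real_normed_vector)"
  shows "H z = 0"
proof (cases "Re z = 0")
  case True
  have "(H \<longlongrightarrow> H z) (at z within {w. Re w \<noteq> 0})"
    using assms(1) by (auto simp: isCont_def intro: tendsto_within_subset)
  moreover have "(H \<longlongrightarrow> 0) (at z within {w. Re w \<noteq> 0})"
    by (rule Lim_transform_eventually[OF tendsto_const])
      (use assms(2) in \<open>auto simp: eventually_at_filter\<close>)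
  ultimately show ?thesis
    using tendsto_unique[OF off_axis_nontrivial[OF True]] by blast
qed (use assms in auto)

text \<open>Taking limits from off the axis gives one global function that agrees with every local
  analytic extension, so no gluing is required.\<close>

definition ext :: "'y \<Rightarrow> complex \<Rightarrow> 'y"
  where "ext y z = (if Re z \<noteq> 0 then R z y else Lim (at z within {w. Re w \<noteq> 0}) (\<lambda>w. R w y))"

definition regular :: "'y \<Rightarrow> complex set"
  where "regular y = {z. Re z \<noteq> 0 \<or> Im z \<notin> spec y}"

lemma ext_off_axis [simp]: "Re z \<noteq> 0 \<Longrightarrow> ext y z = R z y"
  by (simp add: ext_def)

lemma ext_eqI:
  assumes "open U" "vanalytic_on F U" "\<And>\<mu>. \<mu> \<in> U \<Longrightarrow> Re \<mu> \<noteq> 0 \<Longrightarrow> F \<mu> = R \<mu> y" "z \<in> U"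
  shows "ext y z = F z"
proof (cases "Re z = 0")
  case True
  have "(F \<longlongrightarrow> F z) (at z within {w. Re w \<noteq> 0})"
    using vanalytic_onD_continuous[OF assms(2,4)] by (auto simp: isCont_def intro: tendsto_within_subset)
  then have "((\<lambda>w. R w y) \<longlongrightarrow> F z) (at z within {w. Re w \<noteq> 0})"
  proof (rule Lim_transform_eventually)
    have "\<forall>\<^sub>F w in at z within {w. Re w \<noteq> 0}. w \<in> U"
      using eventually_at_in_open'[OF assms(1,4)] by (auto simp: eventually_at_filter elim: eventually_mono)
    moreover have "\<forall>\<^sub>F w in at z within {w. Re w \<noteq> 0}. Re w \<noteq> 0"
      by (auto simp: eventually_at_filter)
    ultimately show "\<forall>\<^sub>F w in at z within {w. Re w \<noteq> 0}. F w = R w y"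
      by eventually_elim (use assms(3) in auto)
  qed
  then show ?thesis
    using True by (simp add: ext_def tendsto_Lim off_axis_nontrivial)
qed (use assms in auto)

lemma ext_local:
  assumes "z \<in> regular y"
  obtains U where "open U" "z \<in> U" "vanalytic_on (ext y) U"
proof (cases "Re z = 0")
  case True
  then have "Im z \<notin> spec y" and z: "z = \<i> * complex_of_real (Im z)"
    using assms by (auto simp: regular_def complex_eq_iff)
  then obtain U F where UF: "open U" "z \<in> U" "vanalytic_on F U"
      "\<And>\<mu>. \<mu> \<in> U \<Longrightarrow> Re \<mu> \<noteq> 0 \<Longrightarrow> F \<mu> = R \<mu> y"
    unfolding spec_def by auto
  have "vanalytic_on (ext y) U"
    using ext_eqI[OF UF(1,3,4)] by (intro vanalytic_on_cong[OF UF(1,3)]) auto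
  then show ?thesis using that UF by blast
next
  case False
  have "vanalytic_on (\<lambda>z. R z y) {z. Re z \<noteq> 0}"
    using R_has_derivative unfolding vanalytic_on_def by blast
  then have "vanalytic_on (ext y) {z. Re z \<noteq> 0}"
    by (rule vanalytic_on_cong[OF open_off_axis]) simp
  then show ?thesis using that[OF open_off_axis] False by simp
qed

lemma vanalytic_on_ext: "vanalytic_on (ext y) (regular y)"
  unfolding vanalytic_on_def
proof
  fix z assume "z \<in> regular y"
  then obtain U where "z \<in> U" "vanalytic_on (ext y) U"
    by (rule ext_local)
  then show "\<exists>F'. (ext y has_derivative (\<lambda>h. h *\<^sub>C F')) (at z)"
    by (auto simp: vanalytic_on_def)
qed

lemma isCont_ext: "z \<in> regular y \<Longrightarrow> isCont (ext y) z"
  by (rule vanalytic_onD_continuous[OF vanalytic_on_ext])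

lemma closed_spec: "closed (spec y)"
  unfolding closed_def open_subopen[of "- spec y"]
proof
  fix \<xi> assume "\<xi> \<in> - spec y"
  then obtain U F where UF: "open U" "\<i> * complex_of_real \<xi> \<in> U" "vanalytic_on F U"
      "\<forall>\<mu>\<in>U. Re \<mu> \<noteq> 0 \<longrightarrow> F \<mu> = R \<mu> y"
    by (auto elim: not_specE)
  let ?V = "(\<lambda>\<xi>. \<i> * complex_of_real \<xi>) -` U"
  have "open ?V" by (intro open_vimage UF continuous_intros)
  moreover have "?V \<subseteq> - spec y" using UF not_specI by blast
  ultimately show "\<exists>V. open V \<and> \<xi> \<in> V \<and> V \<subseteq> - spec y"
    using UF(2) by blast
qed

text \<open>The resolvent identity with one parameter moved onto the axis. Under a contour integral
  it turns the operator R m into the scalar kernel 1 / (m - z).\<close>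

lemma R_ext:
  assumes "z \<in> regular y" "Re m \<noteq> 0"
  shows "(m - z) *\<^sub>C R m (ext y z) = ext y z - R m y"
proof -
  let ?H = "\<lambda>z. (m - z) *\<^sub>C R m (ext y z) - (ext y z - R m y)"
  have "?H z = 0"
  proof (rule off_axis_closure[where H = ?H])
    show "isCont ?H z"
      by (intro continuous_intros bounded_linear.isCont[OF bounded_clinearD(1)[OF R_bounded_clinear]]
          isCont_ext assms)
    show "?H w = 0" if "Re w \<noteq> 0" for w
      using R_resolvent[OF that assms(2), of y] that by (simp add: R_commute[OF that assms(2)])
  qed
  then show ?thesis by simp
qed

section \<open>Operators commuting with the resolvent, and the calculus of spectra\<close>

definition commuting :: "('y \<Rightarrow> 'y) \<Rightarrow> bool"
  where "commuting L \<longleftrightarrow> bounded_clinear L \<and> (\<forall>z y. Re z \<noteq> 0 \<longrightarrow> R z (L y) = L (R z y))"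

lemma commuting_R: "Re m \<noteq> 0 \<Longrightarrow> commuting (R m)"
  unfolding commuting_def using R_bounded_clinear R_commute by auto

lemma spec_commuting:
  assumes "commuting L"
  shows "spec (L y) \<subseteq> spec y"
proof (rule subsetI, rule ccontr)
  fix \<xi> assume \<xi>: "\<xi> \<in> spec (L y)" "\<xi> \<notin> spec y"
  obtain U F where UF: "open U" "\<i> * complex_of_real \<xi> \<in> U" "vanalytic_on F U"
      "\<forall>\<mu>\<in>U. Re \<mu> \<noteq> 0 \<longrightarrow> F \<mu> = R \<mu> y"
    by (rule not_specE[OF \<xi>(2)])
  have "\<xi> \<notin> spec (L y)"
    using assms UF(4) by (intro not_specI[OF UF(1,2) vanalytic_on_bounded_clinear[OF _ UF(3)]])
      (auto simp: commuting_def)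
  with \<xi> show False by simp
qed

lemma ext_commuting:
  assumes "commuting L" "z \<in> regular y"
  shows "ext (L y) z = L (ext y z)"
proof -
  have "z \<in> regular (L y)"
    using assms spec_commuting[OF assms(1), of y] by (auto simp: regular_def)
  let ?H = "\<lambda>z. ext (L y) z - L (ext y z)"
  have "?H z = 0"
  proof (rule off_axis_closure[where H = ?H])
    have "bounded_linear L"
      using assms(1) by (simp add: commuting_def bounded_clinearD)
    then show "isCont ?H z"
      by (rule isCont_diff[OF isCont_ext[OF \<open>z \<in> regular (L y)\<close>]
            bounded_linear.isCont[OF _ isCont_ext[OF assms(2)]]])
    show "?H w = 0" if "Re w \<noteq> 0" for w
      using that assms(1) by (simp add: commuting_def)
  qed
  then show ?thesis by simp
qed

lemma spec_add: "spec (x + y) \<subseteq> spec x \<union> spec y"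
proof (rule subsetI, rule ccontr)
  fix \<xi> assume \<xi>: "\<xi> \<in> spec (x + y)" "\<xi> \<notin> spec x \<union> spec y"
  then have n: "\<xi> \<notin> spec x" "\<xi> \<notin> spec y" by auto
  obtain U F where U: "open U" "\<i> * complex_of_real \<xi> \<in> U" "vanalytic_on F U"
      "\<forall>\<mu>\<in>U. Re \<mu> \<noteq> 0 \<longrightarrow> F \<mu> = R \<mu> x"
    by (rule not_specE[OF n(1)])
  obtain V G where V: "open V" "\<i> * complex_of_real \<xi> \<in> V" "vanalytic_on G V"
      "\<forall>\<mu>\<in>V. Re \<mu> \<noteq> 0 \<longrightarrow> G \<mu> = R \<mu> y"
    by (rule not_specE[OF n(2)])
  from U V have "\<xi> \<notin> spec (x + y)"
    by (intro not_specI[of "U \<inter> V" _ "\<lambda>z. F z + G z"] vanalytic_on_add)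
      (auto simp: R_simps intro: vanalytic_on_subset)
  with \<xi> show False by simp
qed

lemma spec_scaleC: "spec (k *\<^sub>C y) \<subseteq> spec y"
  by (rule spec_commuting) (auto simp: commuting_def bounded_clinear_scaleC R_simps)

lemma spec_diff: "spec (x - y) \<subseteq> spec x \<union> spec y"
  using spec_add[of x "- y"] spec_scaleC[of "- 1" y] by auto

lemma spec_zero: "spec 0 = {}"
proof -
  have "\<xi> \<notin> spec 0" for \<xi>
    by (rule not_specI[of UNIV _ "\<lambda>z. 0"]) (auto simp: vanalytic_on_const R_simps)
  then show ?thesis by blast
qed

lemma spec_sum: "finite I \<Longrightarrow> spec (\<Sum>i\<in>I. y i) \<subseteq> (\<Union>i\<in>I. spec (y i))"
proof (induction I rule: finite_induct)
  case (insert i I)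
  then show ?case using spec_add[of "y i" "\<Sum>i\<in>I. y i"] by auto
qed (simp add: spec_zero)

section \<open>Riesz projections of single vectors\<close>

lemma rect_boundary_regular:
  assumes "a \<notin> spec y" "b \<notin> spec y" "c > 0"
  shows "rect_boundary a b c \<subseteq> regular y"
  using assms by (auto simp: rect_boundary_def regular_def)

lemma continuous_on_ext: "X \<subseteq> regular y \<Longrightarrow> continuous_on X (ext y)"
  by (intro continuous_at_imp_continuous_on ballI isCont_ext) auto

text \<open>Without spectrum between a and b the continued function is continuous on the whole
  rectangle, so Cauchy's theorem across the axis applies. An entire weight h does no harm.\<close>

lemma rint_ext_gap:
  assumes "a \<le> b" "{a..b} \<inter> spec y = {}" "c > 0" "h holomorphic_on UNIV"
  shows "rint a b c (\<lambda>z. h z *\<^sub>C ext y z) = 0"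
proof (rule rint_Cauchy_theorem)
  show "continuous_on {z. \<bar>Re z\<bar> \<le> c \<and> a \<le> Im z \<and> Im z \<le> b} (\<lambda>z. h z *\<^sub>C ext y z)"
    using assms(2) by (intro continuous_intros continuous_on_ext
        continuous_on_subset[OF holomorphic_on_imp_continuous_on[OF assms(4)]])
      (auto simp: regular_def)
  show "((\<lambda>z. h z *\<^sub>C ext y z) has_derivative
      (\<lambda>k. k *\<^sub>C (h z *\<^sub>C (- R z (R z y)) + deriv h z *\<^sub>C R z y))) (at z)" if "Re z \<noteq> 0" for z
  proof -
    have "(h has_field_derivative deriv h z) (at z)"
      using assms(4) by (auto intro: holomorphic_derivI)
    from has_cderivative_scaleC[OF this R_has_derivative[OF that, of y]]
    show ?thesis
      by (rule has_derivative_transform_within_open[OF _ open_off_axis]) (use that in auto)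
  qed
  show "continuous_on {z. Re z \<noteq> 0} (\<lambda>z. h z *\<^sub>C (- R z (R z y)) + deriv h z *\<^sub>C R z y)"
  proof (intro continuous_intros)
    show "continuous_on {z. Re z \<noteq> 0} h" "continuous_on {z. Re z \<noteq> 0} (deriv h)"
      using assms(4) by (auto intro!: holomorphic_on_imp_continuous_on
        holomorphic_on_subset[OF holomorphic_deriv[OF assms(4)]] intro: holomorphic_on_subset)
    show "continuous_on {z. Re z \<noteq> 0} (\<lambda>z. R z y)" "continuous_on {z. Re z \<noteq> 0} (\<lambda>z. R z (R z y))"
      by (auto intro!: continuous_at_imp_continuous_on isCont_R)
  qed
qed (use assms in auto)

text \<open>The Riesz projection for the spectrum between a and b, formed from the continuation for
  the single vector y. It is meaningful only when a and b are regular for y; hence additivity and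
  commutation carry conditions on the vectors. The half width 1 is a convention.\<close>

definition proj :: "real \<Rightarrow> real \<Rightarrow> 'y \<Rightarrow> 'y"
  where "proj a b y = (1 / (2 * pi * \<i>)) *\<^sub>C rint a b 1 (ext y)"

lemma proj_extend_left:
  assumes "a' \<le> a" "a \<le> b" "{a'..a} \<inter> spec y = {}" "b \<notin> spec y"
  shows "proj a' b y = proj a b y"
proof -
  have "a' \<notin> spec y" "a \<notin> spec y"
    using assms(1,3) by auto
  then have "rint a' a 1 (ext y) + rint a b 1 (ext y) = rint a' b 1 (ext y)"
    using assms by (intro rint_combine continuous_on_ext rect_boundary_regular) auto
  moreover have "rint a' a 1 (ext y) = 0"
    using rint_ext_gap[OF assms(1,3), of 1 "\<lambda>_. 1"] by simp
  ultimately show ?thesis by (simp add: proj_def)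
qed

lemma proj_extend_right:
  assumes "a \<le> b" "b \<le> b'" "{b..b'} \<inter> spec y = {}" "a \<notin> spec y"
  shows "proj a b' y = proj a b y"
proof -
  have "b \<notin> spec y" "b' \<notin> spec y"
    using assms(2,3) by auto
  then have "rint a b 1 (ext y) + rint b b' 1 (ext y) = rint a b' 1 (ext y)"
    using assms by (intro rint_combine continuous_on_ext rect_boundary_regular) auto
  moreover have "rint b b' 1 (ext y) = 0"
    using rint_ext_gap[OF assms(2,3), of 1 "\<lambda>_. 1"] by simp
  ultimately show ?thesis by (simp add: proj_def)
qed

lemma proj_commuting:
  assumes "commuting L" "a \<le> b" "a \<notin> spec y" "b \<notin> spec y"
  shows "proj a b (L y) = L (proj a b y)"
proof -
  note reg = rect_boundary_regular[OF assms(3,4), of 1]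
  have L: "bounded_clinear L"
    using assms(1) by (simp add: commuting_def)
  have "rint a b 1 (ext (L y)) = rint a b 1 (\<lambda>z. L (ext y z))"
    using assms reg by (intro rint_cong ext_commuting) auto
  also have "\<dots> = L (rint a b 1 (ext y))"
    using assms reg by (intro rint_bounded_clinear continuous_on_ext L) auto
  finally show ?thesis
    by (simp add: proj_def bounded_clinearD[OF L])
qed

text \<open>By \<open>R_ext\<close>, the integrand becomes a Cauchy kernel times
  \<open>ext y\<close>, analytic in m off the contour, plus a scalar kernel times
  \<open>R m y\<close>. The scalar integral counts the winding around m and decides which of y and
  its projection loses spectrum.\<close>

lemma R_proj:
  assumes "a < b" "a \<notin> spec y" "b \<notin> spec y" "Re m \<noteq> 0" "m \<notin> rect_boundary a b 1"
  shows "R m (proj a b y) = (1 / (2 * pi * \<i>)) *\<^sub>C (rint a b 1 (\<lambda>z. (1 / (m - z)) *\<^sub>C ext y z) +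
    rint a b 1 (\<lambda>z. 1 / (z - m)) *\<^sub>C R m y)"
proof -
  let ?B = "rect_boundary a b 1"
  note reg = rect_boundary_regular[OF assms(2,3) zero_less_one]
  have ce: "continuous_on ?B (ext y)"
    by (rule continuous_on_ext[OF reg])
  have k: "continuous_on ?B (\<lambda>z. 1 / (m - z))" "continuous_on ?B (\<lambda>z. 1 / (z - m))"
    using assms(5) by (auto intro!: continuous_intros)
  have "R m (rint a b 1 (ext y)) = rint a b 1 (\<lambda>z. R m (ext y z))"
    using assms by (intro rint_bounded_clinear[symmetric] ce R_bounded_clinear) auto
  also have "\<dots> = rint a b 1 (\<lambda>z. (1 / (m - z)) *\<^sub>C ext y z + (1 / (z - m)) *\<^sub>C R m y)"
  proof (rule rint_cong)
    fix z assume z: "z \<in> ?B"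
    then have mz: "m - z \<noteq> 0" using assms(5) by auto
    have "R m (ext y z) = (1 / (m - z)) *\<^sub>C ((m - z) *\<^sub>C R m (ext y z))"
      using mz by (simp add: scaleC_scaleC)
    also have "\<dots> = (1 / (m - z)) *\<^sub>C ext y z - (1 / (m - z)) *\<^sub>C R m y"
      using R_ext[OF _ assms(4), of z y] z reg by (auto simp: scaleC.diff_right)
    also have "1 / (m - z) = - (1 / (z - m))"
      by (metis minus_diff_eq divide_minus_right)
    finally show "R m (ext y z) = (1 / (m - z)) *\<^sub>C ext y z + (1 / (z - m)) *\<^sub>C R m y"
      by (metis (no_types, opaque_lifting) \<open>1 / (m - z) = - (1 / (z - m))\<close> add.inverse_inverse
          diff_minus_eq_add scaleC_minus(1))
  qed (use assms in auto)
  also have "\<dots> = rint a b 1 (\<lambda>z. (1 / (m - z)) *\<^sub>C ext y z) + rint a b 1 (\<lambda>z. 1 / (z - m)) *\<^sub>C R m y"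
    using assms k
    by (subst rint_add) (auto simp: rint_scaleC_const intro!: continuous_intros ce)
  finally show ?thesis
    by (simp add: proj_def R_simps assms)
qed

text \<open>Above and below the rectangle the winding number is 0 and only the analytic kernel
  integral remains.\<close>

lemma spec_proj_subset:
  assumes "a < b" "a \<notin> spec y" "b \<notin> spec y"
  shows "spec (proj a b y) \<subseteq> {a..b}"
proof
  let ?J = "\<lambda>m. rint a b 1 (\<lambda>z. (1 / (m - z)) *\<^sub>C ext y z)"
  fix \<xi> assume \<xi>: "\<xi> \<in> spec (proj a b y)"
  show "\<xi> \<in> {a..b}"
  proof (rule ccontr)
    assume n: "\<xi> \<notin> {a..b}"
    let ?U = "{z. Im z < a} \<union> {z. Im z > b}"
    have "\<xi> \<notin> spec (proj a b y)"
    proof (rule not_specI[of ?U])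
      show "open ?U"
        by (intro open_Un open_Collect_less continuous_intros)
      show "\<i> * complex_of_real \<xi> \<in> ?U"
        using n by auto
      have "vanalytic_on ?J ?U"
        by (rule vanalytic_on_subset[OF rint_Cauchy_kernel_vanalytic[OF continuous_on_ext]])
          (use assms rect_boundary_regular in \<open>auto simp: rect_boundary_def\<close>)
      then show "vanalytic_on (\<lambda>m. (1 / (2 * pi * \<i>)) *\<^sub>C ?J m) ?U"
        by (rule vanalytic_on_bounded_clinear[OF bounded_clinear_scaleC])
      show "(1 / (2 * pi * \<i>)) *\<^sub>C ?J m = R m (proj a b y)"
        if "m \<in> ?U" "Re m \<noteq> 0" for m
        using that assms by (subst R_proj) (auto simp: rint_Cauchy_outside rect_boundary_def)
    qed
    with \<xi> show False by simp
  qed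
qed

text \<open>Inside the rectangle the winding number is 1, so the term \<open>R m y\<close> cancels
  against y and only the analytic kernel integral remains.\<close>

lemma spec_diff_proj:
  assumes "a < b" "a \<notin> spec y" "b \<notin> spec y"
  shows "spec (y - proj a b y) \<inter> {a<..<b} = {}"
proof -
  let ?J = "\<lambda>m. rint a b 1 (\<lambda>z. (1 / (m - z)) *\<^sub>C ext y z)"
  have "\<xi> \<notin> spec (y - proj a b y)" if \<xi>: "\<xi> \<in> {a<..<b}" for \<xi>
  proof -
    let ?U = "{z. -1 < Re z} \<inter> {z. Re z < 1} \<inter> {z. a < Im z} \<inter> {z. Im z < b}"
    show ?thesis
    proof (rule not_specI[of ?U])
      show "open ?U"
        by (intro open_Int open_Collect_less continuous_intros)
      show "\<i> * complex_of_real \<xi> \<in> ?U"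
        using \<xi> by auto
      have "vanalytic_on ?J ?U"
        by (rule vanalytic_on_subset[OF rint_Cauchy_kernel_vanalytic[OF continuous_on_ext]])
          (use assms rect_boundary_regular in \<open>auto simp: rect_boundary_def abs_if split: if_splits\<close>)
      then show "vanalytic_on (\<lambda>m. (- 1 / (2 * pi * \<i>)) *\<^sub>C ?J m) ?U"
        by (rule vanalytic_on_bounded_clinear[OF bounded_clinear_scaleC])
      show "(- 1 / (2 * pi * \<i>)) *\<^sub>C ?J m = R m (y - proj a b y)"
        if "m \<in> ?U" "Re m \<noteq> 0" for m
      proof -
        have "rint a b 1 (\<lambda>z. 1 / (z - m)) = 2 * pi * \<i>"
          using rint_Cauchy_formula[of "\<lambda>_. 1" 1 a b m] that assms by auto
        moreover have "m \<notin> rect_boundary a b 1"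
          using that by (auto simp: rect_boundary_def)
        ultimately show ?thesis
          using R_proj[of a b y m] that assms
          by (simp add: R_simps scaleC_add_right scaleC_scaleC)
      qed
    qed
  qed
  then show ?thesis by blast
qed

lemma proj_endpoints:
  assumes "a < b" "a \<notin> spec y" "b \<notin> spec y"
  obtains a' b' where "a < a'" "a' < b'" "b' < b" "a' \<notin> spec y" "b' \<notin> spec y" "proj a b y = proj a' b' y"
proof -
  have "open (- spec y)"
    using closed_spec by blast
  then obtain e d where ed: "e > 0" "ball a e \<subseteq> - spec y" "d > 0" "ball b d \<subseteq> - spec y"
    using assms by (meson ComplI openE)
  \<comment> \<open>A third of the smallest distance keeps both strips free of spectrum and leaves a
    + r below b - r.\<close>
  define r where "r = min (min e d) (b - a) / 3"
  have r: "r > 0" "r < e" "r < d" "r < b - a - r"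
    using ed assms by (auto simp: r_def min_def)
  have ga: "{a..a + r} \<inter> spec y = {}"
  proof -
    have "{a..a + r} \<subseteq> ball a e" using r by (auto simp: dist_real_def)
    then show ?thesis using ed by blast
  qed
  have gb: "{b - r..b} \<inter> spec y = {}"
  proof -
    have "{b - r..b} \<subseteq> ball b d" using r by (auto simp: dist_real_def)
    then show ?thesis using ed by blast
  qed
  have n: "a + r \<notin> spec y" "b - r \<notin> spec y"
  proof -
    have "a + r \<in> {a..a + r}" "b - r \<in> {b - r..b}"
      using r by auto
    then show "a + r \<notin> spec y" "b - r \<notin> spec y"
      using ga gb by blast+
  qed
  have "proj a b y = proj (a + r) b y"
    using r ga assms by (intro proj_extend_left) auto
  also have "\<dots> = proj (a + r) (b - r) y"
    using r gb n by (intro proj_extend_right) auto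
  finally show ?thesis
    using that[of "a + r" "b - r"] r n by simp
qed

text \<open>Moving the end points inwards through gaps excludes a and b. Inside, the complement y -
  proj a b y has no spectrum, so any spectrum of the projection must come from y.\<close>

lemma spec_proj:
  assumes "a < b" "a \<notin> spec y" "b \<notin> spec y"
  shows "spec (proj a b y) \<subseteq> spec y \<inter> {a<..<b}"
proof
  fix \<xi> assume \<xi>: "\<xi> \<in> spec (proj a b y)"
  obtain a' b' where "a < a'" "a' < b'" "b' < b" "a' \<notin> spec y" "b' \<notin> spec y"
      "proj a b y = proj a' b' y"
    using proj_endpoints[OF assms] by metis
  with \<xi> spec_proj_subset[of a' b' y] have in_ab: "\<xi> \<in> {a<..<b}"
    by auto
  have "\<xi> \<in> spec (y - (y - proj a b y))"
    using \<xi> by simp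
  then have "\<xi> \<in> spec y \<union> spec (y - proj a b y)"
    using spec_diff by blast
  then show "\<xi> \<in> spec y \<inter> {a<..<b}"
    using in_ab spec_diff_proj[OF assms] by blast
qed

lemma spec_minus_proj:
  assumes "a < b" "a \<notin> spec y" "b \<notin> spec y"
  shows "spec (y - proj a b y) \<subseteq> spec y - {a<..<b}"
  using spec_diff[of y "proj a b y"] spec_proj[OF assms] spec_diff_proj[OF assms] by blast

text \<open>On the bounded contour the factor m - z, which inverts R m up to a term y, is bounded.
  Two such factors are extracted: lifting back to a mild solution needs a representative whose
  derivative is again in \<open>D_dom\<close>.\<close>

lemma proj_in_range_R:
  assumes "a \<le> b" "a \<notin> spec y" "b \<notin> spec y" "Re m \<noteq> 0"
  obtains q where "proj a b y = R m (R m q)"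
proof -
  let ?B = "rect_boundary a b 1"
  let ?F = "\<lambda>z. (m - z) *\<^sub>C ext y z"
  note reg = rect_boundary_regular[OF assms(2,3) zero_less_one]
  have ce: "continuous_on ?B (ext y)"
    by (rule continuous_on_ext[OF reg])
  have ext: "ext y z = R m (y + ?F z)" if "z \<in> ?B" for z
    using R_ext[of z y m] that reg assms(4) by (auto simp: R_simps)
  have c1: "continuous_on ?B (\<lambda>z. y + ?F z)" "continuous_on ?B (\<lambda>z. (m - z) *\<^sub>C (y + ?F z))"
    by (intro continuous_intros ce)+
  have "rint a b 1 (ext y) = rint a b 1 (\<lambda>z. R m (y + ?F z))"
    using assms(1) by (intro rint_cong ext) auto
  also have "\<dots> = R m (rint a b 1 (\<lambda>z. y + ?F z))"
    using assms by (intro rint_bounded_clinear c1 R_bounded_clinear) auto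
  \<comment> \<open>The constant y integrates to 0 over the closed contour, which leaves
    \<open>?F\<close> free for a second factor R m.\<close>
  also have "rint a b 1 (\<lambda>z. y + ?F z) = rint a b 1 ?F"
    using assms by (subst rint_add) (auto simp: rint_const intro!: continuous_intros ce)
  also have "rint a b 1 ?F = rint a b 1 (\<lambda>z. R m ((m - z) *\<^sub>C (y + ?F z)))"
  proof (rule rint_cong)
    show "?F z = R m ((m - z) *\<^sub>C (y + ?F z))" if "z \<in> ?B" for z
      by (simp only: R_simps(1)[OF assms(4)] ext[OF that, symmetric])
  qed (use assms(1) in auto)
  also have "\<dots> = R m (rint a b 1 (\<lambda>z. (m - z) *\<^sub>C (y + ?F z)))"
    using assms by (intro rint_bounded_clinear c1 R_bounded_clinear) auto
  finally have "proj a b y = R m (R m ((1 / (2 * pi * \<i>)) *\<^sub>C rint a b 1 (\<lambda>z. (m - z) *\<^sub>C (y + ?F z))))"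
    by (simp add: proj_def R_simps assms)
  then show ?thesis by (rule that)
qed

text \<open>A Liouville argument: the weight \<open>1 + z\<^sup>2 / N\<^sup>2\<close> vanishes where the square of half width
  \<open>N\<close> meets the imaginary axis, which compensates the singular bound \<open>1 / \<bar>Re z\<bar>\<close>.\<close>

lemma weight_bound:
  assumes "N \<ge> 2" "z \<in> rect_boundary (- N) N N" "spec y = {}"
  shows "norm (((1 + z\<^sup>2 / of_real (N\<^sup>2)) / (1 - z)) *\<^sub>C ext y z) \<le> 3 * norm y / (N * (N - 1))"
proof -
  let ?h = "1 + z\<^sup>2 / of_real (N\<^sup>2)"
  have N: "N > 1" "N > 0" using assms by auto
  have main: "norm ?h * norm (ext y z) \<le> 3 * norm y / N \<and> norm (1 - z) \<ge> N - 1"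
  proof (cases "\<bar>Re z\<bar> = N")
    case True
    have Im: "\<bar>Im z\<bar> \<le> N"
      using assms(2) True by (auto simp: rect_boundary_def)
    have "(cmod z)\<^sup>2 \<le> 2 * N\<^sup>2"
      unfolding cmod_power2 using True abs_le_square_iff[of "Im z" N] abs_le_square_iff[of "Re z" N] Im N
      by auto
    then have "norm ?h \<le> 1 + 2"
      using N by (intro norm_triangle_mono) (auto simp: norm_divide norm_power divide_le_eq)
    moreover have "norm (ext y z) \<le> norm y / N"
      using R_norm[of z y] True N by (cases "Re z = 0") auto
    ultimately have "norm ?h * norm (ext y z) \<le> 3 * (norm y / N)"
      by (intro mult_mono) auto
    moreover have "N - 1 \<le> norm (1 - z)"
      using abs_Re_le_cmod[of "1 - z"] True by (simp add: abs_if split: if_splits)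
    ultimately show ?thesis by simp
  next
    case False
    then have ReIm: "\<bar>Re z\<bar> \<le> N" "\<bar>Im z\<bar> = N"
      using assms(2) N by (auto simp: rect_boundary_def)
    have Im2: "(Im z)\<^sup>2 = N\<^sup>2"
      using ReIm(2) by (metis power2_abs)
    \<comment> \<open>On a horizontal side (Im z)^2 = N^2, so N^2 + z^2 contains the factor Re z
      that cancels the singularity of the resolvent bound.\<close>
    have "?h = of_real (Re z) * (of_real (Re z) + 2 * \<i> * of_real (Im z)) / of_real (N\<^sup>2)"
    proof -
      have "of_real (N\<^sup>2) + z\<^sup>2 = of_real (Re z) * (of_real (Re z) + 2 * \<i> * of_real (Im z))"
        using Im2 by (auto simp: complex_eq_iff power2_eq_square)
      then show ?thesis
        using N by (simp add: field_simps)
    qed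
    then have "norm ?h = \<bar>Re z\<bar> * norm (of_real (Re z) + 2 * \<i> * of_real (Im z)) / N\<^sup>2"
      by (simp add: norm_mult norm_divide norm_power)
    also have "\<dots> \<le> \<bar>Re z\<bar> * (N + 2 * N) / N\<^sup>2"
      using ReIm by (intro divide_right_mono mult_left_mono norm_triangle_mono)
        (auto simp: norm_mult)
    also have "\<dots> = \<bar>Re z\<bar> * (3 / N)"
      using N by (simp add: power2_eq_square)
    finally have h: "norm ?h \<le> \<bar>Re z\<bar> * (3 / N)" .
    have "norm ?h * norm (ext y z) \<le> 3 * norm y / N"
    proof (cases "Re z = 0")
      case True
      then show ?thesis using h N by simp
    next
      case nz: False
      have "norm ?h * norm (ext y z) \<le> (\<bar>Re z\<bar> * (3 / N)) * (norm y / \<bar>Re z\<bar>)"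
        using R_norm[OF nz, of y] nz h N by (intro mult_mono) auto
      also have "\<dots> = 3 * norm y / N"
        using nz by simp
      finally show ?thesis .
    qed
    moreover have "N - 1 \<le> norm (1 - z)"
      using abs_Im_le_cmod[of "1 - z"] ReIm by simp
    ultimately show ?thesis by simp
  qed
  have "norm ((?h / (1 - z)) *\<^sub>C ext y z) = norm ?h * norm (ext y z) / norm (1 - z)"
    by (simp add: norm_scaleC norm_divide)
  also have "\<dots> \<le> (3 * norm y / N) / (N - 1)"
    using main N by (intro frac_le) auto
  finally show ?thesis by simp
qed

text \<open>Although z -> R z y is now entire, its bound degenerates at the axis, so Liouville's
  theorem does not apply directly. The weighted integral of the continuation for R 1 y is 0 and
  splits, by \<open>R_ext\<close>, into a residue at 1 and an integral with the additional kernel 1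
  / (1 - z). Weight and kernel together make the latter vanish as N grows.\<close>

theorem spec_empty_imp_zero:
  assumes "spec y = {}"
  shows "y = 0"
proof -
  let ?y1 = "R 1 y"
  have spec1: "spec ?y1 = {}"
    using assms spec_commuting[OF commuting_R[of 1], of y] by auto
  then have reg: "regular y = UNIV" "regular ?y1 = UNIV"
    using assms by (auto simp: regular_def)
  have bound: "norm ?y1 \<le> 24 * norm y / (N - 1)" if N: "N \<ge> 2" for N :: real
  proof -
    let ?h = "\<lambda>z::complex. 1 + z\<^sup>2 / of_real (N\<^sup>2)"
    let ?B = "rect_boundary (- N) N N"
    have hol: "?h holomorphic_on UNIV"
      using N by (intro holomorphic_intros) auto
    have ne: "z \<noteq> 1" if "z \<in> ?B" for z
      using that N by (auto simp: rect_boundary_def)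
    have k: "continuous_on ?B (\<lambda>z. ?h z / (1 - z))" "continuous_on ?B (\<lambda>z. ?h z / (z - 1))"
      using N ne by (auto intro!: continuous_intros)
    have ce: "continuous_on ?B (ext y)"
      by (rule continuous_on_ext) (simp add: reg)
    let ?K = "rint (- N) N N (\<lambda>z. (?h z / (1 - z)) *\<^sub>C ext y z)"
    have "0 = rint (- N) N N (\<lambda>z. ?h z *\<^sub>C ext ?y1 z)"
      using N spec1 by (intro rint_ext_gap[symmetric] hol) auto
    also have "\<dots> = rint (- N) N N (\<lambda>z. (?h z / (1 - z)) *\<^sub>C ext y z + (?h z / (z - 1)) *\<^sub>C ?y1)"
    proof (rule rint_cong)
      fix z assume "z \<in> ?B"
      then have z: "1 - z \<noteq> 0" using ne by auto
      have "?h z *\<^sub>C ext ?y1 z = (?h z / (1 - z)) *\<^sub>C ((1 - z) *\<^sub>C R 1 (ext y z))"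
        using z by (simp add: ext_commuting[OF commuting_R] reg scaleC_scaleC)
      also have "\<dots> = (?h z / (1 - z)) *\<^sub>C ext y z - (?h z / (1 - z)) *\<^sub>C ?y1"
        using R_ext[of z y 1] by (simp add: reg scaleC.diff_right)
      also have "(?h z / (1 - z)) *\<^sub>C ?y1 = - ((?h z / (z - 1)) *\<^sub>C ?y1)"
      proof -
        have "?h z / (1 - z) = - (?h z / (z - 1))"
          by (metis minus_diff_eq divide_minus_right)
        then show ?thesis by (simp only: scaleC_minus)
      qed
      finally show "?h z *\<^sub>C ext ?y1 z = (?h z / (1 - z)) *\<^sub>C ext y z + (?h z / (z - 1)) *\<^sub>C ?y1"
        by (simp only: diff_minus_eq_add)
    qed (use N in auto)
    also have "\<dots> = ?K + rint (- N) N N (\<lambda>z. ?h z / (z - 1)) *\<^sub>C ?y1"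
      using N k by (subst rint_add) (auto simp: rint_scaleC_const intro!: continuous_intros ce)
    also have "rint (- N) N N (\<lambda>z. ?h z / (z - 1)) = 2 * pi * \<i> * ?h 1"
      using N by (intro rint_Cauchy_formula hol) auto
    finally have "(2 * pi * \<i> * ?h 1) *\<^sub>C ?y1 = - ?K"
      by (simp add: eq_neg_iff_add_eq_0 add.commute)
    then have "norm ((2 * pi * \<i> * ?h 1) *\<^sub>C ?y1) = norm ?K"
      by simp
    \<comment> \<open>The perimeter 8 N times 3 / (N (N - 1)) gives the constant 24.\<close>
    also have "norm ?K \<le> 2 * (3 * norm y / (N * (N - 1))) * (N - - N) +
        2 * (3 * norm y / (N * (N - 1))) * (2 * N)"
      using N assms ne by (intro norm_rint_le weight_bound) (auto intro!: continuous_intros ce k)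
    also have "\<dots> = 24 * norm y / (N - 1)"
    proof -
      have "2 * (3 * w / (N * M)) * (N - - N) + 2 * (3 * w / (N * M)) * (2 * N) = 24 * w / M"
        if "M \<noteq> 0" for w M :: real
        using N that by (simp add: field_simps)
      then show ?thesis using N by simp
    qed
    finally have *: "norm (2 * pi * \<i> * ?h 1) * norm ?y1 \<le> 24 * norm y / (N - 1)"
      by (simp only: norm_scaleC)
    \<comment> \<open>The weight is at least 1 at the residue point, so the factor in front of R 1 y
      has norm at least 1 for every N.\<close>
    have "?h 1 = of_real (1 + 1 / N\<^sup>2)"
      by simp
    then have "norm (2 * pi * \<i> * ?h 1) = 2 * pi * (1 + 1 / N\<^sup>2)"
      by (simp only: norm_mult norm_of_real) simp
    moreover have "1 * 1 \<le> 2 * pi * (1 + 1 / N\<^sup>2)"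
      using pi_gt3 by (intro mult_mono) auto
    ultimately have "1 * norm ?y1 \<le> norm (2 * pi * \<i> * ?h 1) * norm ?y1"
      by (intro mult_right_mono) auto
    with * show ?thesis by simp
  qed
  have "norm ?y1 \<le> 0"
  proof (rule ccontr)
    assume "\<not> norm ?y1 \<le> 0"
    then have pos: "norm ?y1 > 0" by simp
    \<comment> \<open>Solves 24 norm y = norm (R 1 y) (N - 2), so the bound with N - 1 is
      contradicted.\<close>
    define N where "N = 2 + 24 * norm y / norm ?y1"
    have N: "N \<ge> 2"
      unfolding N_def by simp
    have "norm ?y1 * (N - 1) \<le> 24 * norm y"
      using bound[OF N] N by (simp add: le_divide_eq)
    also have "\<dots> = norm ?y1 * (N - 2)"
      using pos by (simp add: N_def)
    finally show False
      using pos by simp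
  qed
  then show ?thesis
    using R_inj[of 1 y] by simp
qed

text \<open>Insert the relation at l' into R l = R l' + (l' - l) R l R l' and pull Q out. The
  quotient argument supplies only l' = -1; analytic continuation needs all l off the axis.\<close>

lemma solution_all_axis:
  assumes Q: "commuting Q" and l: "Re l \<noteq> 0" "Re l' \<noteq> 0"
    and eq: "R l' y = Q (R l' f + y + (m - l') *\<^sub>C R l' y)"
  shows "R l y = Q (R l f + y + (m - l) *\<^sub>C R l y)"
proof -
  have bQ: "bounded_clinear Q"
    using Q by (simp add: commuting_def)
  note Q_simps = bounded_clinearD(2-)[OF bQ]
  have res: "R l x = R l' x + (l' - l) *\<^sub>C R l (R l' x)" for x
    using R_resolvent[OF l, of x] by (simp add: algebra_simps)
  have RQ: "R l (Q x) = Q (R l x)" for x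
    using Q l by (simp add: commuting_def)
  have "R l y = Q (R l' f + y + (m - l') *\<^sub>C R l' y) +
      (l' - l) *\<^sub>C Q (R l (R l' f + y + (m - l') *\<^sub>C R l' y))"
    by (subst res, subst eq, subst (2) eq, subst RQ) simp
  also have "\<dots> = Q (R l' f + (l' - l) *\<^sub>C R l (R l' f) + y + (l' - l) *\<^sub>C R l y +
      (m - l') *\<^sub>C (R l' y + (l' - l) *\<^sub>C R l (R l' y)))"
    by (simp add: Q_simps R_simps l scaleC_add_right scaleC_scaleC mult.commute)
  also have "\<dots> = Q (R l f + y + ((l' - l) *\<^sub>C R l y + (m - l') *\<^sub>C R l y))"
    by (simp only: res[symmetric] add.assoc)
  also have "(l' - l) *\<^sub>C R l y + (m - l') *\<^sub>C R l y = (m - l) *\<^sub>C R l y"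
    by (simp add: scaleC_add_left[symmetric])
  finally show ?thesis .
qed

text \<open>Near the axis point m the unknown R z y is the fixed point of an equation whose data
  involve only R z f and y. Replacing R z f by its local continuation gives an analytic fixed point,
  and uniqueness identifies it with R z y off the axis.\<close>

lemma spec_solution:
  assumes Q: "commuting Q"
    and eq: "R (- 1) y = Q (R (- 1) f + y + (\<i> * of_real \<xi> + 1) *\<^sub>C R (- 1) y)"
    and "\<xi> \<notin> spec f"
  shows "\<xi> \<notin> spec y"
proof -
  let ?m = "\<i> * complex_of_real \<xi>"
  have bQ: "bounded_clinear Q"
    using Q by (simp add: commuting_def)
  obtain r where r: "r > 0" and fix_ex: "\<forall>U F. open U \<and> U \<subseteq> ball ?m r \<and> vanalytic_on F U \<longrightarrow>
      (\<exists>E. vanalytic_on E U \<and> (\<forall>z\<in>U. \<forall>x. x = Q (F z + (?m - z) *\<^sub>C x) \<longleftrightarrow> x = E z))"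
    using vanalytic_fixpoint[OF bQ, of ?m] by blast
  obtain V F where V: "open V" "?m \<in> V" "vanalytic_on F V" "\<forall>z\<in>V. Re z \<noteq> 0 \<longrightarrow> F z = R z f"
    by (rule not_specE[OF assms(3)])
  let ?U = "V \<inter> ball ?m r"
  have "vanalytic_on (\<lambda>z. F z + y) ?U"
    using V by (intro vanalytic_on_add vanalytic_on_const) (auto intro: vanalytic_on_subset)
  then obtain E where E: "vanalytic_on E ?U"
      "\<forall>z\<in>?U. \<forall>x. x = Q (F z + y + (?m - z) *\<^sub>C x) \<longleftrightarrow> x = E z"
    using fix_ex[rule_format, of ?U "\<lambda>z. F z + y"] V by auto
  show ?thesis
  proof (rule not_specI[OF _ _ E(1)])
    show "E z = R z y" if "z \<in> ?U" "Re z \<noteq> 0" for z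
    proof -
      have "R z y = Q (R z f + y + (?m - z) *\<^sub>C R z y)"
        by (rule solution_all_axis[OF Q that(2), of "- 1"]) (use eq in auto)
      moreover have "F z = R z f"
        using V(4) that by auto
      ultimately show ?thesis
        using E(2)[rule_format, OF that(1), of "R z y"] by simp
    qed
  qed (use V r in auto)
qed

lemma proj_add:
  assumes "a \<le> b" "a \<notin> spec x" "b \<notin> spec x" "a \<notin> spec y" "b \<notin> spec y"
  shows "proj a b (x + y) = proj a b x + proj a b y"
proof -
  let ?B = "rect_boundary a b 1"
  note regx = rect_boundary_regular[OF assms(2,3) zero_less_one]
    and regy = rect_boundary_regular[OF assms(4,5) zero_less_one]
  have regxy: "?B \<subseteq> regular (x + y)"
    using assms spec_add[of x y] by (intro rect_boundary_regular) auto
  have ext: "ext (x + y) z = ext x z + ext y z" if "z \<in> ?B" for z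
  proof -
    let ?H = "\<lambda>z. ext (x + y) z - (ext x z + ext y z)"
    have "?H z = 0"
    proof (rule off_axis_closure[where H = ?H])
      show "isCont ?H z"
        using that regx regy regxy by (intro continuous_intros isCont_ext) auto
    qed (simp add: R_simps)
    then show ?thesis by simp
  qed
  have "rint a b 1 (ext (x + y)) = rint a b 1 (\<lambda>z. ext x z + ext y z)"
    using assms by (intro rint_cong ext) auto
  also have "\<dots> = rint a b 1 (ext x) + rint a b 1 (ext y)"
    using assms by (intro rint_add continuous_on_ext regx regy) auto
  finally show ?thesis
    by (simp add: proj_def scaleC_add_right)
qed

text \<open>One P must serve f and u together, because the equation is projected as a whole. It
  therefore depends on K and L only, and its properties are claimed just for vectors with spectrum
  in their union.\<close>

definition splitting :: "real set \<Rightarrow> real set \<Rightarrow> ('y \<Rightarrow> 'y) \<Rightarrow> bool"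
  where "splitting K L P \<longleftrightarrow>
    (\<forall>x. spec x \<subseteq> K \<union> L \<longrightarrow> spec (P x) \<subseteq> spec x \<inter> K \<and> spec (x - P x) \<subseteq> spec x \<inter> L \<and>
      (\<exists>q. P x = R (- 1) (R (- 1) q)) \<and> (\<forall>Q. commuting Q \<longrightarrow> P (Q x) = Q (P x)) \<and>
      (\<forall>y. spec y \<subseteq> K \<union> L \<longrightarrow> P (x + y) = P x + P y))"

lemma splittingD:
  assumes "splitting K L P" "spec x \<subseteq> K \<union> L"
  shows "spec (P x) \<subseteq> spec x \<inter> K" "spec (x - P x) \<subseteq> spec x \<inter> L"
    "\<exists>q. P x = R (- 1) (R (- 1) q)" "commuting Q \<Longrightarrow> P (Q x) = Q (P x)"
    "spec y \<subseteq> K \<union> L \<Longrightarrow> P (x + y) = P x + P y"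
  using assms unfolding splitting_def by blast+

theorem spectral_splitting:
  assumes "compact K" "closed L" "K \<inter> L = {}"
  shows "\<exists>P. splitting K L P"
proof -
  obtain I :: "real set set" and a b where I: "finite I"
    and cover: "K \<subseteq> (\<Union>i\<in>I. {a i<..<b i})"
    and fam: "disjoint_family_on (\<lambda>i. {a i..b i}) I"
    and ab': "\<forall>i\<in>I. a i < b i \<and> {a i..b i} \<inter> L = {} \<and> a i \<notin> K \<and> b i \<notin> K"
    using compact_closed_separating_intervals[OF assms] by blast
  have ab: "a i < b i" "{a i..b i} \<inter> L = {}" "a i \<notin> K" "b i \<notin> K" if "i \<in> I" for i
    using ab' that by blast+
  have disj: "{a i..b i} \<inter> {a j..b j} = {}" if "i \<in> I" "j \<in> I" "i \<noteq> j" for i j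
    using fam that by (simp add: disjoint_family_on_def)
  define P where "P x = (\<Sum>i\<in>I. proj (a i) (b i) x)" for x
  have n: "a i \<notin> spec x" "b i \<notin> spec x" if "i \<in> I" "spec x \<subseteq> K \<union> L" for i x
  proof -
    have "a i \<in> {a i..b i}" "b i \<in> {a i..b i}"
      using ab(1)[OF that(1)] by auto
    then show "a i \<notin> spec x" "b i \<notin> spec x"
      using ab(2,3,4)[OF that(1)] that(2) by blast+
  qed
  have sub: "spec (proj (a i) (b i) x) \<subseteq> spec x \<inter> {a i<..<b i}" if "i \<in> I" "spec x \<subseteq> K \<union> L" for i x
    using that by (intro spec_proj n ab)
  have "splitting K L P"
    unfolding splitting_def
  proof (intro allI impI conjI)
    fix x assume x: "spec x \<subseteq> K \<union> L"
    have P1: "spec (P x) \<subseteq> (\<Union>i\<in>I. spec (proj (a i) (b i) x))"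
      unfolding P_def by (rule spec_sum[OF I])
    show PK: "spec (P x) \<subseteq> spec x \<inter> K"
    proof
      fix \<xi> assume "\<xi> \<in> spec (P x)"
      then obtain i where "i \<in> I" "\<xi> \<in> spec x" "\<xi> \<in> {a i<..<b i}"
        using P1 sub[OF _ x] by blast
      moreover from this have "\<xi> \<in> {a i..b i}" by simp
      ultimately show "\<xi> \<in> spec x \<inter> K"
        using x ab(2) by blast
    qed
    show "spec (x - P x) \<subseteq> spec x \<inter> L"
    proof
      fix \<xi> assume \<xi>: "\<xi> \<in> spec (x - P x)"
      then have \<xi>x: "\<xi> \<in> spec x"
        using spec_diff[of x "P x"] PK by blast
      \<comment> \<open>The projection over the interval around a point of K removes that point from
        the complement, and the other projections cannot return it since their intervals are
        disjoint.\<close>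
      moreover have "\<xi> \<notin> K"
      proof
        assume "\<xi> \<in> K"
        then obtain i where i: "i \<in> I" "\<xi> \<in> {a i<..<b i}"
          using cover by blast
        let ?rest = "\<Sum>j\<in>I - {i}. proj (a j) (b j) x"
        have "P x = proj (a i) (b i) x + ?rest"
          unfolding P_def by (rule sum.remove[OF I i(1)])
        then have eq: "x - P x = (x - proj (a i) (b i) x) - ?rest"
          by simp
        have "\<xi> \<in> spec (x - proj (a i) (b i) x) \<union> spec ?rest"
          using \<xi> spec_diff[of "x - proj (a i) (b i) x" ?rest] unfolding eq by blast
        moreover have "\<xi> \<notin> spec (x - proj (a i) (b i) x)"
          using spec_minus_proj[OF ab(1)[OF i(1)] n[OF i(1) x]] i(2) by blast
        ultimately obtain j where j: "j \<in> I" "j \<noteq> i" "\<xi> \<in> spec (proj (a j) (b j) x)"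
          using spec_sum[of "I - {i}" "\<lambda>j. proj (a j) (b j) x"] I by blast
        then have "\<xi> \<in> {a j..b j} \<inter> {a i..b i}"
          using sub[OF j(1) x] i(2) by auto
        then show False
          using disj[OF j(1) i(1) j(2)] by blast
      qed
      ultimately show "\<xi> \<in> spec x \<inter> L"
        using x by blast
    qed
    have "\<exists>q. proj (a i) (b i) x = R (- 1) (R (- 1) q)" if "i \<in> I" for i
      using proj_in_range_R[OF less_imp_le[OF ab(1)[OF that]] n[OF that x], of "- 1"] by auto
    then obtain q where q: "\<And>i. i \<in> I \<Longrightarrow> proj (a i) (b i) x = R (- 1) (R (- 1) (q i))"
      by metis
    have lin: "linear (\<lambda>x. R (- 1) (R (- 1) x))"
    proof -
      have "bounded_linear (R (- 1))"
        by (rule bounded_clinearD(1)[OF R_bounded_clinear]) simp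
      then show ?thesis
        using bounded_linear_compose[of "R (- 1)" "R (- 1)"] bounded_linear.linear by blast
    qed
    have "P x = R (- 1) (R (- 1) (\<Sum>i\<in>I. q i))"
      unfolding P_def linear_sum[OF lin] by (rule sum.cong[OF refl q])
    then show "\<exists>q. P x = R (- 1) (R (- 1) q)" ..
    show "P (Q x) = Q (P x)" if Q: "commuting Q" for Q
    proof -
      have "linear Q"
        using Q bounded_clinearD(1) bounded_linear.linear by (auto simp: commuting_def)
      then show ?thesis
        unfolding P_def using ab(1) n[OF _ x]
        by (auto simp: linear_sum intro!: sum.cong proj_commuting[OF Q] less_imp_le)
    qed
    show "P (x + y) = P x + P y" if y: "spec y \<subseteq> K \<union> L" for y
      unfolding P_def sum.distrib[symmetric] using ab(1) n[OF _ x] n[OF _ y]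
      by (intro sum.cong refl proj_add less_imp_le)
  qed
  then show ?thesis by blast
qed

end

section \<open>Functions that agree on the half line, and arithmetic of classes\<close>

lemma BUC_cong: "(\<And>t. t \<ge> 0 \<Longrightarrow> f t = g t) \<Longrightarrow> f \<in> BUC \<longleftrightarrow> g \<in> BUC"
proof -
  assume eq: "\<And>t. t \<ge> 0 \<Longrightarrow> f t = g t"
  have "f ` {0..} = g ` {0..}"
    using eq by (intro image_cong) auto
  moreover have "uniformly_continuous_on {0..} f \<longleftrightarrow> uniformly_continuous_on {0..} g"
    using eq by (simp add: uniformly_continuous_on_def)
  ultimately show ?thesis
    by (simp add: BUC_def)
qed

lemma C0_cong:
  assumes "\<And>t. t \<ge> 0 \<Longrightarrow> f t = g t"
  shows "f \<in> C0 \<longleftrightarrow> g \<in> C0"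
proof -
  have "(f \<longlongrightarrow> 0) at_top \<longleftrightarrow> (g \<longlongrightarrow> 0) at_top"
    by (rule tendsto_cong) (use assms in \<open>auto simp: eventually_at_top_linorder\<close>)
  then show ?thesis
    using BUC_cong[of f g] assms by (simp add: C0_def)
qed

lemma C0_BUC: "f \<in> C0 \<Longrightarrow> f \<in> BUC"
  by (simp add: C0_def)

lemma C0_diff: "f \<in> C0 \<Longrightarrow> g \<in> C0 \<Longrightarrow> (\<lambda>t. f t - g t) \<in> C0"
  using C0_add[OF _ C0_minus, of f g] by simp

lemma buc_class_eqI: "f \<in> BUC \<Longrightarrow> (\<And>t. t \<ge> 0 \<Longrightarrow> f t = g t) \<Longrightarrow> buc_class f = buc_class g"
  using C0_cong[of "\<lambda>t. f t - g t" "\<lambda>t. 0"] BUC_cong[of f g] by (simp add: buc_class_eq_iff C0_0)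

lemma buc_class_eq_0_iff: "f \<in> BUC \<Longrightarrow> buc_class f = 0 \<longleftrightarrow> f \<in> C0"
  by (simp add: buc_class_zero buc_class_eq_iff BUC_0)

lemma buc_class_diff:
  assumes "f \<in> BUC" "g \<in> BUC"
  shows "buc_class f - buc_class g = buc_class (\<lambda>t. f t - g t :: 'a::complex_normed_vector)"
  using assms buc_class_add[OF _ BUC_minus, of f g] by (simp add: buc_class_minus[symmetric])

lemma BUC_scaleC: "(f :: real \<Rightarrow> 'a::complex_normed_vector) \<in> BUC \<Longrightarrow> (\<lambda>t. c *\<^sub>C f t) \<in> BUC"
  by (rule BUC_bounded_linear[OF bounded_linear_scaleC])

lemma C0_scaleC: "(f :: real \<Rightarrow> 'a::complex_normed_vector) \<in> C0 \<Longrightarrow> (\<lambda>t. c *\<^sub>C f t) \<in> C0"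
  by (rule C0_bounded_linear[OF bounded_linear_scaleC])

lemma BUC_continuous_on: "f \<in> BUC \<Longrightarrow> continuous_on {0..} f"
  by (auto simp: BUC_def uniformly_continuous_imp_continuous)

lemma BUC_sum: "finite I \<Longrightarrow> (\<And>i. i \<in> I \<Longrightarrow> f i \<in> BUC) \<Longrightarrow> (\<lambda>t. \<Sum>i\<in>I. f i t) \<in> BUC"
  by (induction I rule: finite_induct) (auto simp: BUC_0 BUC_add)

section \<open>Completeness of the quotient\<close>

lemma BUC_uniform_limit:
  fixes g :: "real \<Rightarrow> 'a::real_normed_vector"
  assumes "\<And>n. f n \<in> BUC" "\<And>n t. t \<ge> 0 \<Longrightarrow> norm (g t - f n t) \<le> e n" "e \<longlonglongrightarrow> 0"
  shows "g \<in> BUC"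
proof -
  have small: "\<exists>n. e n < d" if "d > 0" for d
    using order_tendstoD(2)[OF assms(3) that] by (auto simp: eventually_sequentially)
  have "bounded (g ` {0..})"
  proof -
    obtain n where n: "e n < 1" using small[of 1] by auto
    have "norm (g t) \<le> supnorm (f n) + 1" if "t \<ge> 0" for t
      using norm_triangle_sub[of "g t" "f n t"] norm_le_supnorm[OF assms(1) that, of n] assms(2)[OF that, of n] n
      by linarith
    then show ?thesis by (auto simp: bounded_iff)
  qed
  moreover have "uniformly_continuous_on {0..} g"
    unfolding uniformly_continuous_on_def
  proof (intro allI impI)
    fix d :: real assume "d > 0"
    then obtain n where n: "e n < d / 3" using small[of "d / 3"] by auto
    have uc: "uniformly_continuous_on {0..} (f n)" using assms(1) by (simp add: BUC_def)
    obtain c where c: "c > 0" "\<And>s t. s \<in> {0..} \<Longrightarrow> t \<in> {0..} \<Longrightarrow> dist t s < c \<Longrightarrow> dist (f n t) (f n s) < d / 3"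
      using uc[unfolded uniformly_continuous_on_def, rule_format, of "d / 3"] \<open>d > 0\<close> by auto
    have "dist (g t) (g s) < d" if "s \<in> {0..}" "t \<in> {0..}" "dist t s < c" for s t
    proof -
      have "g t - g s = (g t - f n t) + (f n t - f n s) - (g s - f n s)"
        by simp
      also have "norm \<dots> \<le> norm (g t - f n t) + norm (f n t - f n s) + norm (g s - f n s)"
        by (meson norm_triangle_ineq4 norm_triangle_ineq add_right_mono order_trans)
      also have "\<dots> < d"
        using assms(2)[of t n] assms(2)[of s n] c(2)[OF that] that n by (auto simp: dist_norm)
      finally show ?thesis by (simp add: dist_norm)
    qed
    then show "\<exists>c>0. \<forall>s\<in>{0..}. \<forall>t\<in>{0..}. dist t s < c \<longrightarrow> dist (g t) (g s) < d"
      using c(1) by blast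
  qed
  ultimately show ?thesis by (simp add: BUC_def)
qed

text \<open>A rapidly convergent subsequence telescopes into classes whose representatives can be
  chosen with summable sup norms. The uniformly convergent series of representatives stays in
  \<open>BUC\<close> and its class is the limit.\<close>

instance buc_quot :: (complex_banach) complex_banach
proof
  fix X :: "nat \<Rightarrow> 'a buc_quot"
  assume X: "Cauchy X"
  have "\<exists>N. \<forall>m\<ge>N. \<forall>n\<ge>N. norm (X m - X n) < (1 / 2) ^ k" for k :: nat
    using CauchyD[OF X, of "(1 / 2) ^ k"] by simp
  then obtain N where N: "\<And>k m n. m \<ge> N k \<Longrightarrow> n \<ge> N k \<Longrightarrow> norm (X m - X n) < (1 / 2) ^ k"
    by metis
  \<comment> \<open>The partial sums dominate N k, and the added k makes the subsequence strictly
    increasing.\<close>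
  define r where "r k = (\<Sum>i\<le>k. N i) + k" for k
  have r: "strict_mono r" "\<And>k. N k \<le> r k"
    by (auto simp: strict_mono_Suc_iff r_def intro: trans_le_add1 member_le_sum)
  then have r3: "N k \<le> r (Suc k)" for k
    by (meson le_SucI lessI less_imp_le order_trans strict_mono_less_eq)
  have "\<exists>d\<in>BUC. buc_class d = X (r (Suc k)) - X (r k) \<and> supnorm d < 2 * (1 / 2) ^ k" for k
  proof -
    obtain d where d: "d \<in> BUC" "X (r (Suc k)) - X (r k) = buc_class d"
        "supnorm d < norm (X (r (Suc k)) - X (r k)) + (1 / 2) ^ k"
      using norm_buc_quot_approx[of "(1 / 2) ^ k"] by (metis zero_less_divide_1_iff zero_less_numeral zero_less_power)
    then show ?thesis
      using N[OF r3 r(2), of k] by (intro bexI[of _ d]) auto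
  qed
  then obtain d where d: "\<And>k. d k \<in> BUC" "\<And>k. buc_class (d k) = X (r (Suc k)) - X (r k)"
      "\<And>k. supnorm (d k) < 2 * (1 / 2) ^ k"
    by metis
  obtain g0 where g0: "g0 \<in> BUC" "X (r 0) = buc_class g0"
    by (rule buc_class_cases)
  define s where "s n t = g0 t + (\<Sum>k<n. d k t)" for n t
  have s: "s n \<in> BUC" for n
    unfolding s_def[abs_def] by (intro BUC_add BUC_sum g0 d) auto
  have class_s: "buc_class (s n) = X (r n)" for n
  proof (induction n)
    case (Suc n)
    have "s (Suc n) = (\<lambda>t. s n t + d n t)"
      by (simp add: s_def fun_eq_iff)
    then show ?case
      using Suc d s by (simp add: buc_class_add[symmetric])
  qed (simp add: s_def[abs_def] g0)
  define G where "G t = g0 t + (\<Sum>k. d k t)" for t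
  have bd: "norm (d k t) \<le> 2 * (1 / 2) ^ k" if "t \<ge> 0" for k t
    using norm_le_supnorm[OF d(1) that, of k] d(3)[of k] by linarith
  have geo: "summable (\<lambda>k. 2 * (1 / 2 :: real) ^ k)"
    by (intro summable_mult summable_geometric) auto
  have G: "norm (G t - s n t) \<le> 4 * (1 / 2) ^ n" if "t \<ge> 0" for n t
  proof -
    have sm: "summable (\<lambda>k. norm (d k t))"
      by (rule summable_comparison_test'[OF geo, of 0]) (use bd that in auto)
    then have sm': "summable (\<lambda>k. d k t)"
      by (rule summable_norm_cancel)
    have "G t - s n t = (\<Sum>k. d (k + n) t)"
      unfolding G_def s_def by (simp add: suminf_minus_initial_segment[OF sm'])
    also have "norm \<dots> \<le> (\<Sum>k. norm (d (k + n) t))"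
      using sm by (intro summable_norm summable_ignore_initial_segment)
    also have "\<dots> \<le> (\<Sum>k. 2 * (1 / 2) ^ (k + n))"
      using sm geo bd that by (intro suminf_le summable_ignore_initial_segment) auto
    also have "\<dots> = (2 * (1 / 2) ^ n) * (\<Sum>k. (1 / 2) ^ k)"
      by (subst suminf_mult[symmetric]) (auto simp: power_add mult_ac)
    also have "\<dots> = 4 * (1 / 2) ^ n"
      by (simp add: suminf_geometric)
    finally show ?thesis .
  qed
  have lim: "(\<lambda>n. 4 * (1 / 2 :: real) ^ n) \<longlonglongrightarrow> 0"
    by (intro tendsto_mult_right_zero LIMSEQ_power_zero) auto
  have GB: "G \<in> BUC"
    by (rule BUC_uniform_limit[OF s G lim])
  have "(\<lambda>n. X (r n) - buc_class G) \<longlonglongrightarrow> 0"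
  proof (rule Lim_null_comparison[OF _ lim], rule always_eventually, rule allI)
    fix n
    have "norm (X (r n) - buc_class G) = norm (buc_class (\<lambda>t. G t - s n t))"
      using s GB by (simp add: class_s[symmetric] buc_class_diff[symmetric] norm_minus_commute)
    also have "\<dots> \<le> supnorm (\<lambda>t. G t - s n t)"
      by (intro norm_buc_class_le BUC_diff s GB)
    also have "\<dots> \<le> 4 * (1 / 2) ^ n"
      by (intro supnorm_le G)
    finally show "norm (X (r n) - buc_class G) \<le> 4 * (1 / 2) ^ n" .
  qed
  then have "(X \<circ> r) \<longlonglongrightarrow> buc_class G"
    by (simp add: LIM_zero_iff o_def)
  then show "convergent X"
    using Cauchy_converges_subseq[OF X r(1)] by (auto simp: convergent_def)
qed

section \<open>Differentiation on the half line\<close>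

lemma has_vector_derivative_halfline:
  assumes "(f has_vector_derivative d) (at t within {0..b})" "t < b"
  shows "(f has_vector_derivative d) (at t within {0..})"
proof -
  have "at t within {0..b} = at t within {0..}"
    by (rule at_within_nhd[of _ "{..<b}"]) (use assms(2) in auto)
  then show ?thesis using assms(1) by simp
qed

lemma hderiv_eqI:
  assumes "(g has_vector_derivative d) (at t within {0..})" "t \<ge> 0"
  shows "hderiv g t = d"
  unfolding hderiv_def
proof (rule vector_derivative_within[OF _ assms(1)])
  have "at t within {0..t + 1} = at t within {0..}"
    by (rule at_within_nhd[of _ "{..<t + 1}"]) auto
  moreover have "at t within {0..t + 1} \<noteq> bot"
    using assms(2) by (simp add: trivial_limit_within)
  ultimately show "at t within {0..} \<noteq> bot"
    by simp
qed

lemma D_domI: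
  assumes "g \<in> BUC" "g' \<in> BUC" "\<And>t. t \<ge> 0 \<Longrightarrow> (g has_vector_derivative g' t) (at t within {0..})"
  shows "g \<in> D_dom" "\<And>t. t \<ge> 0 \<Longrightarrow> hderiv g t = g' t"
proof -
  show eq: "\<And>t. t \<ge> 0 \<Longrightarrow> hderiv g t = g' t"
    using hderiv_eqI assms(3) by blast
  have "hderiv g \<in> BUC"
    using assms(2) BUC_cong[of "hderiv g" g'] eq by blast
  then show "g \<in> D_dom"
    using assms differentiableI_vector by (auto simp: D_dom_def)
qed

lemma D_domD:
  assumes "g \<in> D_dom"
  shows "g \<in> BUC" "hderiv g \<in> BUC"
    "t \<ge> 0 \<Longrightarrow> (g has_vector_derivative hderiv g t) (at t within {0..})"
  using assms vector_derivative_works by (auto simp: D_dom_def hderiv_def)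

lemma D_dom_add:
  assumes "f \<in> D_dom" "g \<in> D_dom"
  shows "(\<lambda>t. f t + g t) \<in> D_dom" "\<And>t. t \<ge> 0 \<Longrightarrow> hderiv (\<lambda>t. f t + g t) t = hderiv f t + hderiv g t"
  using D_domI[of "\<lambda>t. f t + g t" "\<lambda>t. hderiv f t + hderiv g t"] D_domD[OF assms(1)] D_domD[OF assms(2)]
  by (auto simp: BUC_add intro!: has_vector_derivative_add)

lemma D_dom_bounded_linear:
  assumes "f \<in> D_dom" "bounded_linear L"
  shows "(\<lambda>t. L (f t)) \<in> D_dom" "\<And>t. t \<ge> 0 \<Longrightarrow> hderiv (\<lambda>t. L (f t)) t = L (hderiv f t)"
  using D_domI[of "\<lambda>t. L (f t)" "\<lambda>t. L (hderiv f t)"] D_domD[OF assms(1)]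
  by (auto simp: BUC_bounded_linear assms(2) intro!: bounded_linear.has_vector_derivative[OF assms(2)])

lemma uniformly_continuous_on_bounded_derivative:
  fixes u :: "real \<Rightarrow> 'a::real_normed_vector"
  assumes "\<And>t. t \<ge> 0 \<Longrightarrow> (u has_vector_derivative u' t) (at t within {0..})"
    and "\<And>t. t \<ge> 0 \<Longrightarrow> norm (u' t) \<le> B"
  shows "uniformly_continuous_on {0..} u"
proof -
  have B: "B \<ge> 0" using assms(2)[of 0] norm_ge_zero order_trans by blast
  have "B-lipschitz_on {0..} u"
  proof (rule bounded_derivative_imp_lipschitz)
    show "(u has_derivative (\<lambda>h. h *\<^sub>R u' t)) (at t within {0..})" if "t \<in> {0..}" for t
      using assms(1) that by (simp add: has_vector_derivative_def)
    show "onorm (\<lambda>h. h *\<^sub>R u' t) \<le> B" if "t \<in> {0..}" for t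
      using assms(2)[of t] that by (intro onorm_le) (simp add: mult.commute[of B] mult_left_mono)
  qed (use B in auto)
  then show ?thesis by (rule lipschitz_on_uniformly_continuous)
qed

text \<open>Over a fixed short step h, uniform continuity of u' keeps the increment of u within h e
  / 3 of h u'(t), and the two end values of u contribute h e / 3 each. This is what makes
  differentiation well defined on classes.\<close>

lemma Barbalat_C0:
  assumes "u \<in> D_dom" "u \<in> C0"
  shows "hderiv u \<in> C0"
proof -
  note u = D_domD[OF assms(1)]
  have "\<forall>\<^sub>F t in at_top. norm (hderiv u t) < e" if "e > 0" for e
  proof -
    have uc: "uniformly_continuous_on {0..} (hderiv u)"
      using u(2) by (simp add: BUC_def)
    obtain c where c: "c > 0" "\<And>s t. s \<in> {0..} \<Longrightarrow> t \<in> {0..} \<Longrightarrow> dist t s < c \<Longrightarrow>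
        dist (hderiv u t) (hderiv u s) < e / 3"
      using uc[unfolded uniformly_continuous_on_def, rule_format, of "e / 3"] \<open>e > 0\<close> by auto
    define h where "h = c / 2"
    have h: "h > 0" "h < c" using c by (auto simp: h_def)
    have "(u \<longlongrightarrow> 0) at_top" using assms(2) by (simp add: C0_def)
    moreover have "h * e / 3 > 0"
      using h \<open>e > 0\<close> by simp
    ultimately have "\<forall>\<^sub>F t in at_top. dist (u t) 0 < h * e / 3"
      by (rule tendstoD)
    then have "\<forall>\<^sub>F t in at_top. norm (u t) < h * e / 3"
      by (simp only: norm_conv_dist)
    then obtain t0 where t0: "\<And>t. t \<ge> t0 \<Longrightarrow> norm (u t) < h * e / 3"
      by (auto simp: eventually_at_top_linorder)
    have "norm (hderiv u t) < e" if t: "t \<ge> max t0 0" for t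
    proof -
      have der: "((\<lambda>s. u s - s *\<^sub>R hderiv u t) has_derivative (\<lambda>k. k *\<^sub>R (hderiv u s - hderiv u t)))
          (at s within {t..t + h})" if "s \<in> {t..t + h}" for s
      proof -
        have "(u has_vector_derivative hderiv u s) (at s within {t..t + h})"
          using that t by (intro has_vector_derivative_within_subset[OF u(3)]) auto
        then have "((\<lambda>s. u s - s *\<^sub>R hderiv u t) has_vector_derivative (hderiv u s - 1 *\<^sub>R hderiv u t))
            (at s within {t..t + h})"
          by (auto intro!: derivative_eq_intros)
        then show ?thesis by (simp add: has_vector_derivative_def)
      qed
      have "norm ((u (t + h) - (t + h) *\<^sub>R hderiv u t) - (u t - t *\<^sub>R hderiv u t)) \<le> e / 3 * norm ((t + h) - t)"
      proof (rule differentiable_bound[OF _ der])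
        show "onorm (\<lambda>k. k *\<^sub>R (hderiv u s - hderiv u t)) \<le> e / 3" if "s \<in> {t..t + h}" for s
        proof (rule onorm_le)
          have "norm (hderiv u s - hderiv u t) \<le> e / 3"
            using c(2)[of t s] that t h by (auto simp: dist_norm)
          then show "norm (k *\<^sub>R (hderiv u s - hderiv u t)) \<le> e / 3 * norm k" for k
            using mult_right_mono[of "norm (hderiv u s - hderiv u t)" "e / 3" "norm k"]
            by (simp add: mult_ac)
        qed
      qed (use h in auto)
      then have "norm (u (t + h) - u t - h *\<^sub>R hderiv u t) \<le> e / 3 * h"
        using h by (simp add: algebra_simps)
      moreover have "norm (h *\<^sub>R hderiv u t) \<le> norm (u (t + h) - u t - h *\<^sub>R hderiv u t) + norm (u (t + h)) + norm (u t)"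
        using norm_triangle_ineq4[of "u (t + h) - u t" "u (t + h) - u t - h *\<^sub>R hderiv u t"]
          norm_triangle_ineq4[of "u (t + h)" "u t"] by simp
      moreover have "norm (u t) < h * e / 3" "norm (u (t + h)) < h * e / 3"
        using t0[of t] t0[of "t + h"] t h by auto
      moreover have "e / 3 * h = h * e / 3"
        by simp
      ultimately have "norm (h *\<^sub>R hderiv u t) < h * e"
        by linarith
      then have "h * norm (hderiv u t) < h * e"
        using h by simp
      then show ?thesis
        using h by simp
    qed
    then show ?thesis
      by (rule eventually_at_top_linorderI)
  qed
  then have "(hderiv u \<longlongrightarrow> 0) at_top"
    by (simp add: tendsto_iff)
  then show ?thesis
    using u(2) by (simp add: C0_def)
qed

lemma D_quot_class:
  assumes "u \<in> D_dom"
  shows "D_quot (buc_class u) = buc_class (hderiv u)"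
proof -
  define v where "v = (SOME v. v \<in> D_dom \<and> buc_class v = buc_class u)"
  have v: "v \<in> D_dom" "buc_class v = buc_class u"
    unfolding v_def using someI[of "\<lambda>v. v \<in> D_dom \<and> buc_class v = buc_class u" u] assms by auto
  let ?d = "\<lambda>t. v t + (- 1) *\<^sub>R u t"
  have L: "bounded_linear (\<lambda>x::'a. (- 1) *\<^sub>R x)"
    by (rule bounded_linear_scaleR_right)
  have d: "?d \<in> D_dom" "\<And>t. t \<ge> 0 \<Longrightarrow> hderiv ?d t = hderiv v t + (- 1) *\<^sub>R hderiv u t"
    using D_dom_add[OF v(1) D_dom_bounded_linear(1)[OF assms L]] D_dom_bounded_linear(2)[OF assms L] by auto
  have "?d \<in> C0"
    using v D_domD(1)[OF v(1)] D_domD(1)[OF assms] by (simp add: buc_class_eq_iff)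
  then have "hderiv ?d \<in> C0"
    by (rule Barbalat_C0[OF d(1)])
  then have "(\<lambda>t. hderiv v t - hderiv u t) \<in> C0"
    using C0_cong[of "hderiv ?d" "\<lambda>t. hderiv v t - hderiv u t"] d(2) by simp
  then have "buc_class (hderiv v) = buc_class (hderiv u)"
    using D_domD(2)[OF v(1)] D_domD(2)[OF assms] by (simp add: buc_class_eq_iff)
  then show ?thesis
    by (simp add: D_quot_def v_def)
qed

section \<open>Bounded solutions of u' = l u - g\<close>

lemma has_vector_derivative_exp_cmult:
  "((\<lambda>t. exp (l * complex_of_real t)) has_vector_derivative l * exp (l * complex_of_real t)) (at t within S)"
  by (rule has_vector_derivative_real_field) (auto intro!: derivative_eq_intros)

lemma has_vector_derivative_scaleC:
  fixes g :: "real \<Rightarrow> 'a::complex_normed_vector"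
  assumes "(f has_vector_derivative f') (at t within S)" "(g has_vector_derivative g') (at t within S)"
  shows "((\<lambda>t. f t *\<^sub>C g t) has_vector_derivative f t *\<^sub>C g' + f' *\<^sub>C g t) (at t within S)"
  using scaleC.has_vector_derivative[OF assms] .

text \<open>Variation of constants: the solutions of u' = l u - g are e^(l t) (c -
  \<open>expint l g t\<close>).\<close>

definition expint :: "complex \<Rightarrow> (real \<Rightarrow> 'a::complex_banach) \<Rightarrow> real \<Rightarrow> 'a"
  where "expint l g t = integral {0..t} (\<lambda>s. exp (- l * complex_of_real s) *\<^sub>C g s)"

lemma expint_deriv:
  assumes "g \<in> BUC" "t \<ge> 0"
  shows "(expint l g has_vector_derivative exp (- l * complex_of_real t) *\<^sub>C g t) (at t within {0..})"
proof (rule has_vector_derivative_halfline)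
  show "(expint l g has_vector_derivative exp (- l * complex_of_real t) *\<^sub>C g t) (at t within {0..t + 1})"
    unfolding expint_def[abs_def]
    by (rule integral_has_vector_derivative)
      (use assms in \<open>auto intro!: continuous_intros continuous_on_subset[OF BUC_continuous_on[OF assms(1)]]\<close>)
qed auto

lemma norm_exp_scaleC:
  "norm (exp (l * complex_of_real t) *\<^sub>C (x :: 'a::complex_normed_vector)) = exp (Re l * t) * norm x"
  by (simp add: norm_scaleC)

lemma expint_diff_bound:
  assumes g: "g \<in> BUC" "\<And>t. t \<ge> 0 \<Longrightarrow> norm (g t) \<le> M" and "Re l \<noteq> 0" "0 \<le> a" "a \<le> b"
  shows "norm (expint l g b - expint l g a) \<le> M * ((exp (- Re l * a) - exp (- Re l * b)) / Re l)"
proof -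
  let ?f = "\<lambda>s. exp (- l * complex_of_real s) *\<^sub>C g s"
  have cont: "continuous_on {0..} ?f"
    by (intro continuous_intros BUC_continuous_on g)
  have "integral {0..a} ?f + integral {a..b} ?f = integral {0..b} ?f"
    using assms by (intro Henstock_Kurzweil_Integration.integral_combine integrable_continuous_interval
        continuous_on_subset[OF cont]) auto
  then have "integral {a..b} ?f + integral {0..a} ?f = integral {0..b} ?f"
    by (subst add.commute)
  then have "integral {a..b} ?f = expint l g b - expint l g a"
    unfolding expint_def by (rule add_implies_diff)
  then have "norm (expint l g b - expint l g a) = norm (integral {a..b} ?f)"
    by (rule arg_cong[OF sym])
  also have "\<dots> \<le> integral {a..b} (\<lambda>s. M * exp (- Re l * s))"
  proof (rule integral_norm_bound_integral)
    show "?f integrable_on {a..b}"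
      using assms by (intro integrable_continuous_interval continuous_on_subset[OF cont]) auto
    show "(\<lambda>s. M * exp (- Re l * s)) integrable_on {a..b}"
      by (intro integrable_continuous_interval continuous_intros)
    show "norm (?f s) \<le> M * exp (- Re l * s)" if "s \<in> {a..b}" for s
      using g(2)[of s] that assms by (simp add: norm_scaleC mult.commute mult_left_mono)
  qed
  also have "((\<lambda>s. M * exp (- Re l * s)) has_integral
      (- M / Re l * exp (- Re l * b) - - M / Re l * exp (- Re l * a))) {a..b}"
    using assms
    by (intro fundamental_theorem_of_calculus)
      (auto simp: has_real_derivative_iff_has_vector_derivative[symmetric] intro!: derivative_eq_intros)
  then have "integral {a..b} (\<lambda>s. M * exp (- Re l * s)) =
      - M / Re l * exp (- Re l * b) - - M / Re l * exp (- Re l * a)"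
    by (rule integral_unique)
  also have "\<dots> = M * ((exp (- Re l * a) - exp (- Re l * b)) / Re l)"
    by (simp add: diff_divide_distrib right_diff_distrib)
  finally show ?thesis .
qed

lemma expint_solves:
  assumes "g \<in> BUC" "t \<ge> 0"
  shows "((\<lambda>t. exp (l * complex_of_real t) *\<^sub>C (c - expint l g t)) has_vector_derivative
    l *\<^sub>C (exp (l * complex_of_real t) *\<^sub>C (c - expint l g t)) - g t) (at t within {0..})"
proof -
  have "((\<lambda>t. exp (l * complex_of_real t) *\<^sub>C (c - expint l g t)) has_vector_derivative
      exp (l * complex_of_real t) *\<^sub>C (0 - exp (- l * complex_of_real t) *\<^sub>C g t) +
      (l * exp (l * complex_of_real t)) *\<^sub>C (c - expint l g t)) (at t within {0..})"
    by (intro has_vector_derivative_scaleC has_vector_derivative_exp_cmult has_vector_derivative_diff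
        expint_deriv assms has_vector_derivative_const)
  moreover have "exp (l * complex_of_real t) * exp (- (l * complex_of_real t)) = 1"
    by (simp add: exp_minus)
  ultimately show ?thesis
    by (simp add: scaleC_scaleC algebra_simps)
qed

lemma BUC_if_derivative_bounded:
  assumes "\<And>t. t \<ge> 0 \<Longrightarrow> (u has_vector_derivative u' t) (at t within {0..})"
    and "\<And>t. t \<ge> 0 \<Longrightarrow> norm (u t) \<le> C" "\<And>t. t \<ge> 0 \<Longrightarrow> norm (u' t) \<le> B"
  shows "u \<in> BUC"
  using uniformly_continuous_on_bounded_derivative[OF assms(1,3)] assms(2)
  by (auto simp: BUC_def bounded_iff)

text \<open>A bound on the solution is enough for membership in \<open>BUC\<close>: the equation
  then bounds the derivative, so the solution is Lipschitz.\<close>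

lemma solve_derivative_bounded:
  assumes g: "g \<in> BUC" and "\<And>t. t \<ge> 0 \<Longrightarrow> norm (exp (l * complex_of_real t) *\<^sub>C (c - expint l g t)) \<le> C"
  defines "U \<equiv> \<lambda>t. exp (l * complex_of_real t) *\<^sub>C (c - expint l g t)"
  shows "U \<in> D_dom" "\<And>t. t \<ge> 0 \<Longrightarrow> hderiv U t = l *\<^sub>C U t - g t"
proof -
  have der: "(U has_vector_derivative l *\<^sub>C U t - g t) (at t within {0..})" if "t \<ge> 0" for t
    unfolding U_def by (rule expint_solves[OF g that])
  have "U \<in> BUC"
  proof (rule BUC_if_derivative_bounded[OF der])
    show "norm (U t) \<le> C" if "t \<ge> 0" for t
      using assms(2)[OF that] by (simp add: U_def)
    show "norm (l *\<^sub>C U t - g t) \<le> cmod l * C + supnorm g" if "t \<ge> 0" for t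
      using assms(2)[OF that] norm_le_supnorm[OF g that]
      by (intro order_trans[OF norm_triangle_ineq4] add_mono) (auto simp: norm_scaleC U_def mult_left_mono)
  qed auto
  then show "U \<in> D_dom" "\<And>t. t \<ge> 0 \<Longrightarrow> hderiv U t = l *\<^sub>C U t - g t"
    using D_domI[of U "\<lambda>t. l *\<^sub>C U t - g t"] der BUC_diff[OF BUC_scaleC g] by blast+
qed

text \<open>For \<open>Re l > 0\<close> the constant is \<open>\<integral>\<^sub>0\<^sup>\<infinity> e\<^sup>-\<^sup>l\<^sup>s g(s) ds\<close>, the only choice that makes the solution bounded.\<close>

lemma bounded_solution:
  assumes g: "g \<in> BUC" "\<And>t. t \<ge> 0 \<Longrightarrow> norm (g t) \<le> M" and "Re l \<noteq> 0"
  obtains c where "Re l < 0 \<Longrightarrow> c = 0"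
    "\<And>t. t \<ge> 0 \<Longrightarrow> norm (exp (l * complex_of_real t) *\<^sub>C (c - expint l g t)) \<le> M / \<bar>Re l\<bar>"
proof (cases "Re l < 0")
  case True
  have M: "M \<ge> 0" using g(2)[of 0] norm_ge_zero order_trans by blast
  show ?thesis
  proof (rule that[of 0])
    fix t :: real assume t: "t \<ge> 0"
    have "norm (expint l g t) \<le> M * ((1 - exp (- Re l * t)) / Re l)"
      using expint_diff_bound[OF g assms(3), of 0 t] t by (simp add: expint_def)
    then have "exp (Re l * t) * norm (expint l g t) \<le> exp (Re l * t) * (M * ((1 - exp (- Re l * t)) / Re l))"
      by (intro mult_left_mono) auto
    also have "\<dots> = M * ((1 - exp (Re l * t)) / \<bar>Re l\<bar>)"
      using True by (simp add: exp_minus field_simps)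
    also have "\<dots> \<le> M * (1 / \<bar>Re l\<bar>)"
      using M by (intro mult_left_mono divide_right_mono) auto
    finally show "norm (exp (l * complex_of_real t) *\<^sub>C (0 - expint l g t)) \<le> M / \<bar>Re l\<bar>"
      by (simp add: norm_scaleC)
  qed auto
next
  case False
  then have l: "Re l > 0" using assms(3) by auto
  have M: "M \<ge> 0" using g(2)[of 0] norm_ge_zero order_trans by blast
  have bnd: "norm (expint l g b - expint l g a) \<le> M * (exp (- Re l * a) / Re l)" if "0 \<le> a" "a \<le> b" for a b
    using expint_diff_bound[OF g assms(3) that] M l
      mult_left_mono[OF divide_right_mono[of "exp (- Re l * a) - exp (- Re l * b)" "exp (- Re l * a)" "Re l"] M]
    by simp
  have lim: "((\<lambda>a. M * (exp (- Re l * a) / Re l)) \<longlongrightarrow> 0) at_top"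
  proof -
    have "((\<lambda>a. exp (- (Re l * a))) \<longlongrightarrow> 0) at_top"
      using l by (intro filterlim_compose[OF exp_at_bot] filterlim_compose[OF filterlim_uminus_at_bot_at_top]
          filterlim_tendsto_pos_mult_at_top[OF tendsto_const] filterlim_ident)
    then show ?thesis
      by (intro tendsto_mult_right_zero tendsto_divide_zero) simp
  qed
  have "Cauchy (\<lambda>n. expint l g (real n))"
  proof (rule CauchyI')
    fix e :: real assume "e > 0"
    from order_tendstoD(2)[OF lim this] obtain a0 where a0: "\<And>a. a \<ge> a0 \<Longrightarrow> M * (exp (- Re l * a) / Re l) < e"
      by (auto simp: eventually_at_top_linorder)
    show "\<exists>N. \<forall>m\<ge>N. \<forall>n>m. dist (expint l g (real m)) (expint l g (real n)) < e"
    proof (intro exI allI impI)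
      fix m n assume "nat \<lceil>a0\<rceil> \<le> m" "m < n"
      then have "norm (expint l g (real n) - expint l g (real m)) < e"
        using bnd[of "real m" "real n"] a0[of "real m"] by (simp add: le_less_trans nat_ceiling_le_eq)
      then show "dist (expint l g (real m)) (expint l g (real n)) < e"
        by (simp add: dist_norm norm_minus_commute)
    qed
  qed
  then obtain c where c: "(\<lambda>n. expint l g (real n)) \<longlonglongrightarrow> c"
    by (auto simp: Cauchy_convergent_iff convergent_def)
  show ?thesis
  proof (rule that[of c])
    fix t :: real assume t: "t \<ge> 0"
    have "norm (c - expint l g t) \<le> M * (exp (- Re l * t) / Re l)"
    proof (rule tendsto_upperbound)
      show "(\<lambda>n. norm (expint l g (real n) - expint l g t)) \<longlonglongrightarrow> norm (c - expint l g t)"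
        by (intro tendsto_intros c)
      show "\<forall>\<^sub>F n in sequentially. norm (expint l g (real n) - expint l g t) \<le> M * (exp (- Re l * t) / Re l)"
        using eventually_ge_at_top[of "nat \<lceil>t\<rceil>"]
        by eventually_elim (use t bnd in \<open>simp add: nat_ceiling_le_eq\<close>)
    qed auto
    then have "exp (Re l * t) * norm (c - expint l g t) \<le> exp (Re l * t) * (M * (exp (- Re l * t) / Re l))"
      by (intro mult_left_mono) auto
    also have "\<dots> = M / \<bar>Re l\<bar>"
      using l by (simp add: exp_minus field_simps)
    finally show "norm (exp (l * complex_of_real t) *\<^sub>C (c - expint l g t)) \<le> M / \<bar>Re l\<bar>"
      by (simp add: norm_scaleC)
  qed (use l in auto)
qed

lemma homogeneous_solution:
  assumes "\<And>t. t \<ge> 0 \<Longrightarrow> (z has_vector_derivative l *\<^sub>C z t) (at t within {0..})" "t \<ge> 0"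
  shows "z t = exp (l * complex_of_real t) *\<^sub>C (z 0 :: 'a::complex_banach)"
proof -
  let ?w = "\<lambda>t. exp (- l * complex_of_real t) *\<^sub>C z t"
  have der: "(?w has_vector_derivative 0) (at t within {0..})" if "t \<ge> 0" for t
  proof -
    have "(?w has_vector_derivative exp (- l * complex_of_real t) *\<^sub>C l *\<^sub>C z t +
        (- l * exp (- l * complex_of_real t)) *\<^sub>C z t) (at t within {0..})"
      by (intro has_vector_derivative_scaleC has_vector_derivative_exp_cmult assms that)
    then show ?thesis by (simp add: scaleC_scaleC mult.commute)
  qed
  obtain c where "\<And>t. t \<in> {0..} \<Longrightarrow> ?w t = c"
    using has_vector_derivative_zero_constant[of "{0..}" ?w] der by auto
  from this[of t] this[of 0] have "?w t = z 0"
    using assms(2) by simp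
  then have "exp (l * complex_of_real t) *\<^sub>C z 0 = (exp (l * complex_of_real t) * exp (- l * complex_of_real t)) *\<^sub>C z t"
    by (simp add: scaleC_scaleC[symmetric])
  then show ?thesis by (simp add: exp_minus)
qed

lemma D_dom_shift:
  assumes "u \<in> D_dom" "s \<ge> 0" "t \<ge> 0"
  shows "((\<lambda>t. u (t + s)) has_vector_derivative hderiv u (t + s)) (at t within {0..})"
proof -
  have 1: "(u has_vector_derivative hderiv u (t + s)) (at (t + s) within {0..})"
    using assms by (intro D_domD(3)) auto
  have "(u \<circ> (\<lambda>t. t + s) has_vector_derivative (1 *\<^sub>R hderiv u (t + s))) (at t within {0..})"
  proof (rule vector_diff_chain_within)
    show "(u has_vector_derivative hderiv u (t + s)) (at (t + s) within (\<lambda>t. t + s) ` {0..})"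
      using assms(2) by (intro has_vector_derivative_within_subset[OF 1]) auto
  qed (auto intro!: derivative_eq_intros)
  then show ?thesis by (simp add: o_def)
qed

text \<open>From a late time on, l u - u' is small, so the bounded solution W with this right-hand
  side is small. The difference z = u - W is bounded and solves the homogeneous equation: it decays
  for Re l < 0, and for Re l > 0 boundedness forces it to be 0.\<close>

lemma solution_in_C0:
  assumes u: "u \<in> D_dom" and l: "Re l \<noteq> 0" and h: "(\<lambda>t. l *\<^sub>C u t - hderiv u t) \<in> C0"
  shows "(u :: real \<Rightarrow> 'a::complex_banach) \<in> C0"
proof -
  note uD = D_domD[OF u]
  let ?h = "\<lambda>t. l *\<^sub>C u t - hderiv u t"
  have "\<forall>\<^sub>F t in at_top. norm (u t) < e" if "e > 0" for e
  proof -
    \<comment> \<open>The bounded solution is at most d / |Re l|, which this choice makes e /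
      2.\<close>
    define d where "d = e / 2 * \<bar>Re l\<bar>"
    have d: "d > 0" "d / \<bar>Re l\<bar> = e / 2" using that l by (auto simp: d_def)
    have "(?h \<longlongrightarrow> 0) at_top" using h by (simp add: C0_def)
    then have "\<forall>\<^sub>F t in at_top. dist (?h t) 0 < d" using d(1) by (rule tendstoD)
    then obtain s0 where s0: "\<And>t. t \<ge> s0 \<Longrightarrow> norm (?h t) < d"
      by (auto simp: eventually_at_top_linorder)
    define s where "s = max s0 0"
    have s: "s \<ge> 0" "\<And>t. t \<ge> 0 \<Longrightarrow> norm (?h (t + s)) \<le> d"
      using s0 by (auto simp: s_def intro!: less_imp_le)
    have hs: "(\<lambda>t. ?h (t + s)) \<in> BUC"
    proof -
      have "uniformly_continuous_on {0..} ?h"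
        using C0_BUC[OF h] by (simp add: BUC_def)
      then have "uniformly_continuous_on {0..} (\<lambda>t. ?h (t + s))"
        unfolding uniformly_continuous_on_def
      proof (intro allI impI)
        fix e :: real
        assume *: "\<forall>e>0. \<exists>d>0. \<forall>x\<in>{0..}. \<forall>x'\<in>{0..}. dist x' x < d \<longrightarrow> dist (?h x') (?h x) < e" "e > 0"
        then obtain c where c: "c > 0" "\<forall>x\<in>{0..}. \<forall>x'\<in>{0..}. dist x' x < c \<longrightarrow> dist (?h x') (?h x) < e"
          by blast
        show "\<exists>d>0. \<forall>x\<in>{0..}. \<forall>x'\<in>{0..}. dist x' x < d \<longrightarrow> dist (?h (x' + s)) (?h (x + s)) < e"
          using c s(1) by (intro exI[of _ c]) (auto simp: dist_real_def)
      qed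
      then show ?thesis
        using s by (auto simp: BUC_def bounded_iff)
    qed
    obtain c where c: "\<And>t. t \<ge> 0 \<Longrightarrow>
        norm (exp (l * complex_of_real t) *\<^sub>C (c - expint l (\<lambda>t. ?h (t + s)) t)) \<le> d / \<bar>Re l\<bar>"
      using bounded_solution[OF hs s(2) l] by metis
    define W where "W t = exp (l * complex_of_real t) *\<^sub>C (c - expint l (\<lambda>t. ?h (t + s)) t)" for t
    have W: "(W has_vector_derivative l *\<^sub>C W t - ?h (t + s)) (at t within {0..})"
        "norm (W t) \<le> e / 2" if "t \<ge> 0" for t
      using expint_solves[OF hs that, of l c] c[OF that] d(2) unfolding W_def[abs_def] by auto
    define z where "z t = u (t + s) - W t" for t
    have "(z has_vector_derivative l *\<^sub>C z t) (at t within {0..})" if "t \<ge> 0" for t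
      using has_vector_derivative_diff[OF D_dom_shift[OF u s(1) that] W(1)[OF that]]
      unfolding z_def[abs_def] by (simp add: scaleC.diff_right)
    then have z: "z t = exp (l * complex_of_real t) *\<^sub>C z 0" if "t \<ge> 0" for t
      by (rule homogeneous_solution) (use that in auto)
    have zb: "norm (z t) \<le> supnorm u + e / 2" if "t \<ge> 0" for t
      unfolding z_def using norm_triangle_ineq4[of "u (t + s)" "W t"] W(2)[OF that]
        norm_le_supnorm[OF uD(1), of "t + s"] s(1) that by linarith
    have "(z \<longlongrightarrow> 0) at_top"
    proof (cases "Re l < 0")
      case True
      have "((\<lambda>t. exp (Re l * t) * norm (z 0)) \<longlongrightarrow> 0) at_top"
        using True by (intro tendsto_mult_left_zero filterlim_compose[OF exp_at_bot]
            filterlim_tendsto_neg_mult_at_bot[OF tendsto_const] filterlim_ident)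
      moreover have "\<forall>\<^sub>F t in at_top. norm (z t) \<le> exp (Re l * t) * norm (z 0)"
        using eventually_ge_at_top[of 0]
        by eventually_elim (subst z, auto simp: norm_scaleC)
      ultimately show ?thesis
        by (rule Lim_null_comparison[rotated])
    next
      \<comment> \<open>Exponential growth is incompatible with boundedness: multiplying the bound
        for z t by exp (- Re l * t) forces z 0 = 0.\<close>
      case False
      have "((\<lambda>t. exp (- Re l * t) * (supnorm u + e / 2)) \<longlongrightarrow> 0) at_top"
        using False l by (intro tendsto_mult_left_zero filterlim_compose[OF exp_at_bot]
            filterlim_tendsto_neg_mult_at_bot[OF tendsto_const] filterlim_ident) auto
      moreover have "\<forall>\<^sub>F t in at_top. norm (z 0) \<le> exp (- Re l * t) * (supnorm u + e / 2)"
        using eventually_ge_at_top[of 0]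
      proof eventually_elim
        case (elim t)
        have "norm (z t) = exp (Re l * t) * norm (z 0)"
          by (subst z[OF elim]) (rule norm_exp_scaleC)
        then have "exp (Re l * t) * norm (z 0) \<le> supnorm u + e / 2"
          using zb[OF elim] by simp
        then have "exp (- Re l * t) * (exp (Re l * t) * norm (z 0)) \<le> exp (- Re l * t) * (supnorm u + e / 2)"
          by (intro mult_left_mono) auto
        moreover have "exp (- Re l * t) * (exp (Re l * t) * norm (z 0)) = norm (z 0)"
          by (simp add: exp_minus)
        ultimately show ?case by (simp only:)
      qed
      ultimately have "norm (z 0) \<le> 0"
        by (intro tendsto_lowerbound) auto
      then have "z t = 0" if "t \<ge> 0" for t
        using z[OF that] by simp
      then show ?thesis
        by (intro tendsto_eventually eventually_at_top_linorderI[of 0]) auto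
    qed
    then have "\<forall>\<^sub>F t in at_top. dist (z t) 0 < e / 2"
      using that by (intro tendstoD) auto
    then obtain t0 where t0: "\<And>t. t \<ge> t0 \<Longrightarrow> norm (z t) < e / 2"
      by (auto simp: eventually_at_top_linorder)
    have "norm (u t) < e" if "t \<ge> max t0 0 + s" for t
    proof -
      have "u t = z (t - s) + W (t - s)" by (simp add: z_def)
      moreover have "norm (z (t - s)) < e / 2" "norm (W (t - s)) \<le> e / 2"
        using t0[of "t - s"] W(2)[of "t - s"] that by auto
      ultimately show ?thesis
        using norm_triangle_ineq[of "z (t - s)" "W (t - s)"] by simp
    qed
    then show ?thesis by (rule eventually_at_top_linorderI)
  qed
  then show ?thesis
    using uD(1) by (simp add: C0_def tendsto_iff)
qed

section \<open>The resolvent of differentiation on the quotient\<close>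

definition RD :: "complex \<Rightarrow> 'a::complex_normed_vector buc_quot \<Rightarrow> 'a buc_quot"
  where "RD l = resolvent D_quot_dom D_quot l"

lemma D_dom_diff:
  fixes u v :: "real \<Rightarrow> 'a::complex_normed_vector"
  assumes "u \<in> D_dom" "v \<in> D_dom"
  shows "(\<lambda>t. u t - v t) \<in> D_dom" "\<And>t. t \<ge> 0 \<Longrightarrow> hderiv (\<lambda>t. u t - v t) t = hderiv u t - hderiv v t"
  using D_domI[of "\<lambda>t. u t - v t" "\<lambda>t. hderiv u t - hderiv v t"] D_domD[OF assms(1)] D_domD[OF assms(2)]
  by (auto simp: BUC_diff intro!: has_vector_derivative_diff)

lemma BUC_resolvent_arg:
  fixes u :: "real \<Rightarrow> 'a::complex_normed_vector"
  shows "u \<in> D_dom \<Longrightarrow> (\<lambda>t. l *\<^sub>C u t - hderiv u t) \<in> BUC"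
  by (intro BUC_diff BUC_scaleC D_domD)

lemma D_quot_resolvent_arg:
  fixes u :: "real \<Rightarrow> 'a::complex_normed_vector"
  assumes "u \<in> D_dom"
  shows "l *\<^sub>C buc_class u - D_quot (buc_class u) = buc_class (\<lambda>t. l *\<^sub>C u t - hderiv u t)"
  using assms D_domD[OF assms]
  by (simp add: D_quot_class buc_class_scaleC buc_class_diff BUC_scaleC)

lemma D_quot_inj:
  assumes "Re l \<noteq> 0"
  shows "inj_on (\<lambda>x. l *\<^sub>C x - D_quot x) (D_quot_dom :: 'a::complex_banach buc_quot set)"
proof (rule inj_onI)
  fix x y :: "'a buc_quot"
  assume "x \<in> D_quot_dom" "y \<in> D_quot_dom" and eq: "l *\<^sub>C x - D_quot x = l *\<^sub>C y - D_quot y"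
  then obtain u v where uv: "u \<in> D_dom" "x = buc_class u" "v \<in> D_dom" "y = buc_class v"
    by (auto simp: D_quot_dom_def)
  let ?w = "\<lambda>t. u t - v t"
  have "(\<lambda>t. (l *\<^sub>C u t - hderiv u t) - (l *\<^sub>C v t - hderiv v t)) \<in> C0"
    using eq uv by (simp add: D_quot_resolvent_arg buc_class_eq_iff BUC_resolvent_arg)
  also have "?this \<longleftrightarrow> (\<lambda>t. l *\<^sub>C ?w t - hderiv ?w t) \<in> C0"
    by (rule C0_cong) (simp add: D_dom_diff uv scaleC.diff_right)
  finally have "?w \<in> C0"
    by (rule solution_in_C0[OF D_dom_diff(1)[OF uv(1,3)] assms])
  then show "x = y"
    using uv buc_class_eq_iff[OF D_domD(1)[OF uv(1)] D_domD(1)[OF uv(3)]] by simp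
qed

text \<open>\<open>RD l\<close> is an \<open>inv_into\<close>, so injectivity off the axis evaluates
  it on the range; that the range is everything comes from \<open>RD_solution\<close>.\<close>

lemma RD_eqI:
  assumes "Re l \<noteq> 0" "u \<in> D_dom"
  shows "RD l (buc_class (\<lambda>t. l *\<^sub>C u t - hderiv u t)) = buc_class (u :: real \<Rightarrow> 'a::complex_banach)"
proof -
  have "buc_class u \<in> D_quot_dom"
    using assms(2) by (simp add: D_quot_dom_def)
  from inv_into_f_f[OF D_quot_inj[OF assms(1)] this] show ?thesis
    by (simp add: RD_def resolvent_def D_quot_resolvent_arg[OF assms(2)])
qed

lemma RD_eqI':
  assumes "Re l \<noteq> 0" "u \<in> D_dom" "g \<in> BUC" "\<And>t. t \<ge> 0 \<Longrightarrow> hderiv u t = l *\<^sub>C u t - g t"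
  shows "RD l (buc_class g) = buc_class (u :: real \<Rightarrow> 'a::complex_banach)"
proof -
  have "buc_class g = buc_class (\<lambda>t. l *\<^sub>C u t - hderiv u t)"
    by (rule buc_class_eqI) (use assms in auto)
  then show ?thesis using RD_eqI[OF assms(1,2)] by simp
qed

lemma RD_solution:
  assumes g: "(g :: real \<Rightarrow> 'a::complex_banach) \<in> BUC" and l: "Re l \<noteq> 0"
  obtains u where "u \<in> D_dom" "RD l (buc_class g) = buc_class u"
    "\<And>t. t \<ge> 0 \<Longrightarrow> hderiv u t = l *\<^sub>C u t - g t" "\<And>t. t \<ge> 0 \<Longrightarrow> norm (u t) \<le> supnorm g / \<bar>Re l\<bar>"
proof -
  obtain c where c: "\<And>t. t \<ge> 0 \<Longrightarrow>
      norm (exp (l * complex_of_real t) *\<^sub>C (c - expint l g t)) \<le> supnorm g / \<bar>Re l\<bar>"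
    using bounded_solution[OF g norm_le_supnorm[OF g] l] by metis
  from solve_derivative_bounded[OF g c] RD_eqI'[OF l _ g] c that show ?thesis
    by blast
qed

text \<open>At -1 the constant c is 0, so the representative involves only the past of g. This is
  the integral that \<open>mild_solution_expint\<close> places in the domain of A.\<close>

lemma RD_explicit:
  assumes g: "(g :: real \<Rightarrow> 'a::complex_banach) \<in> BUC"
  shows "RD (- 1) (buc_class g) = buc_class (\<lambda>t. exp (- complex_of_real t) *\<^sub>C - expint (- 1) g t)"
    "(\<lambda>t. exp (- complex_of_real t) *\<^sub>C - expint (- 1) g t) \<in> D_dom"
proof -
  obtain c where "Re (- 1) < 0 \<Longrightarrow> c = 0" and c: "\<And>t. t \<ge> 0 \<Longrightarrow>
      norm (exp (- 1 * complex_of_real t) *\<^sub>C (c - expint (- 1) g t)) \<le> supnorm g / \<bar>Re (- 1)\<bar>"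
    using bounded_solution[OF g norm_le_supnorm[OF g], of "- 1"] by (metis one_complex.simps(1) uminus_complex.simps(1) zero_neq_neg_one)
  then have c0: "c = 0" by simp
  note s = solve_derivative_bounded[OF g c, unfolded c0]
  from s show "(\<lambda>t. exp (- complex_of_real t) *\<^sub>C - expint (- 1) g t) \<in> D_dom"
    by simp
  from RD_eqI'[OF _ s(1) g s(2)]
  show "RD (- 1) (buc_class g) = buc_class (\<lambda>t. exp (- complex_of_real t) *\<^sub>C - expint (- 1) g t)"
    by simp
qed

lemma RD_add:
  assumes "Re l \<noteq> 0"
  shows "RD l (x + y) = RD l x + RD l (y :: 'a::complex_banach buc_quot)"
proof -
  obtain f g where fg: "f \<in> BUC" "x = buc_class f" "g \<in> BUC" "y = buc_class g"
    by (metis buc_class_cases)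
  obtain u where u: "u \<in> D_dom" "RD l x = buc_class u" "\<And>t. t \<ge> 0 \<Longrightarrow> hderiv u t = l *\<^sub>C u t - f t"
    using RD_solution[OF fg(1) assms] fg(2) by metis
  obtain v where v: "v \<in> D_dom" "RD l y = buc_class v" "\<And>t. t \<ge> 0 \<Longrightarrow> hderiv v t = l *\<^sub>C v t - g t"
    using RD_solution[OF fg(3) assms] fg(4) by metis
  have "RD l (buc_class (\<lambda>t. f t + g t)) = buc_class (\<lambda>t. u t + v t)"
    using u v fg
    by (intro RD_eqI' assms) (auto simp: D_dom_add BUC_add scaleC_add_right)
  then show ?thesis
    using fg u v D_domD(1)[OF u(1)] D_domD(1)[OF v(1)] by (simp add: buc_class_add)
qed

section \<open>Pointwise action of operators on classes, and the axioms of
  \<open>axis_resolvent\<close> for \<open>RD\<close>\<close>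

definition lift_quot :: "('a::complex_normed_vector \<Rightarrow> 'a) \<Rightarrow> 'a buc_quot \<Rightarrow> 'a buc_quot"
  where "lift_quot L y = buc_class (\<lambda>t. L (rep_buc_quot y t))"

lemma lift_quot_class:
  assumes "bounded_linear L" "g \<in> BUC"
  shows "lift_quot L (buc_class g) = buc_class (\<lambda>t. L (g t))"
proof -
  let ?r = "rep_buc_quot (buc_class g)"
  have r: "?r \<in> BUC" "buc_class ?r = buc_class g"
    using Quotient3_abs_rep[OF Quotient3_buc_quot, of "buc_class g"]
      Quotient3_rep_reflp[OF Quotient3_buc_quot, of "buc_class g"]
    by (auto simp: buc_rel_def)
  then have "(\<lambda>t. ?r t - g t) \<in> C0"
    using assms by (simp add: buc_class_eq_iff)
  then have "(\<lambda>t. L (?r t) - L (g t)) \<in> C0"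
    using C0_bounded_linear[OF assms(1)] by (simp add: linear_diff[OF bounded_linear.linear[OF assms(1)], symmetric])
  then show ?thesis
    using r assms by (simp add: lift_quot_def buc_class_eq_iff BUC_bounded_linear)
qed

lemma RD_lift:
  assumes "Re l \<noteq> 0" "bounded_clinear L"
  shows "RD l (lift_quot L y) = lift_quot L (RD l (y :: 'a::complex_banach buc_quot))"
proof -
  note L = bounded_clinearD[OF assms(2)]
  obtain g where g: "g \<in> BUC" "y = buc_class g"
    by (rule buc_class_cases)
  obtain u where u: "u \<in> D_dom" "RD l y = buc_class u" "\<And>t. t \<ge> 0 \<Longrightarrow> hderiv u t = l *\<^sub>C u t - g t"
    using RD_solution[OF g(1) assms(1)] g(2) by metis
  have "RD l (buc_class (\<lambda>t. L (g t))) = buc_class (\<lambda>t. L (u t))"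
    using u g D_dom_bounded_linear[OF u(1) L(1)]
    by (intro RD_eqI' assms) (auto simp: BUC_bounded_linear L)
  then show ?thesis
    using g u D_domD(1)[OF u(1)] by (simp add: lift_quot_class L)
qed

lemma bounded_clinear_lift:
  assumes "bounded_clinear L"
  shows "bounded_clinear (lift_quot (L :: 'a::complex_normed_vector \<Rightarrow> 'a))"
proof -
  note L = bounded_clinearD[OF assms]
  obtain K where K: "K > 0" "\<And>x. norm (L x) \<le> norm x * K"
    using bounded_linear.pos_bounded[OF L(1)] by blast
  have add: "lift_quot L (x + y) = lift_quot L x + lift_quot L y" for x y
  proof -
    obtain f g where "f \<in> BUC" "x = buc_class f" "g \<in> BUC" "y = buc_class g"
      by (metis buc_class_cases)
    then show ?thesis
      using L(1) by (simp add: buc_class_add lift_quot_class BUC_add BUC_bounded_linear L)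
  qed
  have scale: "lift_quot L (c *\<^sub>C x) = c *\<^sub>C lift_quot L x" for c x
  proof -
    obtain f where "f \<in> BUC" "x = buc_class f"
      by (rule buc_class_cases)
    then show ?thesis
      using L(1) by (simp add: buc_class_scaleC lift_quot_class BUC_scaleC BUC_bounded_linear L)
  qed
  have bound: "norm (lift_quot L x) \<le> norm x * K" for x
  proof (rule field_le_epsilon)
    fix e :: real assume "e > 0"
    then obtain g where g: "g \<in> BUC" "x = buc_class g" "supnorm g < norm x + e / K"
      using norm_buc_quot_approx[of "e / K" x] K(1) by auto
    have "norm (lift_quot L x) \<le> supnorm (\<lambda>t. L (g t))"
      using g L(1) by (simp add: lift_quot_class norm_buc_class_le BUC_bounded_linear)
    also have "\<dots> \<le> supnorm g * K"
      using K g by (intro supnorm_le order_trans[OF K(2)] mult_right_mono norm_le_supnorm) auto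
    also have "\<dots> \<le> (norm x + e / K) * K"
      using g(3) K by (intro mult_right_mono) auto
    also have "\<dots> = norm x * K + e"
      using K by (simp add: distrib_right)
    finally show "norm (lift_quot L x) \<le> norm x * K + e" .
  qed
  have "bounded_linear (lift_quot L)"
    by (rule bounded_linear_intro[OF add _ bound]) (simp add: scaleR_eq_scaleC scale)
  then show ?thesis
    by (simp add: bounded_clinear_def scale)
qed

lemma RD_scaleC:
  assumes "Re l \<noteq> 0"
  shows "RD l (c *\<^sub>C y) = c *\<^sub>C RD l (y :: 'a::complex_banach buc_quot)"
proof -
  have "c *\<^sub>C y = lift_quot (\<lambda>x. c *\<^sub>C x) y" for y :: "'a buc_quot"
    by (rule buc_class_cases[of y]) (simp add: lift_quot_class bounded_linear_scaleC buc_class_scaleC)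
  then show ?thesis
    using RD_lift[OF assms bounded_clinear_scaleC, of c y] by simp
qed

lemma norm_RD:
  assumes "Re l \<noteq> 0"
  shows "norm (RD l y) \<le> norm (y :: 'a::complex_banach buc_quot) / \<bar>Re l\<bar>"
proof (rule field_le_epsilon)
  fix e :: real assume "e > 0"
  then obtain g where g: "g \<in> BUC" "y = buc_class g" "supnorm g < norm y + e * \<bar>Re l\<bar>"
    using norm_buc_quot_approx[of "e * \<bar>Re l\<bar>" y] assms by auto
  obtain u where u: "u \<in> D_dom" "RD l y = buc_class u" "\<And>t. t \<ge> 0 \<Longrightarrow> norm (u t) \<le> supnorm g / \<bar>Re l\<bar>"
    using RD_solution[OF g(1) assms] g(2) by metis
  have "norm (RD l y) \<le> supnorm u"
    using u D_domD(1)[OF u(1)] norm_buc_class_le by auto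
  also have "\<dots> \<le> supnorm g / \<bar>Re l\<bar>"
    by (rule supnorm_le[OF u(3)])
  also have "\<dots> \<le> (norm y + e * \<bar>Re l\<bar>) / \<bar>Re l\<bar>"
    using g(3) by (intro divide_right_mono) auto
  also have "\<dots> = norm y / \<bar>Re l\<bar> + e"
    using assms by (simp add: add_divide_distrib)
  finally show "norm (RD l y) \<le> norm y / \<bar>Re l\<bar> + e" .
qed

interpretation D: axis_resolvent "RD :: complex \<Rightarrow> 'a::complex_banach buc_quot \<Rightarrow> 'a buc_quot"
proof
  fix l m :: complex and y :: "'a buc_quot"
  assume l: "Re l \<noteq> 0"
  show "norm (RD l y) \<le> norm y / \<bar>Re l\<bar>"
    by (rule norm_RD[OF l])
  have "bounded_linear (RD l :: 'a buc_quot \<Rightarrow> 'a buc_quot)"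
    by (rule bounded_linear_intro[where K = "1 / \<bar>Re l\<bar>"])
      (use norm_RD[OF l] in \<open>auto simp: RD_add[OF l] RD_scaleC[OF l] scaleR_eq_scaleC\<close>)
  then show "bounded_clinear (RD l :: 'a buc_quot \<Rightarrow> 'a buc_quot)"
    by (simp add: bounded_clinear_def RD_scaleC[OF l])
  obtain g where g: "g \<in> BUC" "y = buc_class g"
    by (rule buc_class_cases)
  show "y = 0" if "RD l y = 0"
  proof -
    obtain u where u: "u \<in> D_dom" "RD l y = buc_class u" "\<And>t. t \<ge> 0 \<Longrightarrow> hderiv u t = l *\<^sub>C u t - g t"
      using RD_solution[OF g(1) l] g(2) by metis
    have C0: "u \<in> C0"
      using that u D_domD(1)[OF u(1)] by (simp add: buc_class_eq_0_iff)
    \<comment> \<open>By Barbalat u' vanishes at infinity together with u, hence so does g = l u -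
      u'.\<close>
    have "(\<lambda>t. l *\<^sub>C u t - hderiv u t) \<in> C0"
      by (intro C0_diff C0_scaleC C0 Barbalat_C0 u(1))
    also have "?this \<longleftrightarrow> g \<in> C0"
      by (rule C0_cong) (simp add: u(3))
    finally show ?thesis
      using g by (simp add: buc_class_eq_0_iff)
  qed
  show "RD l y - RD m y = (m - l) *\<^sub>C RD l (RD m y)" if m: "Re m \<noteq> 0"
  proof -
    obtain v where v: "v \<in> D_dom" "RD m y = buc_class v" "\<And>t. t \<ge> 0 \<Longrightarrow> hderiv v t = m *\<^sub>C v t - g t"
      using RD_solution[OF g(1) m] g(2) by metis
    have "buc_class v = RD l (buc_class (\<lambda>t. l *\<^sub>C v t - hderiv v t))"
      by (rule RD_eqI[OF l v(1), symmetric])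
    also have "buc_class (\<lambda>t. l *\<^sub>C v t - hderiv v t) = buc_class (\<lambda>t. (l - m) *\<^sub>C v t + g t)"
      by (rule buc_class_eqI) (use v in \<open>auto simp: BUC_resolvent_arg scaleC.diff_left\<close>)
    also have "\<dots> = (l - m) *\<^sub>C buc_class v + buc_class g"
      using g D_domD(1)[OF v(1)] by (simp add: buc_class_scaleC buc_class_add BUC_scaleC)
    also have "RD l ((l - m) *\<^sub>C buc_class v + buc_class g) = (l - m) *\<^sub>C RD l (RD m y) + RD l y"
      by (simp only: RD_add[OF l] RD_scaleC[OF l] g(2)[symmetric] v(2))
    finally have "RD m y = (l - m) *\<^sub>C RD l (RD m y) + RD l y"
      unfolding v(2) .
    then have "RD l y - RD m y = - ((l - m) *\<^sub>C RD l (RD m y))"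
      by (metis add_diff_cancel_right' minus_diff_eq)
    then show ?thesis
      by (simp add: scaleC.diff_left)
  qed
qed

lemma sp_eq_spec: "sp g = D.spec (buc_class g)"
  by (simp add: sp_def D.spec_def transform_def RD_def)

lemma commuting_lift: "bounded_clinear L \<Longrightarrow> D.commuting (lift_quot L)"
  by (simp add: D.commuting_def bounded_clinear_lift RD_lift)

lemma RD_range_D_dom:
  obtains u where "u \<in> D_dom" "RD (- 1) (y :: 'a::complex_banach buc_quot) = buc_class u"
    "y = buc_class (\<lambda>t. - u t - hderiv u t)"
proof -
  obtain g where g: "g \<in> BUC" "y = buc_class g"
    by (rule buc_class_cases)
  obtain u where u: "u \<in> D_dom" "RD (- 1) y = buc_class u" "\<And>t. t \<ge> 0 \<Longrightarrow> hderiv u t = (- 1) *\<^sub>C u t - g t"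
    using RD_solution[OF g(1), of "- 1"] g(2) by (metis one_complex.simps(1) uminus_complex.simps(1) zero_neq_neg_one)
  have "y = buc_class (\<lambda>t. - u t - hderiv u t)"
    unfolding g(2) by (rule buc_class_eqI) (use g u in auto)
  with u that show ?thesis by blast
qed

section \<open>Mild solutions\<close>

text \<open>Banach-Steinhaus by Baire category: one of the closed sets \<open>E n\<close> contains a
  ball, and differences within the ball bound all members of F on small vectors.\<close>

theorem uniform_boundedness:
  fixes F :: "('a::banach \<Rightarrow> 'b::real_normed_vector) set"
  assumes lin: "\<And>L. L \<in> F \<Longrightarrow> bounded_linear L" and pt: "\<And>x. \<exists>M. \<forall>L\<in>F. norm (L x) \<le> M"
  shows "\<exists>M>0. \<forall>L\<in>F. \<forall>x. norm (L x) \<le> M * norm x"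
proof -
  define E where "E n = {x. \<forall>L\<in>F. norm (L x) \<le> real n}" for n
  have closed: "closed (E n)" for n
  proof -
    have "E n = (\<Inter>L\<in>F. {x. norm (L x) \<le> real n})"
      by (auto simp: E_def)
    moreover have "closed {x. norm (L x) \<le> real n}" if "L \<in> F" for L
      using bounded_linear.continuous_on[OF lin[OF that] continuous_on_id]
      by (intro closed_Collect_le continuous_intros) auto
    ultimately show ?thesis by auto
  qed
  have "\<Union>(range E) = UNIV"
  proof -
    have "\<exists>n. x \<in> E n" for x
    proof -
      obtain M where M: "\<forall>L\<in>F. norm (L x) \<le> M" using pt by blast
      obtain n where "M \<le> real n" using real_arch_simple by blast
      then have "\<forall>L\<in>F. norm (L x) \<le> real n"
        using M order_trans by blast
      then show ?thesis by (auto simp: E_def)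
    qed
    then show ?thesis by auto
  qed
  then have ne: "(euclidean :: 'a topology) interior_of \<Union>(range E) \<noteq> {}"
    by simp
  have "\<exists>n. interior (E n) \<noteq> {}"
  proof (rule ccontr)
    assume "\<nexists>n. interior (E n) \<noteq> {}"
    then have "(euclidean :: 'a topology) interior_of \<Union>(range E) = {}"
      by (intro Baire_category_alt disjI1 completely_metrizable_space_euclidean) (use closed in auto)
    with ne show False ..
  qed
  then obtain n where "interior (E n) \<noteq> {}" ..
  then obtain x e where xe: "e > 0" "ball x e \<subseteq> E n"
    by (meson equals0I mem_interior)
  define d where "d = e / 2"
  have d: "d > 0" "\<And>z. norm z \<le> d \<Longrightarrow> x + z \<in> E n"
    using xe by (auto simp: d_def dist_norm intro!: subsetD[OF xe(2)])
  have xE: "x \<in> E n"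
    using d(2)[of 0] d(1) by simp
  show ?thesis
  \<comment> \<open>Differences of values on \<open>E n\<close> are at most 2 n; the additional 1
    keeps the constant positive when n = 0.\<close>
  proof (intro exI[of _ "(2 * real n + 1) / d"] conjI ballI allI)
    fix L y assume L: "L \<in> F"
    interpret L: bounded_linear L by (rule lin[OF L])
    show "norm (L y) \<le> (2 * real n + 1) / d * norm y"
    proof (cases "y = 0")
      case False
      define z where "z = (d / norm y) *\<^sub>R y"
      have "norm z \<le> d" using False d(1) by (simp add: z_def)
      then have "norm (L (x + z)) \<le> n" "norm (L x) \<le> n"
        using d(2) xE L by (auto simp: E_def)
      then have "norm (L z) \<le> 2 * n"
        using norm_triangle_ineq4[of "L (x + z)" "L x"] by (simp add: L.add)
      then have "norm (L z) \<le> 2 * real n + 1" by simp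
      then have "(d / norm y) * norm (L y) \<le> 2 * real n + 1"
        using d(1) by (simp add: z_def L.scaleR)
      then show ?thesis
        using False d(1) by (simp add: field_simps)
    qed (simp add: L.zero)
  qed (use d in auto)
qed

lemma has_vector_derivative_quotient_iff:
  "(f has_vector_derivative d) (at x within S) \<longleftrightarrow>
    ((\<lambda>y. (f y - f x) /\<^sub>R (y - x)) \<longlongrightarrow> d) (at x within S)"
proof -
  have eq: "norm (f y - f x - (y - x) *\<^sub>R d) / norm (y - x) = norm ((f y - f x) /\<^sub>R (y - x) - d)"
    if "y \<noteq> x" for y
  proof -
    have "(f y - f x) /\<^sub>R (y - x) - d = (f y - f x - (y - x) *\<^sub>R d) /\<^sub>R (y - x)"
      using that by (simp add: scaleR_diff_right)
    then show ?thesis by (simp add: divide_inverse mult.commute)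
  qed
  have "(f has_vector_derivative d) (at x within S) \<longleftrightarrow>
      ((\<lambda>y. norm (f y - f x - (y - x) *\<^sub>R d) / norm (y - x)) \<longlongrightarrow> 0) (at x within S)"
    by (simp add: has_vector_derivative_def has_derivative_iff_norm bounded_linear_scaleR_left)
  also have "\<dots> \<longleftrightarrow> ((\<lambda>y. norm ((f y - f x) /\<^sub>R (y - x) - d)) \<longlongrightarrow> 0) (at x within S)"
  proof (rule tendsto_cong)
    show "\<forall>\<^sub>F y in at x within S. norm (f y - f x - (y - x) *\<^sub>R d) / norm (y - x) =
        norm ((f y - f x) /\<^sub>R (y - x) - d)"
      using eventually_neq_at_within[of x x S] by eventually_elim (rule eq)
  qed
  also have "\<dots> \<longleftrightarrow> ((\<lambda>y. (f y - f x) /\<^sub>R (y - x)) \<longlongrightarrow> d) (at x within S)"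
    by (simp add: tendsto_norm_zero_iff LIM_zero_iff)
  finally show ?thesis .
qed

lemma exp_decay_C0: "(\<lambda>t. exp (- complex_of_real t) *\<^sub>C (x :: 'a::complex_banach)) \<in> C0"
proof -
  have der: "((\<lambda>t. exp (- complex_of_real t) *\<^sub>C x) has_vector_derivative - (exp (- complex_of_real t) *\<^sub>C x))
      (at t within {0..})" for t
    using has_vector_derivative_scaleC[OF has_vector_derivative_exp_cmult[of "- 1" t "{0..}"]
        has_vector_derivative_const[of x]] by simp
  have "(\<lambda>t. exp (- complex_of_real t) *\<^sub>C x) \<in> BUC"
    by (rule BUC_if_derivative_bounded[OF der, of "norm x" "norm x"])
      (auto simp: norm_scaleC mult_left_le_one_le)
  moreover have "((\<lambda>t. exp (- complex_of_real t) *\<^sub>C x) \<longlongrightarrow> 0) at_top"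
  proof (rule tendsto_norm_zero_cancel)
    have "((\<lambda>t::real. exp (- t)) \<longlongrightarrow> 0) at_top"
      by (rule filterlim_compose[OF exp_at_bot filterlim_uminus_at_bot_at_top])
    then have "((\<lambda>t::real. exp (- t) * norm x) \<longlongrightarrow> 0) at_top"
      by (rule tendsto_mult_left_zero)
    then show "((\<lambda>t. norm (exp (- complex_of_real t) *\<^sub>C x)) \<longlongrightarrow> 0) at_top"
      by (simp add: norm_scaleC)
  qed
  ultimately show ?thesis by (simp add: C0_def)
qed

locale semigroup_generator =
  fixes T :: "real \<Rightarrow> 'a::complex_banach \<Rightarrow> 'a" and DA :: "'a set" and A :: "'a \<Rightarrow> 'a"
  assumes semigroup: "C0_semigroup T" and generator: "is_generator T DA A"
begin

lemma T_clinear: "t \<ge> 0 \<Longrightarrow> bounded_clinear (T t)"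
  using semigroup by (simp add: C0_semigroup_def)

lemmas T_simps = bounded_clinearD(2-)[OF T_clinear]
lemmas T_linear = bounded_clinearD(1)[OF T_clinear]

lemma T_0 [simp]: "T 0 x = x"
  using semigroup by (simp add: C0_semigroup_def)

lemma T_add: "s \<ge> 0 \<Longrightarrow> t \<ge> 0 \<Longrightarrow> T (s + t) x = T s (T t x)"
  using semigroup by (simp add: C0_semigroup_def)

lemma T_continuous: "continuous_on {0..} (\<lambda>t. T t x)"
  using semigroup by (simp add: C0_semigroup_def)

lemma T_scaleR: "t \<ge> 0 \<Longrightarrow> T t (r *\<^sub>R x) = r *\<^sub>R T t x"
  by (simp add: scaleR_eq_scaleC T_simps)

lemma T_locally_bounded:
  "\<exists>M>0. \<forall>t\<in>{0..b}. \<forall>x. norm (T t x) \<le> M * norm x"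
proof -
  have "\<exists>M. \<forall>L\<in>T ` {0..b}. norm (L x) \<le> M" for x
  proof -
    have "compact ((\<lambda>t. T t x) ` {0..b})"
      by (intro compact_continuous_image continuous_on_subset[OF T_continuous]) auto
    then have "bounded ((\<lambda>t. T t x) ` {0..b})"
      by (rule compact_imp_bounded)
    then show ?thesis by (auto simp: bounded_iff)
  qed
  then have "\<exists>M>0. \<forall>L\<in>T ` {0..b}. \<forall>x. norm (L x) \<le> M * norm x"
    by (intro uniform_boundedness) (auto simp: T_linear)
  then show ?thesis by blast
qed

text \<open>The bound on compact time intervals upgrades strong continuity to joint continuity, as
  required when time and vector vary together.\<close>

lemma T_tendsto:
  assumes p: "(p \<longlongrightarrow> p0) F" "\<forall>\<^sub>F k in F. p k \<in> {0..b}" "p0 \<in> {0..b}" and y: "(y \<longlongrightarrow> y0) F"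
  shows "((\<lambda>k. T (p k) (y k)) \<longlongrightarrow> T p0 y0) F"
proof -
  obtain M where M: "M > 0" "\<And>t x. t \<in> {0..b} \<Longrightarrow> norm (T t x) \<le> M * norm x"
    using T_locally_bounded[of b] by blast
  have 1: "((\<lambda>k. T (p k) (y k - y0)) \<longlongrightarrow> 0) F"
  proof (rule Lim_null_comparison)
    show "\<forall>\<^sub>F k in F. norm (T (p k) (y k - y0)) \<le> M * norm (y k - y0)"
      using p(2) by eventually_elim (rule M(2))
    have "((\<lambda>k. M * norm (y k - y0)) \<longlongrightarrow> M * norm (y0 - y0)) F"
      by (intro tendsto_intros y)
    then show "((\<lambda>k. M * norm (y k - y0)) \<longlongrightarrow> 0) F"
      by simp
  qed
  have 2: "((\<lambda>k. T (p k) y0) \<longlongrightarrow> T p0 y0) F"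
    by (rule continuous_on_tendsto_compose[OF T_continuous p(1)])
      (use p in \<open>auto elim: eventually_mono\<close>)
  have "((\<lambda>k. T (p k) (y k - y0) + T (p k) y0) \<longlongrightarrow> 0 + T p0 y0) F"
    by (intro tendsto_add 1 2)
  moreover have "\<forall>\<^sub>F k in F. T (p k) (y k - y0) + T (p k) y0 = T (p k) (y k)"
    using p(2) by eventually_elim (simp add: T_simps)
  ultimately show ?thesis
    by (simp add: tendsto_cong)
qed

lemma T_continuous_on:
  assumes "continuous_on K p" "continuous_on K g" "\<And>k. k \<in> K \<Longrightarrow> p k \<in> {0..b}"
  shows "continuous_on K (\<lambda>k. T (p k) (g k))"
  unfolding continuous_on_def
proof
  fix k assume k: "k \<in> K"
  show "((\<lambda>k. T (p k) (g k)) \<longlongrightarrow> T (p k) (g k)) (at k within K)"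
    by (rule T_tendsto[where b = b])
      (use assms k in \<open>auto simp: continuous_on_def eventually_at_filter\<close>)
qed

section \<open>Mild solutions and their time integrals\<close>

lemma convolution_continuous:
  assumes "g \<in> BUC" "0 \<le> a" "b \<le> t"
  shows "continuous_on {a..b} (\<lambda>s. T (t - s) (g s))"
  using assms
  by (intro T_continuous_on[where b = "t - a"] continuous_intros
      continuous_on_subset[OF BUC_continuous_on[OF assms(1)]]) auto

definition mild_solution :: "(real \<Rightarrow> 'a) \<Rightarrow> (real \<Rightarrow> 'a) \<Rightarrow> bool"
  where "mild_solution g u \<longleftrightarrow> (\<forall>t\<ge>0. u t = T t (u 0) + integral {0..t} (\<lambda>s. T (t - s) (g s)))"

lemma mild_solution_diff:
  assumes "mild_solution g u" "mild_solution k v" "g \<in> BUC" "k \<in> BUC"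
  shows "mild_solution (\<lambda>t. g t - k t) (\<lambda>t. u t - v t)"
  unfolding mild_solution_def
proof (intro allI impI)
  fix t :: real assume t: "t \<ge> 0"
  have "integral {0..t} (\<lambda>s. T (t - s) (g s - k s)) = integral {0..t} (\<lambda>s. T (t - s) (g s) - T (t - s) (k s))"
    by (rule integral_cong) (simp add: T_simps)
  also have "\<dots> = integral {0..t} (\<lambda>s. T (t - s) (g s)) - integral {0..t} (\<lambda>s. T (t - s) (k s))"
    using assms by (intro integral_diff integrable_continuous_interval convolution_continuous) auto
  finally have *: "integral {0..t} (\<lambda>s. T (t - s) (g s - k s)) =
      integral {0..t} (\<lambda>s. T (t - s) (g s)) - integral {0..t} (\<lambda>s. T (t - s) (k s))" .
  have "u t = T t (u 0) + integral {0..t} (\<lambda>s. T (t - s) (g s))"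
    "v t = T t (v 0) + integral {0..t} (\<lambda>s. T (t - s) (k s))"
    using assms(1,2) t unfolding mild_solution_def by blast+
  then show "u t - v t = T t (u 0 - v 0) + integral {0..t} (\<lambda>s. T (t - s) (g s - k s))"
    unfolding * using t by (simp add: T_simps)
qed

text \<open>The integral over \<open>{0..h}\<close> is rescaled to \<open>{0..1}\<close> so that it is continuous in \<open>h\<close> down to \<open>0\<close>.\<close>

definition average :: "(real \<Rightarrow> 'a) \<Rightarrow> real \<Rightarrow> real \<Rightarrow> 'a"
  where "average g h s = integral {0..1} (\<lambda>r. T (h * (1 - r)) (g (s + h * r)))"

text \<open>Restarting the solution at time s expresses T h (u s) by the later value
  \<open>u (s + h)\<close> and an average of the forcing, so that applying T h amounts to a shift in
  time.\<close>

lemma mild_solution_step: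
  assumes "mild_solution g u" "g \<in> BUC" "s \<ge> 0" "h > 0"
  shows "u (s + h) = T h (u s) + h *\<^sub>R average g h s"
proof -
  let ?f = "\<lambda>r. T (s + h - r) (g r)"
  have us: "u s = T s (u 0) + integral {0..s} (\<lambda>r. T (s - r) (g r))"
    "u (s + h) = T (s + h) (u 0) + integral {0..s + h} ?f"
    using assms add_nonneg_nonneg[of s h] unfolding mild_solution_def by (blast dest: less_imp_le)+
  have "T h (integral {0..s} (\<lambda>r. T (s - r) (g r))) = integral {0..s} (\<lambda>r. T h (T (s - r) (g r)))"
    using integral_linear[OF integrable_continuous_interval[OF convolution_continuous] T_linear, of g 0 s s h]
      assms by (simp add: o_def)
  also have "\<dots> = integral {0..s} ?f"
    using assms by (intro integral_cong) (auto simp: T_add[symmetric] algebra_simps)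
  finally have 1: "T h (integral {0..s} (\<lambda>r. T (s - r) (g r))) = integral {0..s} ?f" .
  have 2: "integral {0..s} ?f + integral {s..s + h} ?f = integral {0..s + h} ?f"
    using assms by (intro Henstock_Kurzweil_Integration.integral_combine integrable_continuous_interval
        convolution_continuous) auto
  have "(?f has_integral integral {s..s + h} ?f) (cbox s (s + h))"
    using assms by (auto intro!: integrable_integral integrable_continuous_interval convolution_continuous)
  from has_integral_affinity'[OF this assms(4), of s]
  have "((\<lambda>r. T (h * (1 - r)) (g (s + h * r))) has_integral (integral {s..s + h} ?f /\<^sub>R h)) {0..1}"
    using assms(4) by (simp add: algebra_simps)
  then have "average g h s = integral {s..s + h} ?f /\<^sub>R h"
    unfolding average_def by (rule integral_unique)
  then have "h *\<^sub>R average g h s = integral {s..s + h} ?f"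
    using assms(4) by simp
  then show ?thesis
    using us 1 2[symmetric] assms by (simp add: T_simps T_add add.commute[of s h] add.assoc)
qed

lemma average_continuous:
  assumes "g \<in> BUC"
  shows "continuous_on ({0..1} \<times> {0..t}) (\<lambda>(h, s). average g h s)"
proof -
  have "continuous_on (({0..1} \<times> {0..t}) \<times> cbox 0 1)
      (\<lambda>x. T (fst (fst x) * (1 - snd x)) (g (snd (fst x) + fst (fst x) * snd x)))"
  proof (rule T_continuous_on[where b = 1])
    show "continuous_on (({0..1} \<times> {0..t}) \<times> cbox 0 1) (\<lambda>x. g (snd (fst x) + fst (fst x) * snd x))"
      by (rule continuous_on_compose2[OF BUC_continuous_on[OF assms]]) (auto intro!: continuous_intros)
  qed (auto intro!: continuous_intros mult_le_one)
  from integral_continuous_on_param[of _ 0 "1::real"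
      "\<lambda>p r. T (fst p * (1 - r)) (g (snd p + fst p * r))", unfolded split_beta, OF this]
  show ?thesis
    by (simp add: average_def split_beta)
qed

text \<open>At h = 0 the average is \<open>g s\<close> itself, so the limit is a value of a
  continuous parameter integral.\<close>

lemma expint_tendsto_average:
  assumes "g \<in> BUC" "t \<ge> 0"
  shows "((\<lambda>h. integral {0..t} (\<lambda>s. exp (complex_of_real s) *\<^sub>C average g h s)) \<longlongrightarrow> expint (- 1) g t) (at_right 0)"
proof -
  let ?W = "\<lambda>h. integral {0..t} (\<lambda>s. exp (complex_of_real s) *\<^sub>C average g h s)"
  have "continuous_on ({0..1} \<times> cbox 0 t) (\<lambda>(h, s). exp (complex_of_real s) *\<^sub>C average g h s)"
    using average_continuous[OF assms(1), of t] by (auto simp: split_beta intro!: continuous_intros)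
  from integral_continuous_on_param[OF this]
  have "continuous_on {0..1} ?W"
    by simp
  then have lim: "(?W \<longlongrightarrow>
      ?W 0) (at 0 within {0..1})"
    by (simp add: continuous_on_def)
  have right: "at_right (0::real) = at 0 within {0<..1}"
    by (rule at_within_nhd[of _ "{..<1}"]) auto
  have "(?W \<longlongrightarrow>
      ?W 0) (at_right 0)"
    unfolding right by (rule tendsto_within_subset[OF lim]) auto
  then show ?thesis
    by (simp add: average_def expint_def)
qed

lemma generatorI: "((\<lambda>h. (T h x - x) /\<^sub>R h) \<longlongrightarrow> y) (at_right 0) \<Longrightarrow> x \<in> DA \<and> A x = y"
proof -
  assume *: "((\<lambda>h. (T h x - x) /\<^sub>R h) \<longlongrightarrow> y) (at_right 0)"
  have x: "x \<in> DA"
    using * generator by (auto simp: is_generator_def)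
  then have "((\<lambda>h. (T h x - x) /\<^sub>R h) \<longlongrightarrow> A x) (at_right 0)"
    using generator by (auto simp: is_generator_def)
  then have "A x = y"
    using * by (rule tendsto_unique[rotated]) simp
  with x show ?thesis ..
qed

text \<open>The time integral lies in the domain of A even if u does not take values there: by
  \<open>mild_solution_step\<close>, T h acts on it as a time shift up to the forcing, and shifts of
  an integral are differentiable. The formula is the integral of (e^s u)' = e^s (u + A u + g) with A
  moved outside.\<close>

lemma mild_solution_expint:
  assumes mild: "mild_solution g u" and g: "g \<in> BUC" and u: "u \<in> BUC" and t: "t \<ge> 0"
  shows "expint (- 1) u t \<in> DA \<and>
    A (expint (- 1) u t) = exp (complex_of_real t) *\<^sub>C u t - u 0 - expint (- 1) u t - expint (- 1) g t"
proof (rule generatorI)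
  let ?I = "expint (- 1) u"
  let ?E = "\<lambda>s. exp (complex_of_real s)"
  let ?W = "\<lambda>h. integral {0..t} (\<lambda>s. ?E s *\<^sub>C average g h s)"
  let ?\<Theta> = "\<lambda>h. exp (- complex_of_real h) *\<^sub>C (?I (t + h) - ?I h)"
  have cu: "continuous_on {0..} u"
    by (rule BUC_continuous_on[OF u])
  \<comment> \<open>The shift by h moves from u to the limits of integration, where the fundamental
    theorem gives the derivative at h = 0.\<close>
  have \<Theta>: "integral {0..t} (\<lambda>s. ?E s *\<^sub>C u (s + h)) = ?\<Theta> h" if h: "h \<ge> 0" for h
  proof -
    let ?f = "\<lambda>s. ?E s *\<^sub>C u s"
    have int: "?f integrable_on {a..b}" if "a \<ge> 0" for a b
      using that by (intro integrable_continuous_interval continuous_intros continuous_on_subset[OF cu]) auto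
    have "integral {0..t} (\<lambda>s. ?E s *\<^sub>C u (s + h)) = integral {h - h..t + h - h} (\<lambda>s. exp (- complex_of_real h) *\<^sub>C ?f (s + h))"
      by (simp add: scaleC_scaleC mult_exp_exp)
    also have "\<dots> = integral {h..t + h} (\<lambda>s. exp (- complex_of_real h) *\<^sub>C ?f s)"
      by (rule integral_shift_real_ivl)
    also have "\<dots> = exp (- complex_of_real h) *\<^sub>C integral {h..t + h} ?f"
      using h by (intro integral_scaleC int)
    also have "integral {h..t + h} ?f = ?I (t + h) - ?I h"
    proof -
      have "integral {0..h} ?f + integral {h..t + h} ?f = integral {0..t + h} ?f"
        using h t by (intro Henstock_Kurzweil_Integration.integral_combine int) auto
      then show ?thesis by (simp add: expint_def algebra_simps)
    qed
    finally show ?thesis .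
  qed
  have quot: "(T h (?I t) - ?I t) /\<^sub>R h = (?\<Theta> h - ?\<Theta> 0) /\<^sub>R h -
      ?W h" if h: "h \<in> {0<..1}" for h
  proof -
    have ca: "continuous_on {0..t} (\<lambda>s. average g h s)"
    proof -
      have "continuous_on {0..t} (\<lambda>s. (h, s))"
        by (intro continuous_intros)
      from continuous_on_compose2[OF average_continuous[OF g, of t] this] show ?thesis
        using h by (simp add: image_subset_iff)
    qed
    have cuh: "continuous_on {0..t} (\<lambda>s. u (s + h))"
      by (rule continuous_on_compose2[OF cu]) (use h in \<open>auto intro!: continuous_intros\<close>)
    have "T h (?I t) = integral {0..t} (\<lambda>s. T h (?E s *\<^sub>C u s))"
    proof -
      have "(\<lambda>s. ?E s *\<^sub>C u s) integrable_on {0..t}"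
        by (intro integrable_continuous_interval continuous_intros continuous_on_subset[OF cu]) auto
      from integral_linear[OF this T_linear[of h]] h show ?thesis
        by (simp add: o_def expint_def)
    qed
    also have "\<dots> = integral {0..t} (\<lambda>s. ?E s *\<^sub>C u (s + h) - h *\<^sub>R (?E s *\<^sub>C average g h s))"
    proof (rule integral_cong)
      fix s assume "s \<in> {0..t}"
      then have "T h (u s) = u (s + h) - h *\<^sub>R average g h s"
        using mild_solution_step[OF mild g, of s h] h by simp
      then show "T h (?E s *\<^sub>C u s) = ?E s *\<^sub>C u (s + h) - h *\<^sub>R (?E s *\<^sub>C average g h s)"
        using h by (simp add: T_simps scaleC.diff_right scaleC_scaleR_commute)
    qed
    also have "\<dots> = integral {0..t} (\<lambda>s. ?E s *\<^sub>C u (s + h)) -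
        integral {0..t} (\<lambda>s. h *\<^sub>R (?E s *\<^sub>C average g h s))"
      by (intro integral_diff integrable_continuous_interval continuous_intros ca cuh)
    also have "\<dots> = ?\<Theta> h - h *\<^sub>R ?W h"
      using h by (simp only: \<Theta> integral_cmul) (simp add: \<Theta>)
    finally have "T h (?I t) = ?\<Theta> h - h *\<^sub>R ?W h" .
    moreover have "?I 0 = 0"
      by (simp add: expint_def)
    ultimately show ?thesis
      using h by (simp add: scaleR_diff_right)
  qed
  have I': "(?I has_vector_derivative ?E s *\<^sub>C u s) (at s within {0..})" if "s \<ge> 0" for s
    using expint_deriv[OF u that, of "- 1"] by simp
  have It: "((\<lambda>h. ?I (t + h)) has_vector_derivative ?E t *\<^sub>C u t) (at 0 within {0..})"
  proof -
    have "(?I \<circ> (\<lambda>h. t + h) has_vector_derivative (1 *\<^sub>R (?E t *\<^sub>C u t))) (at 0 within {0..})"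
    proof (rule vector_diff_chain_within)
      show "(?I has_vector_derivative ?E t *\<^sub>C u t) (at (t + 0) within (\<lambda>h. t + h) ` {0..})"
        using t I'[OF t] by (auto intro: has_vector_derivative_within_subset)
    qed (auto intro!: derivative_eq_intros)
    then show ?thesis by (simp add: o_def)
  qed
  have ex: "((\<lambda>h. exp (- complex_of_real h)) has_vector_derivative - 1) (at 0 within {0..})"
    using has_vector_derivative_exp_cmult[of "- 1" 0 "{0..}"] by simp
  have "(?\<Theta> has_vector_derivative exp (- complex_of_real 0) *\<^sub>C (?E t *\<^sub>C u t - ?E 0 *\<^sub>C u 0) +
      (- 1) *\<^sub>C (?I (t + 0) - ?I 0)) (at 0 within {0..})"
    by (intro has_vector_derivative_scaleC has_vector_derivative_diff It ex I') simp
  then have "(?\<Theta> has_vector_derivative ?E t *\<^sub>C u t - u 0 - ?I t) (at 0 within {0..})"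
    by (simp add: expint_def)
  then have "((\<lambda>h. (?\<Theta> h - ?\<Theta> 0) /\<^sub>R (h - 0)) \<longlongrightarrow> ?E t *\<^sub>C u t - u 0 - ?I t) (at_right 0)"
    unfolding has_vector_derivative_quotient_iff by (rule tendsto_within_subset) auto
  then have "((\<lambda>h. (?\<Theta> h - ?\<Theta> 0) /\<^sub>R h - ?W h) \<longlongrightarrow>
      ?E t *\<^sub>C u t - u 0 - ?I t - expint (- 1) g t) (at_right 0)"
    by (intro tendsto_diff expint_tendsto_average g t) simp
  moreover have "\<forall>\<^sub>F h in at_right 0. (?\<Theta> h - ?\<Theta> 0) /\<^sub>R h - ?W h =
      (T h (?I t) - ?I t) /\<^sub>R h"
  proof -
    have "\<forall>\<^sub>F h in at_right (0::real). h \<in> {0<..1}"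
      unfolding eventually_at_right_field by (intro exI[of _ 1]) auto
    then show ?thesis
      by eventually_elim (rule quot[symmetric])
  qed
  ultimately show "((\<lambda>h. (T h (?I t) - ?I t) /\<^sub>R h) \<longlongrightarrow>
      ?E t *\<^sub>C u t - u 0 - ?I t - expint (- 1) g t) (at_right 0)"
    by (rule Lim_transform_eventually)
qed

text \<open>The error term only changes the representative of the class of f, so asymptotic
  solutions are exact ones for some representative.\<close>

lemma asymptotic_mild_solution_iff:
  assumes "f \<in> BUC"
  shows "asymptotic_mild_solution T f u \<longleftrightarrow>
    u \<in> BUC \<and> (\<exists>g\<in>BUC. buc_class g = buc_class f \<and> mild_solution g u)"
proof
  assume "asymptotic_mild_solution T f u"
  then obtain e where e: "u \<in> BUC" "e \<in> C0" "mild_solution (\<lambda>s. f s + e s) u"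
    unfolding asymptotic_mild_solution_def mild_solution_def by blast
  moreover have "(\<lambda>s. f s + e s) \<in> BUC"
    using assms C0_BUC[OF e(2)] by (rule BUC_add)
  moreover have "buc_class (\<lambda>s. f s + e s) = buc_class f"
    using buc_class_eq_iff[of "\<lambda>s. f s + e s" f] calculation(4) assms e(2) by simp
  ultimately show "u \<in> BUC \<and> (\<exists>g\<in>BUC. buc_class g = buc_class f \<and> mild_solution g u)"
    by blast
next
  assume "u \<in> BUC \<and> (\<exists>g\<in>BUC. buc_class g = buc_class f \<and> mild_solution g u)"
  then obtain g where g: "u \<in> BUC" "g \<in> BUC" "buc_class g = buc_class f" "mild_solution g u"
    by blast
  have C0: "(\<lambda>s. g s - f s) \<in> C0"
    using buc_class_eq_iff[OF g(2) assms] g(3) by simp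
  have fg: "f s + (g s - f s) = g s" for s
    by simp
  have eq: "\<forall>t\<ge>0. u t = T t (u 0) + integral {0..t} (\<lambda>s. T (t - s) (f s + (g s - f s)))"
    using g(4) unfolding mild_solution_def fg .
  show "asymptotic_mild_solution T f u"
    unfolding asymptotic_mild_solution_def
    by (intro conjI bexI[of _ "\<lambda>s. g s - f s"] g(1) eq C0)
qed

section \<open>Passing between mild solutions and the equation in the quotient\<close>

lemma resolvent_A:
  assumes "m \<in> resolvent_set DA A"
  shows "bounded_clinear (resolvent DA A m)"
    "x \<in> DA \<Longrightarrow> resolvent DA A m (m *\<^sub>C x - A x) = x"
    "resolvent DA A m y \<in> DA" "m *\<^sub>C resolvent DA A m y - A (resolvent DA A m y) = y"
proof -
  let ?F = "\<lambda>x. m *\<^sub>C x - A x"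
  have F: "bij_betw ?F DA UNIV" and b: "bounded_clinear (resolvent DA A m)"
    using assms by (auto simp: resolvent_set_def)
  show "bounded_clinear (resolvent DA A m)" by (fact b)
  show "resolvent DA A m (m *\<^sub>C x - A x) = x" if "x \<in> DA"
    unfolding resolvent_def by (rule bij_betw_inv_into_left[OF F that])
  show "resolvent DA A m y \<in> DA"
    unfolding resolvent_def using F by (metis UNIV_I bij_betw_def inv_into_into)
  show "m *\<^sub>C resolvent DA A m y - A (resolvent DA A m y) = y"
    unfolding resolvent_def using bij_betw_inv_into_right[OF F, of y] by simp
qed

text \<open>\<open>A\<close> only acts in the time-dependent values, so the equation passes to the quotient in the form
  \<open>(m - A) R(-1) u = u + R(-1) f + (m + 1) R(-1) u\<close>, with \<open>R\<close> the resolvent of differentiation.\<close>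

definition solves :: "complex \<Rightarrow> 'a buc_quot \<Rightarrow> 'a buc_quot \<Rightarrow> bool"
  where "solves m f y \<longleftrightarrow>
    RD (- 1) y = lift_quot (resolvent DA A m) (RD (- 1) f + y + (m + 1) *\<^sub>C RD (- 1) y)"

text \<open>Multiplying the formula of \<open>mild_solution_expint\<close> by -e^(-t) gives a
  pointwise identity to which the resolvent of A can be applied.\<close>

lemma asymptotic_mild_solution_solves:
  assumes "asymptotic_mild_solution T f u" and f: "f \<in> BUC" and m: "m \<in> resolvent_set DA A"
  shows "solves m (buc_class f) (buc_class u)"
proof -
  obtain g where u: "u \<in> BUC" and g: "g \<in> BUC" "buc_class g = buc_class f" "mild_solution g u"
    using assms(1) asymptotic_mild_solution_iff[OF f] by blast
  let ?Q = "resolvent DA A m"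
  note Q = resolvent_A[OF m]
  note Q_simps = bounded_clinearD(2-)[OF Q(1)]
  define U where "U t = exp (- complex_of_real t) *\<^sub>C - expint (- 1) u t" for t
  define G where "G t = exp (- complex_of_real t) *\<^sub>C - expint (- 1) g t" for t
  \<comment> \<open>The contribution of the initial value; being in \<open>C0\<close> it disappears
    in the quotient.\<close>
  define e where "e t = exp (- complex_of_real t) *\<^sub>C u 0" for t
  have U: "RD (- 1) (buc_class u) = buc_class U" "U \<in> BUC"
    using RD_explicit[OF u] D_domD(1) unfolding U_def[abs_def] by blast+
  have G: "RD (- 1) (buc_class f) = buc_class G" "G \<in> BUC"
    using RD_explicit[OF g(1)] D_domD(1) g(2) unfolding G_def[abs_def] by auto
  have e: "e \<in> C0"
    unfolding e_def[abs_def] by (rule exp_decay_C0)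
  let ?v = "\<lambda>t. G t + (u t - e t) + (m + 1) *\<^sub>C U t"
  have v: "?v \<in> BUC"
    by (intro BUC_add BUC_diff BUC_scaleC U G u C0_BUC e)
  have pointwise: "U t = ?Q (?v t)" if t: "t \<ge> 0" for t
  proof -
    let ?I = "expint (- 1) u t" and ?J = "expint (- 1) g t" and ?c = "exp (- complex_of_real t)"
    have I: "?I \<in> DA" "A ?I = exp (complex_of_real t) *\<^sub>C u t - u 0 - ?I - ?J"
      using mild_solution_expint[OF g(3,1) u t] by auto
    have "?v t = (- ?c) *\<^sub>C (m *\<^sub>C ?I - A ?I)"
      unfolding I(2) U_def G_def e_def
      by (simp add: scaleC.diff_right scaleC_add_left scaleC_add_right scaleC_scaleC mult_exp_exp mult.commute[of _ m] distrib_left distrib_right)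
    then have "?Q (?v t) = (- ?c) *\<^sub>C ?I"
      using Q(2)[OF I(1)] by (simp only: Q_simps(1))
    then show ?thesis
      by (simp add: U_def)
  qed
  have "buc_class U = buc_class (\<lambda>t. ?Q (?v t))"
    by (rule buc_class_eqI[OF U(2) pointwise])
  also have "\<dots> = lift_quot ?Q (buc_class ?v)"
    by (rule lift_quot_class[OF bounded_clinearD(1)[OF Q(1)] v, symmetric])
  also have "buc_class ?v = buc_class G + (buc_class u - buc_class e) + (m + 1) *\<^sub>C buc_class U"
    using U G u C0_BUC[OF e] by (simp add: buc_class_add buc_class_diff buc_class_scaleC BUC_add BUC_diff BUC_scaleC)
  also have "buc_class e = 0"
    using e C0_BUC[OF e] by (simp add: buc_class_eq_0_iff)
  finally show ?thesis
    by (simp add: solves_def U(1) G(1))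
qed

text \<open>The generator provides only a right derivative at 0. Writing the quotient between r and
  t as \<open>T (min t r)\<close> applied to the forward quotient of step |r - t| treats both sides
  of t at once, by joint continuity.\<close>

lemma orbit_derivative:
  assumes z: "z \<in> DA" and t: "t \<ge> 0"
  shows "((\<lambda>t. T t z) has_vector_derivative T t (A z)) (at t within {0..})"
  unfolding has_vector_derivative_quotient_iff
proof -
  let ?D = "\<lambda>h. (T h z - z) /\<^sub>R h"
  have D: "(?D \<longlongrightarrow> A z) (at_right 0)"
    using z generator by (auto simp: is_generator_def)
  let ?F = "at t within {0..}"
  have abs0: "((\<lambda>r. \<bar>r - t\<bar>) \<longlongrightarrow> 0) ?F"
  proof -
    have "((\<lambda>r. \<bar>r - t\<bar>) \<longlongrightarrow> \<bar>t - t\<bar>) ?F" by (intro tendsto_intros)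
    then show ?thesis by simp
  qed
  have "filterlim (\<lambda>r. \<bar>r - t\<bar>) (at_right 0) ?F"
    unfolding filterlim_at using abs0 by (auto simp: eventually_at_filter)
  from filterlim_compose[OF D this]
  have 1: "((\<lambda>r. ?D \<bar>r - t\<bar>) \<longlongrightarrow> A z) ?F" .
  have 2: "((\<lambda>r. min t r) \<longlongrightarrow> t) ?F"
  proof -
    have "((\<lambda>r. min t r) \<longlongrightarrow> min t t) ?F" by (intro tendsto_intros)
    then show ?thesis by simp
  qed
  have 3: "\<forall>\<^sub>F r in ?F. min t r \<in> {0..t}"
    using t by (auto simp: eventually_at_filter)
  have "((\<lambda>r. T (min t r) (?D \<bar>r - t\<bar>)) \<longlongrightarrow> T t (A z)) ?F"
    by (rule T_tendsto[OF 2 3 _ 1]) (use t in auto)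
  moreover have "\<forall>\<^sub>F r in ?F. T (min t r) (?D \<bar>r - t\<bar>) = (T r z - T t z) /\<^sub>R (r - t)"
  proof -
    have *: "T (min t r) (?D \<bar>r - t\<bar>) = (T r z - T t z) /\<^sub>R (r - t)" if r: "r \<noteq> t" "r \<ge> 0" for r
    proof (cases "r > t")
      case True
      have "T t (T (r - t) z) = T r z"
        using True t by (simp add: T_add[symmetric])
      then show ?thesis
        using True t by (simp add: T_scaleR T_simps)
    next
      case False
      have "T r (T (t - r) z) = T t z"
        using False r by (simp add: T_add[symmetric])
      then have "T (min t r) (?D \<bar>r - t\<bar>) = (T t z - T r z) /\<^sub>R (t - r)"
        using False r by (simp add: T_scaleR T_simps min_def)
      also have "\<dots> = (- (T r z - T t z)) /\<^sub>R (- (r - t))"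
        by simp
      also have "\<dots> = (T r z - T t z) /\<^sub>R (r - t)"
        by (simp only: inverse_minus_eq scaleR_minus_left scaleR_minus_right minus_minus)
      finally show ?thesis .
    qed
    show ?thesis
      using eventually_neq_at_within[of t t "{0..}"] by (auto simp: eventually_at_filter *)
  qed
  ultimately show "((\<lambda>r. (T r z - T t z) /\<^sub>R (r - t)) \<longlongrightarrow> T t (A z)) ?F"
    by (rule Lim_transform_eventually)
qed

text \<open>In the derivative of s -> T (t - s) (x s) the terms with A cancel, and integrating over
  [0,t] gives the mild formula.\<close>

lemma classical_imp_mild_solution:
  assumes k: "k \<in> BUC"
    and x: "\<And>t. t \<ge> 0 \<Longrightarrow> (x has_vector_derivative A (x t) + k t) (at t within {0..})"
    and dom: "\<And>t. t \<ge> 0 \<Longrightarrow> x t \<in> DA"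
  shows "mild_solution k x"
  unfolding mild_solution_def
proof (intro allI impI)
  fix t :: real assume t: "t \<ge> 0"
  have "((\<lambda>s. T (t - s) (k s)) has_integral T (t - t) (x t) - T (t - 0) (x 0)) {0..t}"
  proof (rule fundamental_theorem_of_calculus[OF t])
    fix s assume s: "s \<in> {0..t}"
    let ?F = "at s within {0..t}"
    \<comment> \<open>The product rule is carried out on quotients since the semigroup is only
      strongly continuous: \<open>1\<close> takes the increment of x, \<open>2\<close> that of the
      orbit of the fixed vector x s.\<close>
    have 1: "((\<lambda>r. T (t - r) ((x r - x s) /\<^sub>R (r - s))) \<longlongrightarrow> T (t - s) (A (x s) + k s)) ?F"
    proof (rule T_tendsto[where b = t])
      have "(x has_vector_derivative A (x s) + k s) ?F"
        by (rule has_vector_derivative_within_subset[OF x]) (use s in auto)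
      then show "((\<lambda>r. (x r - x s) /\<^sub>R (r - s)) \<longlongrightarrow> A (x s) + k s) ?F"
        by (simp add: has_vector_derivative_quotient_iff)
      show "\<forall>\<^sub>F r in ?F. t - r \<in> {0..t}"
        by (auto simp: eventually_at_filter)
      show "((\<lambda>r. t - r) \<longlongrightarrow> t - s) ?F"
        by (intro tendsto_intros)
    qed (use s in auto)
    have "((\<lambda>r. T r (x s)) \<circ> (\<lambda>r. t - r) has_vector_derivative (- 1) *\<^sub>R T (t - s) (A (x s))) ?F"
    proof (rule vector_diff_chain_within)
      show "((\<lambda>r. T r (x s)) has_vector_derivative T (t - s) (A (x s))) (at (t - s) within (\<lambda>r. t - r) ` {0..t})"
        by (rule has_vector_derivative_within_subset[OF orbit_derivative[OF dom]]) (use s in auto)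
    qed (auto intro!: derivative_eq_intros)
    then have 2: "((\<lambda>r. (T (t - r) (x s) - T (t - s) (x s)) /\<^sub>R (r - s)) \<longlongrightarrow> - T (t - s) (A (x s))) ?F"
      by (simp add: has_vector_derivative_quotient_iff o_def)
    have lim: "((\<lambda>r. T (t - r) ((x r - x s) /\<^sub>R (r - s)) + (T (t - r) (x s) - T (t - s) (x s)) /\<^sub>R (r - s))
        \<longlongrightarrow> T (t - s) (A (x s) + k s) + - T (t - s) (A (x s))) ?F"
      by (rule tendsto_add[OF 1 2])
    have ev: "\<forall>\<^sub>F r in ?F. T (t - r) ((x r - x s) /\<^sub>R (r - s)) + (T (t - r) (x s) - T (t - s) (x s)) /\<^sub>R (r - s)
        = (T (t - r) (x r) - T (t - s) (x s)) /\<^sub>R (r - s)"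
      by (auto simp: eventually_at_filter T_scaleR T_simps scaleR_add_right[symmetric])
    have val: "T (t - s) (A (x s) + k s) + - T (t - s) (A (x s)) = T (t - s) (k s)"
      using s by (simp add: T_simps)
    show "((\<lambda>s. T (t - s) (x s)) has_vector_derivative T (t - s) (k s)) ?F"
      using Lim_transform_eventually[OF lim ev] unfolding has_vector_derivative_quotient_iff val .
  qed
  then have "integral {0..t} (\<lambda>s. T (t - s) (k s)) = x t - T t (x 0)"
    by (simp add: integral_unique)
  then show "x t = T t (x 0) + integral {0..t} (\<lambda>s. T (t - s) (k s))"
    by simp
qed

text \<open>Smoothness of the two classes makes a pointwise solution \<open>x = (m - A)\<^sup>-\<^sup>1 (m w - w' + f)\<close> of the
  stationary equation differentiable; \<open>x - w\<close> and its derivative vanish at infinity by Barbalat.\<close>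

lemma solves_imp_asymptotic_mild_solution:
  assumes m: "m \<in> resolvent_set DA A" and f: "f \<in> BUC"
    and eq: "solves m (buc_class f) (RD (- 1) (RD (- 1) q))" and smooth: "buc_class f = RD (- 1) p"
  obtains x where "asymptotic_mild_solution T f x" "buc_class x = RD (- 1) (RD (- 1) q)"
proof -
  let ?y = "RD (- 1) (RD (- 1) q)"
  let ?Q = "resolvent DA A m"
  note Q = resolvent_A[OF m]
  note Q_simps = bounded_clinearD(2-)[OF Q(1)]
  obtain f1 where f1: "f1 \<in> D_dom" "RD (- 1) p = buc_class f1"
    using RD_range_D_dom[of p] by metis
  obtain v where v: "v \<in> D_dom" "RD (- 1) q = buc_class v"
    using RD_range_D_dom[of q] by metis
  obtain w where w: "w \<in> D_dom" "?y = buc_class w" "\<And>t. t \<ge> 0 \<Longrightarrow> hderiv w t = (- 1) *\<^sub>C w t - v t"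
    using RD_solution[OF D_domD(1)[OF v(1)], of "- 1"] v(2) by (metis one_complex.simps(1) uminus_complex.simps(1) zero_neq_neg_one)
  \<comment> \<open>Equals the derivative of w on the half line. The second factor R(-1) makes v,
    and hence w', differentiable, so that b and x are.\<close>
  define w' where "w' t = (- 1) *\<^sub>C w t - v t" for t
  have w': "w' \<in> D_dom"
    unfolding w'_def[abs_def] by (rule D_dom_diff(1)[OF D_dom_bounded_linear(1)[OF w(1) bounded_linear_scaleC] v(1)])
  define b where "b t = m *\<^sub>C w t - w' t + f1 t" for t
  have b: "b \<in> D_dom"
    unfolding b_def[abs_def]
    by (rule D_dom_add(1)[OF D_dom_diff(1)[OF D_dom_bounded_linear(1)[OF w(1) bounded_linear_scaleC] w'] f1(1)])
  define x where "x t = ?Q (b t)" for t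
  have x: "x \<in> D_dom"
    unfolding x_def[abs_def] by (rule D_dom_bounded_linear(1)[OF b bounded_clinearD(1)[OF Q(1)]])
  note B = D_domD(1)[OF w(1)] D_domD(1)[OF w'] D_domD(1)[OF b] D_domD(1)[OF x] D_domD(1)[OF f1(1)] D_domD(1)[OF v(1)]
  have class_w': "buc_class w' = - ?y - RD (- 1) q"
    unfolding w'_def[abs_def] w(2) unfolding v(2)
    using B by (simp add: buc_class_diff[symmetric] buc_class_minus[symmetric] BUC_minus)
  have class_b: "buc_class b = m *\<^sub>C ?y - buc_class w' + RD (- 1) p"
    unfolding b_def[abs_def] w(2) f1(2)
    using B by (simp add: buc_class_diff buc_class_add buc_class_scaleC BUC_diff BUC_scaleC)
  \<comment> \<open>\<open>solves\<close> is the stationary equation with R(-1) applied. Injectivity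
    of R(-1) removes it and identifies the class of x.\<close>
  have "RD (- 1) (buc_class x) = RD (- 1) ?y"
  proof -
    have "buc_class x = lift_quot ?Q (buc_class b)"
      unfolding x_def[abs_def] by (rule lift_quot_class[OF bounded_clinearD(1)[OF Q(1)] B(3), symmetric])
    then have "RD (- 1) (buc_class x) = lift_quot ?Q (RD (- 1) (buc_class b))"
      using RD_lift[OF _ Q(1), of "- 1"] by simp
    also have "RD (- 1) (buc_class b) = RD (- 1) (buc_class f) + ?y + (m + 1) *\<^sub>C RD (- 1) ?y"
      unfolding class_b class_w' smooth
      by (simp add: D.R_simps scaleC_add_left)
    finally show ?thesis
      using eq by (simp add: solves_def)
  qed
  then have "RD (- 1) (buc_class x - ?y) = 0"
    by (simp add: D.R_simps)
  then have "buc_class x - ?y = 0"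
    by (rule D.R_inj[rotated]) simp
  then have class_x: "buc_class x = ?y"
    by simp
  define d where "d t = w t - x t" for t
  have d: "d \<in> D_dom" "\<And>t. t \<ge> 0 \<Longrightarrow> hderiv d t = hderiv w t - hderiv x t"
    unfolding d_def[abs_def] using D_dom_diff[OF w(1) x] by auto
  have dC0: "d \<in> C0"
    using class_x w(2) B by (simp add: d_def[abs_def] buc_class_eq_iff[symmetric])
  have dC0': "hderiv d \<in> C0"
    by (rule Barbalat_C0[OF d(1) dC0])
  \<comment> \<open>The forcing for which x' = A x + k holds exactly: A x = m x - b and b = m w - w'
    + f1, so the defect is f1 + m d - d' with d = w - x.\<close>
  define k where "k t = f1 t + (m *\<^sub>C d t - hderiv d t)" for t
  have kC0: "(\<lambda>t. k t - f1 t) \<in> C0"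
    using C0_diff[OF C0_scaleC[OF dC0, of m] dC0'] by (simp add: k_def)
  have k: "k \<in> BUC"
    unfolding k_def[abs_def] by (intro BUC_add BUC_diff BUC_scaleC C0_BUC dC0 dC0' B)
  have "mild_solution k x"
  proof (rule classical_imp_mild_solution[OF k])
    fix t :: real assume t: "t \<ge> 0"
    show "x t \<in> DA"
      unfolding x_def by (rule Q(3))
    have "A (x t) = m *\<^sub>C x t - b t"
      using Q(4)[of "b t"] by (simp add: x_def algebra_simps)
    then have "A (x t) + k t = hderiv x t"
      using w(3)[OF t] d(2)[OF t] unfolding b_def k_def d_def w'_def by (simp add: scaleC.diff_right)
    then show "(x has_vector_derivative A (x t) + k t) (at t within {0..})"
      using D_domD(3)[OF x t] by simp
  qed
  moreover have "buc_class k = buc_class f"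
    using kC0 k B smooth f1(2) by (simp add: buc_class_eq_iff)
  ultimately have "asymptotic_mild_solution T f x"
    using asymptotic_mild_solution_iff[OF f] k B by blast
  then show ?thesis
    using that class_x by blast
qed

text \<open>Each operator in the equation commutes with P, but P is additive only on classes with
  spectrum in the union of K and L, so this is checked for every summand.\<close>

lemma solves_splitting:
  assumes P: "D.splitting K L P" and m: "m \<in> resolvent_set DA A"
    and eq: "solves m f y" and fy: "D.spec f \<subseteq> K \<union> L" "D.spec y \<subseteq> K \<union> L"
  shows "solves m (P f) (P y)"
proof -
  let ?R = "RD (- 1) :: 'a buc_quot \<Rightarrow> 'a buc_quot" and ?Q = "lift_quot (resolvent DA A m)"
  have R: "D.commuting ?R"
    by (rule D.commuting_R) simp
  have Q: "D.commuting ?Q"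
    by (rule commuting_lift[OF resolvent_A(1)[OF m]])
  have S: "D.commuting (\<lambda>x. (m + 1) *\<^sub>C x)"
    by (auto simp: D.commuting_def bounded_clinear_scaleC D.R_simps)
  have comm: "P (H x) = H (P x)" if "D.commuting H" "D.spec x \<subseteq> K \<union> L" for H x
    by (rule D.splittingD(4)[OF P that(2,1)])
  have add: "P (x + x') = P x + P x'" if "D.spec x \<subseteq> K \<union> L" "D.spec x' \<subseteq> K \<union> L" for x x'
    by (rule D.splittingD(5)[OF P that])
  have KL: "D.spec (H x) \<subseteq> K \<union> L" if "D.commuting H" "D.spec x \<subseteq> K \<union> L" for H x
    using D.spec_commuting[OF that(1)] that(2) by blast
  have KL': "D.spec (x + x') \<subseteq> K \<union> L" if "D.spec x \<subseteq> K \<union> L" "D.spec x' \<subseteq> K \<union> L" for x x'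
    using D.spec_add[of x x'] that by blast
  have "?R (P y) = P (?R y)"
    by (rule comm[OF R fy(2), symmetric])
  also have "\<dots> = P (?Q (?R f + y + (m + 1) *\<^sub>C ?R y))"
    using eq by (simp add: solves_def)
  also have "\<dots> = ?Q (P (?R f + y + (m + 1) *\<^sub>C ?R y))"
    by (intro comm Q KL' KL[OF R] KL[OF S] fy)
  also have "P (?R f + y + (m + 1) *\<^sub>C ?R y) = P (?R f + y) + P ((m + 1) *\<^sub>C ?R y)"
    by (intro add KL' KL[OF R] KL[OF S] fy)
  also have "P (?R f + y) = P (?R f) + P y"
    by (intro add KL[OF R] fy)
  also have "P (?R f) = ?R (P f)"
    by (rule comm[OF R fy(1)])
  also have "P ((m + 1) *\<^sub>C ?R y) = (m + 1) *\<^sub>C P (?R y)"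
    by (rule comm[OF S KL[OF R fy(2)]])
  also have "P (?R y) = ?R (P y)"
    by (rule comm[OF R fy(2)])
  finally show ?thesis
    by (simp add: solves_def)
qed

section \<open>Spectrum of a solution and selection of the required one\<close>

lemma spec_solution_subset:
  assumes "asymptotic_mild_solution T f u" "f \<in> BUC"
  shows "sp u \<subseteq> sp f \<union> imag_spectrum DA A"
proof
  fix \<xi> assume \<xi>: "\<xi> \<in> sp u"
  show "\<xi> \<in> sp f \<union> imag_spectrum DA A"
  proof (rule ccontr)
    let ?m = "\<i> * complex_of_real \<xi>"
    assume n: "\<xi> \<notin> sp f \<union> imag_spectrum DA A"
    then have m: "?m \<in> resolvent_set DA A"
      by (simp add: imag_spectrum_def spectrum_def)
    have "\<xi> \<notin> D.spec (buc_class u)"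
    proof (rule D.spec_solution)
      show "D.commuting (lift_quot (resolvent DA A ?m))"
        by (rule commuting_lift[OF resolvent_A(1)[OF m]])
      show "RD (- 1) (buc_class u) = lift_quot (resolvent DA A ?m)
          (RD (- 1) (buc_class f) + buc_class u + (?m + 1) *\<^sub>C RD (- 1) (buc_class u))"
        using asymptotic_mild_solution_solves[OF assms m] by (simp add: solves_def)
    qed (use n in \<open>simp add: sp_eq_spec\<close>)
    with \<xi> show False by (simp add: sp_eq_spec)
  qed
qed

lemma asymptotic_mild_solution_diff:
  assumes "asymptotic_mild_solution T f u" "asymptotic_mild_solution T (\<lambda>t. 0) v" "f \<in> BUC"
  shows "asymptotic_mild_solution T f (\<lambda>t. u t - v t)"
proof -
  obtain g where g: "u \<in> BUC" "g \<in> BUC" "buc_class g = buc_class f" "mild_solution g u"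
    using assms(1) asymptotic_mild_solution_iff[OF assms(3)] by blast
  obtain k where k: "v \<in> BUC" "k \<in> BUC" "buc_class k = buc_class (\<lambda>t. 0)" "mild_solution k v"
    using assms(2) asymptotic_mild_solution_iff[OF BUC_0] by blast
  have "buc_class (\<lambda>t. g t - k t) = buc_class f"
    using g k by (simp add: buc_class_diff[symmetric] buc_class_zero[symmetric])
  moreover have "mild_solution (\<lambda>t. g t - k t) (\<lambda>t. u t - v t)"
    by (rule mild_solution_diff[OF g(4) k(4) g(2) k(2)])
  ultimately show ?thesis
    using asymptotic_mild_solution_iff[OF assms(3)] BUC_diff[OF g(1) k(1)] BUC_diff[OF g(2) k(2)] by blast
qed

lemma asymptotic_mild_solution_zero:
  assumes "f \<in> C0"
  shows "asymptotic_mild_solution T f (\<lambda>t. 0)"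
proof -
  have "mild_solution (\<lambda>t. 0) (\<lambda>t. 0)"
    unfolding mild_solution_def
  proof (intro allI impI)
    fix t :: real assume t: "t \<ge> 0"
    have "integral {0..t} (\<lambda>s. T (t - s) 0) = integral {0..t} (\<lambda>s. 0 :: 'a)"
      by (rule integral_cong) (simp add: T_simps)
    then show "0 = T t 0 + integral {0..t} (\<lambda>s. T (t - s) 0)"
      using t by (simp add: T_simps)
  qed
  moreover have "buc_class (\<lambda>t. 0) = buc_class f"
    using assms C0_BUC[OF assms] by (simp add: buc_class_zero[symmetric] buc_class_eq_0_iff)
  ultimately show ?thesis
    using asymptotic_mild_solution_iff[OF C0_BUC[OF assms]] BUC_0 by blast
qed

lemma exists_solution_spectrum:
  assumes f: "f \<in> BUC" and u: "asymptotic_mild_solution T f u"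
    and disjoint: "sp f \<inter> closure (imag_spectrum DA A - sp f) = {}"
    and bounded: "bounded (sp f) \<or> bounded (closure (imag_spectrum DA A - sp f))"
  shows "\<exists>w. asymptotic_mild_solution T f w \<and> sp w \<subseteq> sp f"
proof (cases "imag_spectrum DA A = UNIV")
  case True
  \<comment> \<open>If the axis has no resolvent point, the hypothesis makes the complement of
    \<open>sp f\<close> closed as well. By connectedness \<open>sp f\<close> is empty, where f is in
    \<open>C0\<close> and 0 is a solution, or the whole line, where u itself will do.\<close>
  have cS: "closed (sp f)"
    by (simp add: sp_eq_spec D.closed_spec)
  have "sp f = {} \<or> sp f = UNIV"
  proof (rule clopen[THEN iffD1], intro conjI cS)
    have "sp f \<inter> closure (- sp f) = {}"
      using disjoint True by (simp add: Compl_eq_Diff_UNIV)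
    then have "closure (- sp f) \<subseteq> - sp f"
      by blast
    then have "closed (- sp f)"
      using closure_subset_eq by blast
    then show "open (sp f)"
      by (simp add: open_closed)
  qed
  then show ?thesis
  proof
    assume "sp f = {}"
    then have "buc_class f = 0"
      using D.spec_empty_imp_zero by (simp add: sp_eq_spec)
    then have "asymptotic_mild_solution T f (\<lambda>t. 0)"
      using f by (intro asymptotic_mild_solution_zero) (simp add: buc_class_eq_0_iff)
    moreover have "sp (\<lambda>t. 0 :: 'a) = {}"
      by (simp add: sp_eq_spec buc_class_zero[symmetric] D.spec_zero)
    ultimately show ?thesis by (metis empty_subsetI)
  next
    assume "sp f = UNIV"
    then show ?thesis using u by auto
  qed
next
  case False
  then obtain \<xi> where "\<xi> \<notin> imag_spectrum DA A" by blast
  then have m: "\<i> * complex_of_real \<xi> \<in> resolvent_set DA A" (is "?m \<in> _")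
    by (simp add: imag_spectrum_def spectrum_def)
  define S where "S = sp f"
  define L where "L = closure (imag_spectrum DA A - sp f)"
  let ?y = "buc_class u" and ?f = "buc_class f"
  have uB: "u \<in> BUC"
    using u by (simp add: asymptotic_mild_solution_def)
  have S: "closed S" "D.spec ?f = S"
    by (simp_all add: S_def sp_eq_spec D.closed_spec)
  have y: "D.spec ?y \<subseteq> S \<union> L"
    using spec_solution_subset[OF u f] closure_subset[of "imag_spectrum DA A - sp f"]
    by (auto simp: S_def L_def sp_eq_spec)
  have eq: "solves ?m ?f ?y"
    by (rule asymptotic_mild_solution_solves[OF u f m])
  have SL: "S \<inter> L = {}" using disjoint by (simp add: S_def L_def)
  have cL: "closed L" by (simp add: L_def)
  from bounded consider "compact S" | "compact L"
    using S(1) cL by (auto simp: S_def L_def compact_eq_bounded_closed)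
  then show ?thesis
  proof cases
    case 1
    obtain P :: "'a buc_quot \<Rightarrow> 'a buc_quot" where P: "D.splitting S L P"
      using D.spectral_splitting[OF 1 cL SL] by blast
    have f': "D.spec ?f \<subseteq> S \<union> L" using S(2) by blast
    note Pf = D.splittingD(2,3)[OF P f']
    \<comment> \<open>Its spectrum lies in both S and L, hence is empty. So P fixes the class of f,
      which makes that class smooth.\<close>
    have "?f - P ?f = 0"
      using Pf(1) S(2) SL by (intro D.spec_empty_imp_zero) blast
    then have Pff: "P ?f = ?f" by simp
    obtain p where p: "?f = RD (- 1) p"
      using Pf(2) unfolding Pff by blast
    obtain q where q: "P ?y = RD (- 1) (RD (- 1) q)"
      using D.splittingD(3)[OF P y] by blast
    have Py: "D.spec (P ?y) \<subseteq> S"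
      using D.splittingD(1)[OF P y] by blast
    have "solves ?m ?f (RD (- 1) (RD (- 1) q))"
      using solves_splitting[OF P m eq f' y] Pff q by simp
    then obtain w where w: "asymptotic_mild_solution T f w" "buc_class w = RD (- 1) (RD (- 1) q)"
      by (rule solves_imp_asymptotic_mild_solution[OF m f _ p])
    have "sp w \<subseteq> sp f"
      using Py q w(2) by (simp add: sp_eq_spec S_def)
    with w(1) show ?thesis by blast
  next
    case 2
    have LS: "L \<inter> S = {}" using SL by blast
    obtain P :: "'a buc_quot \<Rightarrow> 'a buc_quot" where P: "D.splitting L S P"
      using D.spectral_splitting[OF 2 S(1) LS] by blast
    have y': "D.spec ?y \<subseteq> L \<union> S" using y by blast
    have f': "D.spec ?f \<subseteq> L \<union> S" using S(2) by blast
    \<comment> \<open>The spectrum of f lies in S and that of its projection in L, so the projection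
      has none; P u then solves the homogeneous equation.\<close>
    have Pf: "P ?f = 0"
      using D.splittingD(1)[OF P f'] S(2) SL by (intro D.spec_empty_imp_zero) blast
    obtain q where q: "P ?y = RD (- 1) (RD (- 1) q)"
      using D.splittingD(3)[OF P y'] by blast
    have Py: "D.spec (?y - P ?y) \<subseteq> S"
      using D.splittingD(2)[OF P y'] by blast
    have "solves ?m (buc_class (\<lambda>t. 0)) (RD (- 1) (RD (- 1) q))"
      using solves_splitting[OF P m eq f' y'] Pf q by (simp add: buc_class_zero[symmetric])
    \<comment> \<open>The zero forcing is smooth, so only P u has to be lifted; u minus the lifted
      solution keeps the spectrum in S.\<close>
    moreover have "buc_class (\<lambda>t. 0 :: 'a) = RD (- 1) 0"
      by (simp add: buc_class_zero[symmetric] D.R_simps)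
    ultimately obtain x where x: "asymptotic_mild_solution T (\<lambda>t. 0) x" "buc_class x = RD (- 1) (RD (- 1) q)"
      by (rule solves_imp_asymptotic_mild_solution[OF m BUC_0])
    have "x \<in> BUC" using x(1) by (simp add: asymptotic_mild_solution_def)
    then have "buc_class (\<lambda>t. u t - x t) = ?y - P ?y"
      using uB x(2) q by (simp add: buc_class_diff[symmetric])
    then have "sp (\<lambda>t. u t - x t) \<subseteq> sp f"
      using Py by (simp add: sp_eq_spec S_def)
    then show ?thesis
      using asymptotic_mild_solution_diff[OF u x(1) f] by blast
  qed
qed

end

theorem theorem3p13:
  fixes T :: "real \<Rightarrow> 'a::complex_banach \<Rightarrow> 'a"
    and DA :: "'a set" and A :: "'a \<Rightarrow> 'a"
    and f :: "real \<Rightarrow> 'a"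
  assumes "C0_semigroup T"
    and "is_generator T DA A"
    and "f \<in> BUC_C"
    and "sp f \<inter> closure (imag_spectrum DA A - sp f) = {}"
    and "bounded (sp f) \<or> bounded (closure (imag_spectrum DA A - sp f))"
    and "\<exists>u\<in>BUC_C. asymptotic_mild_solution T f u"
  shows "\<exists>w. asymptotic_mild_solution T f w \<and> sp w \<subseteq> sp f"
proof -
  interpret semigroup_generator T DA A
    by (rule semigroup_generator.intro) fact+
  have "f \<in> BUC"
    using assms(3) by (simp add: BUC_C_def)
  with assms(4-6) show ?thesis
    using exists_solution_spectrum by blast
qed

end
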